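(* Let $(A(u))$, $u\in\mathbb{R}^n$, be a measurable family of real $n\times n$ matrices which, where defined, are non-singular, self-adjoint and commute with each other. Fix an orthogonal matrix $C$ with $C^{-1}A(u)C=\mathrm{diag}(a_1(u),\dots,a_n(u))$ for all $u$ for which $A(u)$ is defined. For $\varepsilon\in\{-1,1\}^n$ put $\Omega_\varepsilon=\{u\in\mathbb{R}^n:(\mathrm{sgn}\,a_1(u),\dots,\mathrm{sgn}\,a_n(u))=\varepsilon\}$. Assume that for every $\varepsilon\in\{-1,1\}^n$ the system of equations $|a_k(u)|=e^{t_k}$, $k=1,\dots,n$, has a unique solution $u=b(t)=(b_1(t),\dots,b_n(t))\in\Omega_\varepsilon$ for almost every $t=(t_1,\dots,t_n)\in\mathbb{R}^n$, so that one has a measurable map $\mathbb{R}^n\to\Omega_\varepsilon$, $t\mapsto b(t)$, which is almost bijective. Then the set $\mathcal{A}_A$ of Hausdorff operators associated with $A$ is a non-closed commutative subalgebra without unit of the Banach algebra $\mathcal{L}(L^2(\mathbb{R}^n))$ of bounded operators on $L^2(\mathbb{R}^n)$.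
   Context: Let $K$ be a locally Lebesgue integrable function on $\mathbb{R}^n$ such that $A(u)$ is defined and satisfies $\det A(u)\neq0$ for almost every $u$ in the support of $K$. The Hausdorff operator with kernel $K$ is $\mathcal{H}_{K,A}f(x)=\int_{\mathbb{R}^n}K(u)f(A(u)x)\,du$, where $x\in\mathbb{R}^n$ is a column vector. The condition $|\det A(u)|^{-1/2}K(u)\in L^1(\mathbb{R}^n)$ guarantees that $\mathcal{H}_{K,A}$ is bounded on $L^2(\mathbb{R}^n)$. For the fixed family $A$, $$\mathcal{A}_A=\{\mathcal{H}_{K,A}: |\det A(u)|^{-1/2}K(u)\in L^1(\mathbb{R}^n)\}.$$ Since the matrices $A(u)$ are self-adjoint and commute, they are simultaneously diagonalized by one orthogonal matrix $C$; $a_1(u),\dots,a_n(u)$ are the eigenvalues of $A(u)$ with multiplicities.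
   Formalization: "Almost bijective" is taken to include that b and its inverse map null sets to null sets (false otherwise); the algebra is taken as displayed, without requiring K locally integrable (closure under products can fail with it), and the support of K is read modulo null sets. *)

theory Defs
  imports "HOL-Analysis.Analysis"
begin

section \<open>The complex Hilbert space of square-integrable functions\<close>

definition square_integrable :: "('a::euclidean_space \<Rightarrow> complex) \<Rightarrow> bool" where
  "square_integrable f \<longleftrightarrow>
     f \<in> borel_measurable lebesgue \<and> integrable lebesgue (\<lambda>x. (cmod (f x))\<^sup>2)"

definition l2_rel :: "('a::euclidean_space \<Rightarrow> complex) \<Rightarrow> ('a \<Rightarrow> complex) \<Rightarrow> bool" where
  "l2_rel f g \<longleftrightarrow> square_integrable f \<and> square_integrable g \<and> (AE x in lebesgue. f x = g x)"

lemma square_integrable_zero: "square_integrable (\<lambda>x. 0)"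
  by (simp add: square_integrable_def)

lemma square_integrable_mult_left:
  assumes "square_integrable f"
  shows "square_integrable (\<lambda>x. c * f x)"
  using assms by (auto simp: square_integrable_def norm_mult power_mult_distrib)

lemma square_integrable_add:
  assumes "square_integrable f" "square_integrable g"
  shows "square_integrable (\<lambda>x. f x + g x)"
proof -
  have [measurable]: "f \<in> borel_measurable lebesgue" "g \<in> borel_measurable lebesgue"
    using assms by (auto simp: square_integrable_def)
  have bound: "(cmod (z + w))\<^sup>2 \<le> 2 * (cmod z)\<^sup>2 + 2 * (cmod w)\<^sup>2" for z w :: complex
  proof -
    have "(cmod (z + w))\<^sup>2 \<le> (cmod z + cmod w)\<^sup>2"
      by (intro power_mono norm_triangle_ineq) auto
    also have "\<dots> \<le> 2 * (cmod z)\<^sup>2 + 2 * (cmod w)\<^sup>2"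
      using sum_squares_bound[of "cmod z" "cmod w"] by (simp add: power2_sum)
    finally show ?thesis .
  qed
  have "integrable lebesgue (\<lambda>x. 2 * (cmod (f x))\<^sup>2 + 2 * (cmod (g x))\<^sup>2)"
    using assms by (auto simp: square_integrable_def)
  then have "integrable lebesgue (\<lambda>x. (cmod (f x + g x))\<^sup>2)"
    by (rule Bochner_Integration.integrable_bound) (use bound in auto)
  then show ?thesis by (simp add: square_integrable_def)
qed

lemma square_integrable_uminus: "square_integrable f \<Longrightarrow> square_integrable (\<lambda>x. - f x)"
  using square_integrable_mult_left[of f "-1"] by simp

lemma square_integrable_diff:
  "square_integrable f \<Longrightarrow> square_integrable g \<Longrightarrow> square_integrable (\<lambda>x. f x - g x)"
  using square_integrable_add[of f "\<lambda>x. - g x"] square_integrable_uminus[of g] by simp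

lemma integrable_inner_square_integrable:
  assumes "square_integrable f" "square_integrable g"
  shows "integrable lebesgue (\<lambda>x. inner (f x) (g x))"
proof -
  have [measurable]: "f \<in> borel_measurable lebesgue" "g \<in> borel_measurable lebesgue"
    using assms by (auto simp: square_integrable_def)
  have bound: "\<bar>inner z w\<bar> \<le> (cmod z)\<^sup>2 + (cmod w)\<^sup>2" for z w :: complex
  proof -
    have "\<bar>inner z w\<bar> \<le> cmod z * cmod w" by (rule Cauchy_Schwarz_ineq2)
    also have "\<dots> \<le> 2 * cmod z * cmod w" by simp
    also have "\<dots> \<le> (cmod z)\<^sup>2 + (cmod w)\<^sup>2" by (rule sum_squares_bound)
    finally show ?thesis .
  qed
  have "integrable lebesgue (\<lambda>x. (cmod (f x))\<^sup>2 + (cmod (g x))\<^sup>2)"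
    using assms by (auto simp: square_integrable_def)
  then show ?thesis
    by (rule Bochner_Integration.integrable_bound) (use bound in auto)
qed

quotient_type (overloaded) 'a l2 = "'a::euclidean_space \<Rightarrow> complex" / partial: l2_rel
proof (rule part_equivpI)
  show "\<exists>f. l2_rel f (f :: 'a \<Rightarrow> complex)"
    using square_integrable_zero by (auto simp: l2_rel_def)
  show "symp (l2_rel :: ('a \<Rightarrow> complex) \<Rightarrow> _)"
    by (auto simp: symp_def l2_rel_def eq_commute)
  show "transp (l2_rel :: ('a \<Rightarrow> complex) \<Rightarrow> _)"
    by (auto simp: transp_def l2_rel_def)
qed

text \<open>The real inner product is \<open>Re \<integral>f (cnj g)\<close>; it induces the usual norm.\<close>

instantiation l2 :: (euclidean_space) real_inner
begin

lift_definition zero_l2 :: "'a l2" is "\<lambda>x. 0"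
  by (simp add: l2_rel_def square_integrable_zero)

lift_definition plus_l2 :: "'a l2 \<Rightarrow> 'a l2 \<Rightarrow> 'a l2" is "\<lambda>f g x. f x + g x"
  by (auto simp: l2_rel_def square_integrable_add)

lift_definition uminus_l2 :: "'a l2 \<Rightarrow> 'a l2" is "\<lambda>f x. - f x"
  by (auto simp: l2_rel_def square_integrable_uminus)

lift_definition minus_l2 :: "'a l2 \<Rightarrow> 'a l2 \<Rightarrow> 'a l2" is "\<lambda>f g x. f x - g x"
  by (auto simp: l2_rel_def square_integrable_diff)

lift_definition scaleR_l2 :: "real \<Rightarrow> 'a l2 \<Rightarrow> 'a l2" is "\<lambda>r f x. complex_of_real r * f x"
  by (auto simp: l2_rel_def square_integrable_mult_left)

lift_definition inner_l2 :: "'a l2 \<Rightarrow> 'a l2 \<Rightarrow> real"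
  is "\<lambda>f g. integral\<^sup>L lebesgue (\<lambda>x. inner (f x) (g x))"
proof -
  fix f f' g g' :: "'a \<Rightarrow> complex"
  assume rel: "l2_rel f f'" "l2_rel g g'"
  then have [measurable]: "f \<in> borel_measurable lebesgue" "f' \<in> borel_measurable lebesgue"
      "g \<in> borel_measurable lebesgue" "g' \<in> borel_measurable lebesgue"
    by (auto simp: l2_rel_def square_integrable_def)
  have "AE x in lebesgue. inner (f x) (g x) = inner (f' x) (g' x)"
    using rel by (auto simp: l2_rel_def)
  then show "integral\<^sup>L lebesgue (\<lambda>x. inner (f x) (g x)) =
      integral\<^sup>L lebesgue (\<lambda>x. inner (f' x) (g' x))"
    by (intro integral_cong_AE) auto
qed

definition norm_l2 :: "'a l2 \<Rightarrow> real" where "norm_l2 f = sqrt (inner f f)"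
definition dist_l2 :: "'a l2 \<Rightarrow> 'a l2 \<Rightarrow> real" where "dist_l2 f g = norm (f - g)"
definition sgn_l2 :: "'a l2 \<Rightarrow> 'a l2" where "sgn_l2 f = scaleR (inverse (norm f)) f"
definition uniformity_l2 :: "('a l2 \<times> 'a l2) filter" where
  "uniformity_l2 = (INF e\<in>{0<..}. principal {(f, g). dist f g < e})"
definition open_l2 :: "'a l2 set \<Rightarrow> bool" where
  "open_l2 U \<longleftrightarrow> (\<forall>f\<in>U. eventually (\<lambda>(f', g). f' = f \<longrightarrow> g \<in> U) uniformity)"

instance
proof
  fix f g h :: "'a l2" and r s :: real
  show "f + g + h = f + (g + h)"
    by transfer (auto simp: l2_rel_def add.assoc intro!: square_integrable_add)
  show "f + g = g + f"
    by transfer (auto simp: l2_rel_def add.commute intro!: square_integrable_add)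
  show "0 + f = f"
    by transfer (auto simp: l2_rel_def)
  show "- f + f = 0"
    by transfer (auto simp: l2_rel_def square_integrable_zero)
  show "f - g = f + - g"
    by transfer (auto simp: l2_rel_def intro!: square_integrable_diff)
  show "r *\<^sub>R (f + g) = r *\<^sub>R f + r *\<^sub>R g"
    by transfer (auto simp: l2_rel_def distrib_left
        intro!: square_integrable_add square_integrable_mult_left)
  show "(r + s) *\<^sub>R f = r *\<^sub>R f + s *\<^sub>R f"
    by transfer (auto simp: l2_rel_def distrib_right
        intro!: square_integrable_add square_integrable_mult_left)
  show "r *\<^sub>R s *\<^sub>R f = (r * s) *\<^sub>R f"
    by transfer (auto simp: l2_rel_def mult.assoc intro!: square_integrable_mult_left)
  show "1 *\<^sub>R f = f"
    by transfer (auto simp: l2_rel_def)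
  show "dist f g = norm (f - g)" by (rule dist_l2_def)
  show "sgn f = scaleR (inverse (norm f)) f" by (rule sgn_l2_def)
  show "inner f g = inner g f"
    by transfer (simp add: inner_commute)
  show "inner (f + g) h = inner f h + inner g h"
    by transfer (simp add: l2_rel_def inner_add_left integrable_inner_square_integrable)
  show "inner (r *\<^sub>R f) g = r * inner f g"
    by transfer (simp flip: scaleR_conv_of_real)
  show "0 \<le> inner f f"
    by transfer (simp add: integral_nonneg_AE)
  show "inner f f = 0 \<longleftrightarrow> f = 0"
  proof transfer
    fix f :: "'a \<Rightarrow> complex" assume "l2_rel f f"
    then have f: "square_integrable f" by (simp add: l2_rel_def)
    have "integral\<^sup>L lebesgue (\<lambda>x. inner (f x) (f x)) = 0 \<longleftrightarrow> (AE x in lebesgue. inner (f x) (f x) = 0)"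
      using f by (intro integral_nonneg_eq_0_iff_AE integrable_inner_square_integrable) auto
    then show "integral\<^sup>L lebesgue (\<lambda>x. inner (f x) (f x)) = 0 \<longleftrightarrow> l2_rel f (\<lambda>x. 0)"
      using f by (simp add: l2_rel_def square_integrable_zero)
  qed
  show "norm f = sqrt (inner f f)" by (rule norm_l2_def)
qed (simp_all add: uniformity_l2_def open_l2_def)

end

section \<open>Bounded complex-linear operators\<close>

lift_definition scaleC_l2 :: "complex \<Rightarrow> 'a::euclidean_space l2 \<Rightarrow> 'a l2" is "\<lambda>c f x. c * f x"
  by (auto simp: l2_rel_def square_integrable_mult_left)

lemma norm_scaleC_l2: "norm (scaleC_l2 c f) = cmod c * norm f"
proof -
  have "inner (scaleC_l2 c f) (scaleC_l2 c f) = (cmod c)\<^sup>2 * inner f f"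
    by transfer (simp add: dot_square_norm norm_mult power_mult_distrib)
  then show ?thesis by (simp add: norm_l2_def real_sqrt_mult)
qed

lemma bounded_linear_scaleC_l2:
  "bounded_linear (scaleC_l2 c :: 'a::euclidean_space l2 \<Rightarrow> 'a l2)"
proof (rule bounded_linear_intro)
  fix f g :: "'a l2" and r :: real
  show "scaleC_l2 c (f + g) = scaleC_l2 c f + scaleC_l2 c g"
    by transfer (auto simp: l2_rel_def distrib_left
        intro!: square_integrable_add square_integrable_mult_left)
  show "scaleC_l2 c (r *\<^sub>R f) = r *\<^sub>R scaleC_l2 c f"
    by transfer (auto simp: l2_rel_def mult.left_commute intro!: square_integrable_mult_left)
  show "norm (scaleC_l2 c f) \<le> norm f * cmod c"
    by (simp add: norm_scaleC_l2)
qed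

definition scaleC_op ::
    "complex \<Rightarrow> ('a::euclidean_space l2 \<Rightarrow>\<^sub>L 'a l2) \<Rightarrow> ('a l2 \<Rightarrow>\<^sub>L 'a l2)" where
  "scaleC_op c T = Blinfun (scaleC_l2 c) o\<^sub>L T"

lemma scaleC_op_apply: "blinfun_apply (scaleC_op c T) f = scaleC_l2 c (blinfun_apply T f)"
  by (simp add: scaleC_op_def bounded_linear_scaleC_l2 bounded_linear_Blinfun_apply)

text \<open>The type \<open>'a l2 \<Rightarrow>\<^sub>L 'a l2\<close> consists of the real-linear bounded operators, normed by the
  operator norm; the Banach algebra of the complex Hilbert space is the following subset.\<close>

definition bounded_operators :: "('a::euclidean_space l2 \<Rightarrow>\<^sub>L 'a l2) set" where
  "bounded_operators =
     {T. \<forall>c f. blinfun_apply T (scaleC_l2 c f) = scaleC_l2 c (blinfun_apply T f)}"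

definition operator_subalgebra :: "('a::euclidean_space l2 \<Rightarrow>\<^sub>L 'a l2) set \<Rightarrow> bool" where
  "operator_subalgebra S \<longleftrightarrow>
     S \<subseteq> bounded_operators \<and> 0 \<in> S \<and>
     (\<forall>T\<in>S. \<forall>U\<in>S. T + U \<in> S) \<and>
     (\<forall>c. \<forall>T\<in>S. scaleC_op c T \<in> S) \<and>
     (\<forall>T\<in>S. \<forall>U\<in>S. T o\<^sub>L U \<in> S)"

definition commutative_operators :: "('a::euclidean_space l2 \<Rightarrow>\<^sub>L 'a l2) set \<Rightarrow> bool" where
  "commutative_operators S \<longleftrightarrow> (\<forall>T\<in>S. \<forall>U\<in>S. T o\<^sub>L U = U o\<^sub>L T)"

definition has_unit :: "('a::euclidean_space l2 \<Rightarrow>\<^sub>L 'a l2) set \<Rightarrow> bool" where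
  "has_unit S \<longleftrightarrow> (\<exists>E\<in>S. \<forall>T\<in>S. E o\<^sub>L T = T \<and> T o\<^sub>L E = T)"

section \<open>Hausdorff operators\<close>

text \<open>A partially defined matrix family is given by a total function \<open>A\<close> together with the set \<open>D\<close>
  of those \<open>u\<close> for which \<open>A u\<close> is meant to be defined.  The support of a kernel is
  taken modulo null sets: the kernel vanishes almost everywhere where \<open>A\<close> is
  undefined or singular.  Local integrability of the kernel is not required: if \<open>\<bar>det (A u)\<bar>\<close> is
  locally bounded it follows from the integrability condition, and otherwise it need not be
  preserved under composition of operators.\<close>

definition hausdorff_kernels ::
    "(real^'n) set \<Rightarrow> (real^'n \<Rightarrow> real^'n^'n) \<Rightarrow> (real^'n \<Rightarrow> complex) set" where
  "hausdorff_kernels D A =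
     {K. K \<in> borel_measurable lebesgue \<and>
         (AE u in lebesgue. K u \<noteq> 0 \<longrightarrow> u \<in> D \<and> det (A u) \<noteq> 0) \<and>
         integrable lebesgue (\<lambda>u. complex_of_real (\<bar>det (A u)\<bar> powr (-1/2)) * K u)}"

lemma hausdorff_kernel_locally_integrable:
  fixes A :: "real^'n \<Rightarrow> real^'n^'n"
  assumes K: "K \<in> hausdorff_kernels D A"
    and bounded: "\<And>u. u \<in> S \<inter> D \<Longrightarrow> \<bar>det (A u)\<bar> \<le> c"
    and S: "S \<in> sets lebesgue"
  shows "set_integrable lebesgue S K"
proof -
  let ?w = "\<lambda>u. complex_of_real (\<bar>det (A u)\<bar> powr (-1/2)) * K u"
  have meas: "K \<in> borel_measurable lebesgue" and int: "integrable lebesgue ?w"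
    and supp: "AE u in lebesgue. K u \<noteq> 0 \<longrightarrow> u \<in> D \<and> det (A u) \<noteq> 0"
    using K by (auto simp: hausdorff_kernels_def)
  have le: "cmod (indicator S u *\<^sub>R K u) \<le> cmod (complex_of_real (c powr (1/2)) * ?w u)"
    if "K u \<noteq> 0 \<longrightarrow> u \<in> D \<and> det (A u) \<noteq> 0" for u
  proof (cases "u \<in> S \<and> K u \<noteq> 0")
    case True
    then have pos: "0 < \<bar>det (A u)\<bar>" and "\<bar>det (A u)\<bar> \<le> c" using that bounded by auto
    then have "\<bar>det (A u)\<bar> powr (1/2) \<le> c powr (1/2)" by (intro powr_mono2) auto
    then have "\<bar>det (A u)\<bar> powr (1/2) * \<bar>det (A u)\<bar> powr (-1/2) \<le>
        c powr (1/2) * \<bar>det (A u)\<bar> powr (-1/2)"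
      by (intro mult_right_mono) auto
    moreover have "\<bar>det (A u)\<bar> powr (1/2) * \<bar>det (A u)\<bar> powr (-1/2) = 1"
      using pos by (simp flip: powr_add)
    ultimately have "1 * cmod (K u) \<le> c powr (1/2) * \<bar>det (A u)\<bar> powr (-1/2) * cmod (K u)"
      by (intro mult_right_mono) auto
    then show ?thesis using True by (simp add: norm_mult mult.assoc)
  qed auto
  show ?thesis
    unfolding set_integrable_def
  proof (rule Bochner_Integration.integrable_bound)
    show "integrable lebesgue (\<lambda>u. complex_of_real (c powr (1/2)) * ?w u)"
      using int by (rule integrable_mult_right)
    show "(\<lambda>u. indicator S u *\<^sub>R K u) \<in> borel_measurable lebesgue"
      using meas S by measurable
    show "AE u in lebesgue. cmod (indicator S u *\<^sub>R K u) \<le>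
        cmod (complex_of_real (c powr (1/2)) * ?w u)"
      using supp le by (auto elim!: eventually_mono)
  qed
qed

definition is_hausdorff_operator ::
    "(real^'n \<Rightarrow> real^'n^'n) \<Rightarrow> (real^'n \<Rightarrow> complex) \<Rightarrow> ((real^'n) l2 \<Rightarrow>\<^sub>L (real^'n) l2) \<Rightarrow> bool" where
  "is_hausdorff_operator A K T \<longleftrightarrow>
     (\<forall>f. square_integrable f \<longrightarrow>
        (AE x in lebesgue. integrable lebesgue (\<lambda>u. K u * f (A u *v x))) \<and>
        square_integrable (\<lambda>x. LINT u|lebesgue. K u * f (A u *v x)) \<and>
        blinfun_apply T (abs_l2 f) = abs_l2 (\<lambda>x. LINT u|lebesgue. K u * f (A u *v x)))"

definition hausdorff_operators ::
    "(real^'n) set \<Rightarrow> (real^'n \<Rightarrow> real^'n^'n) \<Rightarrow> ((real^'n) l2 \<Rightarrow>\<^sub>L (real^'n) l2) set" where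
  "hausdorff_operators D A = {T. \<exists>K\<in>hausdorff_kernels D A. is_hausdorff_operator A K T}"

section \<open>Sign regions and almost bijections\<close>

definition diag_matrix :: "real^'n \<Rightarrow> real^'n^'n" where
  "diag_matrix v = (\<chi> i j. if i = j then v $ i else 0)"

definition sign_vectors :: "(real^'n) set" where
  "sign_vectors = {e. \<forall>k. e $ k \<in> {-1, 1}}"

definition sign_region :: "(real^'n) set \<Rightarrow> (real^'n \<Rightarrow> real^'n) \<Rightarrow> real^'n \<Rightarrow> (real^'n) set" where
  "sign_region D a e = {u\<in>D. \<forall>k. sgn (a u $ k) = e $ k}"

text \<open>A map is almost bijective onto \<open>X\<close> if it has an inverse in the category of almost everywhere
  defined maps modulo null sets.  For composition there to make sense both the map and
  its inverse have to respect null sets; a bijection off null sets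
  alone may still turn null sets into sets of positive measure and vice versa.\<close>

definition almost_bijective :: "('a::euclidean_space \<Rightarrow> 'a) \<Rightarrow> 'a set \<Rightarrow> bool" where
  "almost_bijective b X \<longleftrightarrow>
     (\<exists>N\<in>null_sets lebesgue. \<exists>M\<in>null_sets lebesgue.
        bij_betw b (UNIV - N) (X - M) \<and>
        (\<forall>Z. Z \<subseteq> UNIV - N \<longrightarrow> (Z \<in> null_sets lebesgue \<longleftrightarrow> b ` Z \<in> null_sets lebesgue)))"

end

(* Let u range over D. Under the eigenvalue map a, a kernel becomes an integrable density on the
   group of vectors with nonzero coordinates under componentwise multiplication, and the
   Hausdorff operators become the convolution operators by such densities; the hypotheses on b are
   what lets densities be transported in both directions (Radon-Nikodym). Composition is convolution,
   hence the algebra is commutative and closed under products.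

   Absolutely continuous measures give little mass to small neighbourhoods of the identity, so a unit
   E would act with norm less than one on a vector F supported near (1,...,1), although E F = F.

   For non-closedness, take a sum of widely separated dilates of one bump operator T with
   coefficients of modulus (3/5)^k on the k-th dyadic block. With Rudin-Shapiro signs, block k has
   norm of order (3/5)^k 2^(k/2), so the sum converges in norm; but its total mass, which can be read
   off by testing against dilates of a bump function, is at least of order (6/5)^k for every k. *)
theory Submission
  imports Defs
begin


text \<open>Membership in the algebra asks for a kernel of finite mass, but the operator norm does
  not control the mass; this mismatch shapes the proof. Mass bounds norms from above
  (\<open>norm_mixture_le\<close>). It is bounded from below only through matrix coefficients:
  between vectors of known support, a coefficient sees just the part of the kernel that carries one
  support into the other (\<open>inner_localized_le\<close>). Both negative results rest on this; no
  Fourier or Mellin transform enters. All estimates are made for mixtures of stretchings over an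
  arbitrary sigma-finite measure space, since compositions live on product spaces and dilations on a
  one-point space. Dilations are point masses, not densities, yet they multiply the algebra into
  itself, because translating a density yields a density. The way back to kernels is a Borel right
  inverse \<beta> of \<open>a\<close>, valid off a set that stays null along every translate
  \<open>c * a u\<close>; in logarithmic coordinates this is the translation invariance of Lebesgue
  null sets. The ratio 3/5 could be any q with q * sqrt 2 < 1 < 2 * q.\<close>

section \<open>Linear changes of variables\<close>

(* The library version, measure_orthogonal_image, needs a well-ordered index type. By Vitali,
   a box is a disjoint union of balls up to a null set, and the preimage of a ball is a ball. *)
lemma lborel_distr_orthogonal:
  fixes f :: "'a::euclidean_space \<Rightarrow> 'a"
  assumes f: "orthogonal_transformation f"
  shows "distr lborel borel f = lborel"
proof (rule sym, rule lborel_eqI)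
  have lin: "linear f" using f by (rule orthogonal_transformation_linear)
  then have cont: "continuous_on UNIV f" by (simp add: linear_continuous_on linear_conv_bounded_linear)
  have [measurable]: "f \<in> borel_measurable borel"
    using cont by (rule borel_measurable_continuous_onI)
  obtain g where g: "orthogonal_transformation g" and fg: "\<And>x. f (g x) = x" and gf: "\<And>x. g (f x) = x"
    using orthogonal_transformation_inv[OF f] orthogonal_transformation_bij[OF f]
    by (metis bij_inv_eq_iff)
  have ball: "f -` ball a r = ball (g a) r" for a r
  proof -
    have "f -` ball a r = g ` ball a r" using fg gf by (auto simp: image_iff) (metis mem_ball)
    then show ?thesis by (simp add: image_orthogonal_transformation_ball[OF g])
  qed
  have null: "f -` N \<in> null_sets lebesgue" if "N \<in> null_sets lebesgue" for N
  proof -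
    have "f -` N = g ` N" using fg gf by (auto simp: image_iff) metis
    moreover have "negligible (g ` N)"
      using that g
      by (intro negligible_differentiable_image_negligible)
         (auto simp: negligible_iff_null_sets linear_imp_differentiable_on orthogonal_transformation_linear)
    ultimately show ?thesis by (simp add: negligible_iff_null_sets)
  qed
  fix l u :: 'a assume le: "\<And>b. b \<in> Basis \<Longrightarrow> l \<bullet> b \<le> u \<bullet> b"
  define K where "K = {p. 0 < snd p \<and> ball (fst p) (snd p) \<subseteq> box l u}"
  obtain C where C: "countable C" "C \<subseteq> K"
     "pairwise (\<lambda>i j. disjnt (ball (fst i) (snd i)) (ball (fst j) (snd j))) C"
     "negligible (box l u - (\<Union>i \<in> C. ball (fst i) (snd i)))"
  proof (rule Vitali_covering_theorem_balls[of "box l u" K fst snd])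
    fix x :: 'a and d :: real assume x: "x \<in> box l u" "0 < d"
    obtain k where k: "k > 0" "ball x k \<subseteq> box l u" using x open_box by (meson openE)
    show "\<exists>i. i \<in> K \<and> x \<in> ball (fst i) (snd i) \<and> snd i < d"
      using k x by (intro exI[of _ "(x, min k (d/2))"]) (auto simp: K_def)
  qed
  define W where "W = (\<Union>i \<in> C. ball (fst i) (snd i))"
  have WU: "W \<subseteq> box l u" using C(2) unfolding W_def K_def by blast
  have Wb[measurable]: "W \<in> sets borel" unfolding W_def by (intro borel_open) auto
  \<comment> \<open>Stated for a general map \<open>h\<close>, because it is applied twice: to
    \<open>f\<close>, and to the identity in order to return from the balls to the box.\<close>
  have decomp: "emeasure lborel (h -` box l u) = emeasure lborel (h -` W)"
    if h[measurable]: "h \<in> borel_measurable borel" and n: "h -` (box l u - W) \<in> null_sets lebesgue" for h :: "'a \<Rightarrow> 'a"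
  proof -
    have m[measurable]: "h -` W \<in> sets borel" "h -` (box l u - W) \<in> sets borel"
      using measurable_sets[OF h, of W] measurable_sets[OF h, of "box l u - W"] by auto
    have "h -` box l u = h -` W \<union> h -` (box l u - W)" using WU by auto
    moreover have "h -` (box l u - W) \<in> null_sets lborel"
      using n m(2) by (simp add: null_sets_completion_iff)
    ultimately show ?thesis using m by (simp add: emeasure_Un_null_set)
  qed
  have disj: "disjoint_family_on (\<lambda>i. h -` ball (fst i) (snd i)) C" for h :: "'a \<Rightarrow> 'a"
    using C(3) unfolding disjoint_family_on_def pairwise_def disjnt_def by (metis vimage_Int vimage_empty)
  have "emeasure (distr lborel borel f) (box l u) = emeasure lborel (f -` W)"
    using null C(4) by (simp add: emeasure_distr decomp W_def negligible_iff_null_sets)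
  also have "\<dots> = (\<integral>\<^sup>+i. emeasure lborel (f -` ball (fst i) (snd i)) \<partial>count_space C)"
    unfolding W_def vimage_UN using C(1) disj[of f] by (intro emeasure_UN_countable) (simp_all add: ball)
  also have "\<dots> = (\<integral>\<^sup>+i. emeasure lborel (ball (fst i) (snd i)) \<partial>count_space C)"
  proof (intro nn_integral_cong)
    fix i assume "i \<in> space (count_space C)"
    then have "0 \<le> snd i" using C(2) by (auto simp: K_def)
    then show "emeasure lborel (f -` ball (fst i) (snd i)) = emeasure lborel (ball (fst i) (snd i))"
      by (simp add: ball emeasure_ball)
  qed
  also have "\<dots> = emeasure lborel W"
    unfolding W_def using C(1) disj[of "\<lambda>x. x"] by (intro emeasure_UN_countable[symmetric]) simp_all
  also have "\<dots> = emeasure lborel (box l u)"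
    using decomp[of "\<lambda>x. x"] C(4) by (simp add: W_def negligible_iff_null_sets)
  finally show "emeasure (distr lborel borel f) (box l u) = (\<Prod>b\<in>Basis. (u - l) \<bullet> b)"
    using le by simp
qed simp

text \<open>Coordinatewise reduction to real-valued functions. Borel versions are wanted because,
  unlike Lebesgue measurable functions, they can be composed with measurable maps.\<close>

lemma lebesgue_ex_borel_measurable:
  fixes f :: "'a::euclidean_space \<Rightarrow> 'b::euclidean_space"
  assumes f: "f \<in> borel_measurable lebesgue"
  obtains g where "g \<in> borel_measurable borel" "AE x in lebesgue. f x = g x"
proof -
  have "\<exists>g\<in>borel_measurable lborel. AE x in lborel. f x \<bullet> b = g x" for b
    using f by (intro completion_ex_borel_measurable_real) simp
  then obtain g where g: "\<And>b. g b \<in> borel_measurable lborel" "\<And>b. AE x in lborel. f x \<bullet> b = g b x"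
    by metis
  show thesis
  proof
    show "(\<lambda>x. \<Sum>b\<in>Basis. g b x *\<^sub>R b) \<in> borel_measurable borel"
      using g(1) by simp
    have "AE x in lborel. \<forall>b\<in>Basis. f x \<bullet> b = g b x"
      using g(2) by (intro AE_finite_allI) auto
    then have "AE x in lborel. f x = (\<Sum>b\<in>Basis. g b x *\<^sub>R b)"
    proof eventually_elim
      fix x assume "\<forall>b\<in>Basis. f x \<bullet> b = g b x"
      then have "(\<Sum>b\<in>Basis. g b x *\<^sub>R b) = (\<Sum>b\<in>Basis. (f x \<bullet> b) *\<^sub>R b)" by (intro sum.cong) auto
      then show "f x = (\<Sum>b\<in>Basis. g b x *\<^sub>R b)" by (simp add: euclidean_representation)
    qed
    then show "AE x in lebesgue. f x = (\<Sum>b\<in>Basis. g b x *\<^sub>R b)"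
      by (rule AE_completion)
  qed
qed

lemma sigma_finite_lebesgue: "sigma_finite_measure (lebesgue :: 'a::euclidean_space measure)"
proof
  obtain A :: "'a set set" where "countable A" "A \<subseteq> sets lborel" "\<Union>A = space lborel" "\<forall>a\<in>A. emeasure lborel a \<noteq> \<infinity>"
    using lborel.sigma_finite_countable by blast
  then show "\<exists>A::'a set set. countable A \<and> A \<subseteq> sets lebesgue \<and> \<Union> A = space lebesgue \<and> (\<forall>a\<in>A. emeasure lebesgue a \<noteq> \<infinity>)"
    by (intro exI[of _ A]) (auto simp: subset_iff)
qed

declare transpose_matrix_vector [simp del]

text \<open>The determinant of \<open>diag_matrix y\<close>, and therefore of
  \<open>stretch C y\<close> for orthogonal \<open>C\<close>.\<close>

definition coord_prod :: "real^'n \<Rightarrow> real" where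
  "coord_prod y = (\<Prod>k\<in>UNIV. y $ k)"

definition nonzero_coords :: "real^'n \<Rightarrow> bool" where
  "nonzero_coords y \<longleftrightarrow> (\<forall>k. y $ k \<noteq> 0)"

(* The action of C diag(y) C^T, i.e. of A u for y = a u. *)
definition stretch :: "real^'n^'n \<Rightarrow> real^'n \<Rightarrow> real^'n \<Rightarrow> real^'n" where
  "stretch C y x = C *v (y * (transpose C *v x))"

lemma coord_prod_mult: "coord_prod (y * z) = coord_prod y * coord_prod z"
  by (simp add: coord_prod_def prod.distrib)

lemma coord_prod_eq_0_iff: "coord_prod y = 0 \<longleftrightarrow> \<not> nonzero_coords y"
  by (simp add: coord_prod_def nonzero_coords_def)

lemma nonzero_coords_mult: "nonzero_coords (y * z) \<longleftrightarrow> nonzero_coords y \<and> nonzero_coords z"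
  by (auto simp: nonzero_coords_def)

lemma nonzero_coords_one [simp]: "nonzero_coords 1"
  by (simp add: nonzero_coords_def)

lemma borel_measurable_vec_nth [measurable (raw)]:
  "f \<in> borel_measurable M \<Longrightarrow> (\<lambda>x. f x $ k) \<in> borel_measurable M" for f :: "'a \<Rightarrow> ('b::euclidean_space)^'n"
  by (rule borel_measurable_continuous_on[where f="\<lambda>x. x $ k"]) (auto intro!: continuous_intros)

lemma borel_measurable_vec_lambda [measurable (raw)]:
  fixes f :: "'n::finite \<Rightarrow> 'a \<Rightarrow> real"
  assumes [measurable]: "\<And>k. f k \<in> borel_measurable M"
  shows "(\<lambda>x. \<chi> k. f k x) \<in> borel_measurable M"
proof (subst borel_measurable_euclidean_space, intro ballI)
  fix b :: "real^'n" assume "b \<in> Basis"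
  then obtain k where "b = axis k 1" by (auto simp: Basis_vec_def)
  then show "(\<lambda>x. (\<chi> k. f k x) \<bullet> b) \<in> borel_measurable M"
    by (simp add: inner_axis)
qed

lemma borel_measurable_vec_times [measurable (raw)]:
  fixes f g :: "'a \<Rightarrow> real^'n"
  assumes [measurable]: "f \<in> borel_measurable M" "g \<in> borel_measurable M"
  shows "(\<lambda>x. f x * g x) \<in> borel_measurable M"
  unfolding times_vec_def by measurable

lemma borel_measurable_coord_prod [measurable (raw)]:
  "f \<in> borel_measurable M \<Longrightarrow> (\<lambda>x. coord_prod (f x)) \<in> borel_measurable M"
  unfolding coord_prod_def by measurable

lemma borel_measurable_matrix_vector [measurable (raw)]:
  fixes f :: "'a \<Rightarrow> real^'n"
  assumes [measurable]: "f \<in> borel_measurable M"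
  shows "(\<lambda>x. (C :: real^'n^'m) *v f x) \<in> borel_measurable M"
  unfolding matrix_vector_mult_def by measurable

lemma borel_measurable_stretch [measurable (raw)]:
  assumes [measurable]: "f \<in> borel_measurable M" "g \<in> borel_measurable M"
  shows "(\<lambda>x. stretch C (f x) (g x)) \<in> borel_measurable M"
  unfolding stretch_def by measurable

lemma pred_nonzero_coords [measurable (raw)]:
  "f \<in> borel_measurable M \<Longrightarrow> Measurable.pred M (\<lambda>x. nonzero_coords (f x))"
  unfolding nonzero_coords_def by measurable

lemma transpose_mult_self:
  "orthogonal_matrix C \<Longrightarrow> transpose C *v (C *v x) = x"
  "orthogonal_matrix C \<Longrightarrow> C *v (transpose C *v x) = x"
  by (simp_all add: orthogonal_matrix_def matrix_vector_mul_assoc)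

lemma stretch_stretch:
  "orthogonal_matrix C \<Longrightarrow> stretch C y (stretch C z x) = stretch C (y * z) x"
  by (simp add: stretch_def transpose_mult_self mult.assoc)

lemma nn_integral_orthogonal_matrix:
  fixes C :: "real^'n^'n"
  assumes C: "orthogonal_matrix C" and [measurable]: "g \<in> borel_measurable borel"
  shows "(\<integral>\<^sup>+x. g (C *v x) \<partial>lborel) = (\<integral>\<^sup>+x. g x \<partial>lborel)"
proof -
  have "orthogonal_transformation ((*v) C)"
    using C by (simp add: orthogonal_transformation_matrix)
  then have "(\<integral>\<^sup>+x. g x \<partial>lborel) = (\<integral>\<^sup>+x. g x \<partial>distr lborel borel ((*v) C))"
    by (simp add: lborel_distr_orthogonal)
  then show ?thesis by (simp add: nn_integral_distr)
qed

text \<open>An instance of the scaling law for diagonal affine maps; \<open>T\<close> and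
  \<open>P\<close> translate its sums and products over \<open>Basis\<close> into
  coordinates.\<close>

lemma nn_integral_componentwise_mult:
  fixes y :: "real^'n"
  assumes y: "nonzero_coords y" and [measurable]: "g \<in> borel_measurable borel"
  shows "(\<integral>\<^sup>+x. g x \<partial>lborel) = ennreal \<bar>coord_prod y\<bar> * (\<integral>\<^sup>+x. g (y * x) \<partial>lborel)"
proof -
  have ax: "j \<in> Basis \<Longrightarrow> \<exists>k. j = axis k 1" for j :: "real^'n" by (auto simp: Basis_vec_def)
  have T: "0 + (\<Sum>j\<in>Basis. ((y \<bullet> j) * (x \<bullet> j)) *\<^sub>R j) = y * x" for x
    by (subst euclidean_representation[symmetric, of "y * x"], simp, intro sum.cong)
       (auto dest!: ax simp: inner_axis)
  have P: "(\<Prod>j\<in>Basis. \<bar>y \<bullet> j\<bar>) = \<bar>coord_prod y\<bar>"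
  proof -
    have "(\<Prod>j\<in>Basis. \<bar>y \<bullet> j\<bar>) = (\<Prod>k\<in>UNIV. \<bar>y \<bullet> axis k 1\<bar>)"
      by (subst prod.reindex_bij_betw[symmetric, of "\<lambda>k. axis k 1" UNIV Basis])
         (auto simp: bij_betw_def inj_on_def axis_eq_axis Basis_vec_def)
    then show ?thesis by (simp add: coord_prod_def inner_axis abs_prod)
  qed
  have "lborel = density (distr lborel borel (\<lambda>x. y * x)) (\<lambda>_. ennreal \<bar>coord_prod y\<bar>)"
  proof -
    have "y \<bullet> j \<noteq> 0" if "j \<in> Basis" for j
      using y ax[OF that] by (auto simp: inner_axis nonzero_coords_def)
    then show ?thesis using lborel_affine_euclidean[of "\<lambda>j. y \<bullet> j" 0] unfolding T P by simp
  qed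
  then have "(\<integral>\<^sup>+x. g x \<partial>lborel) = (\<integral>\<^sup>+x. g x \<partial>density (distr lborel borel (\<lambda>x. y * x)) (\<lambda>_. ennreal \<bar>coord_prod y\<bar>))"
    by simp
  also have "\<dots> = ennreal \<bar>coord_prod y\<bar> * (\<integral>\<^sup>+x. g (y * x) \<partial>lborel)"
    by (simp add: nn_integral_density nn_integral_distr nn_integral_cmult)
  finally show ?thesis .
qed

text \<open>A stretching is a rotation, a diagonal map and a rotation back; the rotations preserve
  the integral, so the factor is that of the diagonal map.\<close>

lemma nn_integral_stretch:
  assumes C: "orthogonal_matrix C" and y: "nonzero_coords y" and [measurable]: "g \<in> borel_measurable borel"
  shows "(\<integral>\<^sup>+x. g x \<partial>lborel) = ennreal \<bar>coord_prod y\<bar> * (\<integral>\<^sup>+x. g (stretch C y x) \<partial>lborel)"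
proof -
  have "orthogonal_matrix (transpose C)" using C by (simp add: orthogonal_matrix_def)
  then have "(\<integral>\<^sup>+x. g (stretch C y x) \<partial>lborel) = (\<integral>\<^sup>+x. g (C *v (y * x)) \<partial>lborel)"
    unfolding stretch_def by (rule nn_integral_orthogonal_matrix) measurable
  moreover have "(\<integral>\<^sup>+x. g (C *v x) \<partial>lborel) = ennreal \<bar>coord_prod y\<bar> * (\<integral>\<^sup>+x. g (C *v (y * x)) \<partial>lborel)"
    using y by (rule nn_integral_componentwise_mult) measurable
  ultimately show ?thesis using nn_integral_orthogonal_matrix[OF C, of g] by simp
qed

text \<open>Change of variables for the indicator of \<open>N\<close>; the factor
  \<open>coord_prod y\<close> is nonzero and can be cancelled.\<close>

lemma AE_stretch_lborel:
  assumes C: "orthogonal_matrix C" and y: "nonzero_coords y" and N: "N \<in> null_sets lborel"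
  shows "AE x in lborel. stretch C y x \<notin> N"
proof -
  have [measurable]: "N \<in> sets borel" using N by auto
  have "0 = ennreal \<bar>coord_prod y\<bar> * (\<integral>\<^sup>+x. indicator N (stretch C y x) \<partial>lborel)"
    using nn_integral_stretch[OF C y, of "indicator N"] N by (simp add: null_sets_def)
  then have "(\<integral>\<^sup>+x. indicator N (stretch C y x) \<partial>lborel) = 0"
    using y by (simp add: coord_prod_eq_0_iff)
  then have "AE x in lborel. indicator N (stretch C y x) = (0::ennreal)"
    by (subst (asm) nn_integral_0_iff_AE) measurable
  then show ?thesis by (auto elim!: eventually_mono simp: indicator_def split: if_splits)
qed


section \<open>Mixtures of stretchings\<close>

lemma norm_abs_l2:
  assumes "square_integrable f"
  shows "(norm (abs_l2 f))\<^sup>2 = (LINT x|lebesgue. (cmod (f x))\<^sup>2)"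
proof -
  have "l2_rel f f" using assms by (simp add: l2_rel_def)
  then have "inner (abs_l2 f) (abs_l2 f) = (LINT x|lebesgue. (cmod (f x))\<^sup>2)"
    unfolding inner_l2.abs_eq[OF \<open>l2_rel f f\<close> \<open>l2_rel f f\<close>] by (simp add: dot_square_norm)
  then show ?thesis unfolding power2_norm_eq_inner .
qed

lemma inner_abs_l2:
  assumes "square_integrable f" "square_integrable g"
  shows "inner (abs_l2 f) (abs_l2 g) = (LINT x|lebesgue. inner (f x) (g x))"
  using assms by (simp add: inner_l2.abs_eq l2_rel_def)

lemma abs_l2_eq_iff:
  assumes "square_integrable f" "square_integrable g"
  shows "abs_l2 f = abs_l2 g \<longleftrightarrow> (AE x in lebesgue. f x = g x)"
  using assms Quotient3_rel[OF Quotient3_l2, of f g] by (auto simp: l2_rel_def)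

lemma abs_l2_cong:
  assumes "square_integrable f" "g \<in> borel_measurable lebesgue" "AE x in lebesgue. f x = g x"
  shows "square_integrable g" "abs_l2 f = abs_l2 g"
proof -
  have "integrable lebesgue (\<lambda>x. (cmod (g x))\<^sup>2) \<longleftrightarrow> integrable lebesgue (\<lambda>x. (cmod (f x))\<^sup>2)"
    using assms by (intro integrable_cong_AE) (auto simp: square_integrable_def)
  then show "square_integrable g" using assms by (simp add: square_integrable_def)
  then show "abs_l2 f = abs_l2 g" using assms by (simp add: abs_l2_eq_iff)
qed

lemma square_integrable_borel_rep:
  assumes "square_integrable f"
  obtains g where "g \<in> borel_measurable borel" "square_integrable g"
    "AE x in lebesgue. f x = g x" "abs_l2 g = abs_l2 f"
proof -
  obtain g where g: "g \<in> borel_measurable borel" "AE x in lebesgue. f x = g x"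
    using lebesgue_ex_borel_measurable[of f] assms by (auto simp: square_integrable_def)
  moreover have "g \<in> borel_measurable lebesgue" using g(1) by (simp add: measurable_completion)
  ultimately show thesis using that abs_l2_cong[OF assms] by metis
qed

lemma l2_borel_cases:
  obtains f where "f \<in> borel_measurable borel" "square_integrable f" "F = abs_l2 f"
proof -
  have "square_integrable (rep_l2 F)"
    using Quotient3_rep_reflp[OF Quotient3_l2, of F] by (simp add: l2_rel_def)
  then obtain g where "g \<in> borel_measurable borel" "square_integrable g" "abs_l2 g = abs_l2 (rep_l2 F)"
    by (rule square_integrable_borel_rep)
  then show thesis using that Quotient3_abs_rep[OF Quotient3_l2] by metis
qed

text \<open>The measure space is left open: Lebesgue measure gives Hausdorff operators, product
  measures their compositions, a one-point space a single dilation.\<close>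

definition mixture :: "real^'n^'n \<Rightarrow> 'b measure \<Rightarrow> ('b \<Rightarrow> real^'n) \<Rightarrow> ('b \<Rightarrow> complex) \<Rightarrow>
    (real^'n \<Rightarrow> complex) \<Rightarrow> real^'n \<Rightarrow> complex" where
  "mixture C M c K f x = (LINT u|M. K u * f (stretch C (c u) x))"

text \<open>The weight is the \<open>l2\<close> operator norm of composition with
  \<open>stretch C (c u)\<close>, so this is the bound that the triangle inequality gives for the
  mixture. It is the total variation of the weighted kernel.\<close>

definition mixture_mass :: "'b measure \<Rightarrow> ('b \<Rightarrow> real^'n) \<Rightarrow> ('b \<Rightarrow> complex) \<Rightarrow> real" where
  "mixture_mass M c K = (LINT u|M. \<bar>coord_prod (c u)\<bar> powr (-1/2) * cmod (K u))"

text \<open>Invertibility is demanded at every point rather than almost everywhere; \<open>c\<close>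
  can be given the value 1 at points where the kernel vanishes, as \<open>a'\<close> does
  below.\<close>

locale stretch_mixture = sigma_finite_measure M
  for C :: "real^'n^'n" and M :: "'b measure" and c :: "'b \<Rightarrow> real^'n" and K :: "'b \<Rightarrow> complex" +
  assumes orthogonal: "orthogonal_matrix C"
    and c_measurable [measurable]: "c \<in> borel_measurable M"
    and K_measurable [measurable]: "K \<in> borel_measurable M"
    and nonzero: "\<And>u. u \<in> space M \<Longrightarrow> nonzero_coords (c u)"
    and weight_integrable: "integrable M (\<lambda>u. \<bar>coord_prod (c u)\<bar> powr (-1/2) * cmod (K u))"
begin

lemma mass_nonneg: "0 \<le> mixture_mass M c K"
  unfolding mixture_mass_def by (intro integral_nonneg_AE) auto

text \<open>This makes mixtures well defined on classes modulo null sets. Each single stretching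
  preserves null sets; the two quantifiers are exchanged by Fubini, which calls for a Borel null set
  containing \<open>N\<close>.\<close>

lemma AE_stretch_not_in:
  assumes N: "N \<in> null_sets lebesgue"
  shows "AE x in lebesgue. AE u in M. stretch C (c u) x \<notin> N"
proof -
  interpret P: pair_sigma_finite M lborel ..
  obtain N' where N': "N' \<in> null_sets lborel" "N \<subseteq> N'"
    using N by (metis null_sets_completionI null_sets_completion_iff2)
  have [measurable]: "N' \<in> sets borel" using N' by auto
  have "AE u in M. AE x in lborel. stretch C (c u) x \<notin> N'"
    using AE_stretch_lborel[OF orthogonal nonzero N'(1)] by (auto intro!: AE_I2)
  then have "AE x in lborel. AE u in M. stretch C (c u) x \<notin> N'"
    by (subst (asm) P.AE_commute) measurable
  then show ?thesis
    using N'(2) by (intro AE_completion) (auto elim!: eventually_mono)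
qed

lemma borel_measurable_mixture:
  assumes [measurable]: "f \<in> borel_measurable borel"
  shows "mixture C M c K f \<in> borel_measurable borel"
  unfolding mixture_def by measurable

lemma weight_identity:
  assumes "u \<in> space M"
  shows "\<bar>coord_prod (c u)\<bar> powr (-1/2) * sqrt \<bar>coord_prod (c u)\<bar> = 1"
  using nonzero[OF assms] coord_prod_eq_0_iff[of "c u"]
  by (simp add: powr_half_sqrt[symmetric] powr_add[symmetric])

(* Cauchy-Schwarz with respect to the measure with density w(u) = |det|^(-1/2) |K u|, then Tonelli. *)
lemma nn_integral_mixture_le:
  assumes [measurable]: "f \<in> borel_measurable borel"
  shows "(\<integral>\<^sup>+x. (\<integral>\<^sup>+u. ennreal (cmod (K u * f (stretch C (c u) x))) \<partial>M)\<^sup>2 \<partial>lborel) \<le>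
    ennreal ((mixture_mass M c K)\<^sup>2) * (\<integral>\<^sup>+x. ennreal ((cmod (f x))\<^sup>2) \<partial>lborel)"
proof -
  interpret P: pair_sigma_finite M lborel ..
  define w where "w u = \<bar>coord_prod (c u)\<bar> powr (-1/2) * cmod (K u)" for u
  have w0: "0 \<le> w u" for u by (simp add: w_def)
  have [measurable]: "w \<in> borel_measurable M" unfolding w_def by measurable
  have wint: "(\<integral>\<^sup>+u. ennreal (w u) \<partial>M) = ennreal (mixture_mass M c K)"
    unfolding mixture_mass_def w_def using weight_integrable by (intro nn_integral_eq_integral) auto
  let ?p = "\<lambda>u. \<bar>coord_prod (c u)\<bar>"
  let ?I = "\<integral>\<^sup>+x. ennreal ((cmod (f x))\<^sup>2) \<partial>lborel"
  have cs: "(\<integral>\<^sup>+u. ennreal (cmod (K u * f (stretch C (c u) x))) \<partial>M)\<^sup>2 \<le>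
      ennreal (mixture_mass M c K) * (\<integral>\<^sup>+u. ennreal (w u * ?p u) * ennreal ((cmod (f (stretch C (c u) x)))\<^sup>2) \<partial>M)" for x
  proof -
    \<comment> \<open>Because w * sqrt p = |K|, the integrand is the product of \<open>?F\<close>
      and \<open>?G\<close>. The square of \<open>?F\<close> integrates to the mass, and that of
      \<open>?G\<close> contains the factor p, which is absorbed by the change of variables in
      x.\<close>
    let ?F = "\<lambda>u. ennreal (sqrt (w u))"
    let ?G = "\<lambda>u. ennreal (sqrt (w u * ?p u) * cmod (f (stretch C (c u) x)))"
    have "(\<integral>\<^sup>+u. ennreal (cmod (K u * f (stretch C (c u) x))) \<partial>M) = (\<integral>\<^sup>+u. ?F u * ?G u \<partial>M)"
    proof (intro nn_integral_cong)
      fix u assume u: "u \<in> space M"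
      have "sqrt (w u) * sqrt (w u * ?p u) = w u * sqrt (?p u)"
        using w0[of u] by (simp add: real_sqrt_mult mult.assoc[symmetric])
      also have "\<dots> = cmod (K u)" using weight_identity[OF u] by (simp add: w_def mult.commute mult.left_commute)
      finally have "cmod (K u * f (stretch C (c u) x)) = sqrt (w u) * (sqrt (w u * ?p u) * cmod (f (stretch C (c u) x)))"
        by (simp add: norm_mult mult.assoc[symmetric])
      then show "ennreal (cmod (K u * f (stretch C (c u) x))) = ?F u * ?G u"
        using w0[of u] by (simp add: ennreal_mult')
    qed
    moreover have "(\<integral>\<^sup>+u. (?F u)\<^sup>2 \<partial>M) = ennreal (mixture_mass M c K)"
      unfolding wint[symmetric] using w0 by (intro nn_integral_cong) (simp add: ennreal_power)
    moreover have "(\<integral>\<^sup>+u. (?G u)\<^sup>2 \<partial>M) =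
        (\<integral>\<^sup>+u. ennreal (w u * ?p u) * ennreal ((cmod (f (stretch C (c u) x)))\<^sup>2) \<partial>M)"
      using w0 by (intro nn_integral_cong)
        (simp add: ennreal_power power_mult_distrib ennreal_mult'[symmetric])
    ultimately show ?thesis
      using Cauchy_Schwarz_nn_integral[of ?F M ?G] by simp
  qed
  have "(\<integral>\<^sup>+x. (\<integral>\<^sup>+u. ennreal (cmod (K u * f (stretch C (c u) x))) \<partial>M)\<^sup>2 \<partial>lborel) \<le>
      (\<integral>\<^sup>+x. ennreal (mixture_mass M c K) * (\<integral>\<^sup>+u. ennreal (w u * ?p u) * ennreal ((cmod (f (stretch C (c u) x)))\<^sup>2) \<partial>M) \<partial>lborel)"
    by (intro nn_integral_mono cs)
  also have "\<dots> = ennreal (mixture_mass M c K) *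
      (\<integral>\<^sup>+x. (\<integral>\<^sup>+u. ennreal (w u * ?p u) * ennreal ((cmod (f (stretch C (c u) x)))\<^sup>2) \<partial>M) \<partial>lborel)"
    by (intro nn_integral_cmult) measurable
  also have "(\<integral>\<^sup>+x. (\<integral>\<^sup>+u. ennreal (w u * ?p u) * ennreal ((cmod (f (stretch C (c u) x)))\<^sup>2) \<partial>M) \<partial>lborel) =
      (\<integral>\<^sup>+u. (\<integral>\<^sup>+x. ennreal (w u * ?p u) * ennreal ((cmod (f (stretch C (c u) x)))\<^sup>2) \<partial>lborel) \<partial>M)"
    by (rule P.Fubini') measurable
  also have "\<dots> = (\<integral>\<^sup>+u. ennreal (w u) * ?I \<partial>M)"
  proof (intro nn_integral_cong)
    fix u assume u: "u \<in> space M"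
    have "?I = ennreal (?p u) * (\<integral>\<^sup>+x. ennreal ((cmod (f (stretch C (c u) x)))\<^sup>2) \<partial>lborel)"
      by (rule nn_integral_stretch[OF orthogonal nonzero[OF u]]) measurable
    then show "(\<integral>\<^sup>+x. ennreal (w u * ?p u) * ennreal ((cmod (f (stretch C (c u) x)))\<^sup>2) \<partial>lborel) = ennreal (w u) * ?I"
      using w0[of u] by (simp add: nn_integral_cmult ennreal_mult mult.assoc)
  qed
  also have "\<dots> = ennreal (mixture_mass M c K) * ?I"
    by (simp add: nn_integral_multc wint)
  finally show ?thesis
    using mass_nonneg by (simp add: power2_eq_square ennreal_mult mult.assoc)
qed

lemma mixture_borel:
  assumes f: "square_integrable f" and [measurable]: "f \<in> borel_measurable borel"
  shows AE_integrable_mixture: "AE x in lebesgue. integrable M (\<lambda>u. K u * f (stretch C (c u) x))"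
    and square_integrable_mixture: "square_integrable (mixture C M c K f)"
    and norm_mixture_le: "norm (abs_l2 (mixture C M c K f)) \<le> mixture_mass M c K * norm (abs_l2 f)"
proof -
  let ?g = "mixture C M c K f"
  let ?h = "\<lambda>x. \<integral>\<^sup>+u. ennreal (cmod (K u * f (stretch C (c u) x))) \<partial>M"
  have [measurable]: "?g \<in> borel_measurable borel" by (rule borel_measurable_mixture) measurable
  have fint: "(\<integral>\<^sup>+x. ennreal ((cmod (f x))\<^sup>2) \<partial>lborel) = ennreal ((norm (abs_l2 f))\<^sup>2)"
  proof -
    have "(\<integral>\<^sup>+x. ennreal ((cmod (f x))\<^sup>2) \<partial>lborel) = (\<integral>\<^sup>+x. ennreal ((cmod (f x))\<^sup>2) \<partial>lebesgue)"
      by (simp add: nn_integral_completion)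
    also have "\<dots> = ennreal (LINT x|lebesgue. (cmod (f x))\<^sup>2)"
      using f by (intro nn_integral_eq_integral) (auto simp: square_integrable_def)
    finally show ?thesis by (simp add: norm_abs_l2[OF f])
  qed
  have le: "(\<integral>\<^sup>+x. (?h x)\<^sup>2 \<partial>lborel) \<le> ennreal ((mixture_mass M c K * norm (abs_l2 f))\<^sup>2)"
    using nn_integral_mixture_le[of f] mass_nonneg
    by (simp add: fint power_mult_distrib ennreal_mult)
  then have "(\<integral>\<^sup>+x. (?h x)\<^sup>2 \<partial>lborel) \<noteq> \<infinity>" by (auto simp: top_unique)
  then have "AE x in lborel. (?h x)\<^sup>2 \<noteq> \<infinity>"
    by (intro nn_integral_PInf_AE) measurable
  then have "AE x in lborel. integrable M (\<lambda>u. K u * f (stretch C (c u) x))"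
  proof eventually_elim
    fix x assume "(?h x)\<^sup>2 \<noteq> \<infinity>"
    then have "?h x < \<infinity>" by (auto simp: less_top[symmetric] power2_eq_square ennreal_mult_eq_top_iff)
    then show "integrable M (\<lambda>u. K u * f (stretch C (c u) x))" by (intro integrableI_bounded) measurable
  qed
  then show "AE x in lebesgue. integrable M (\<lambda>u. K u * f (stretch C (c u) x))"
    by (rule AE_completion)
  \<comment> \<open>Valid for every x: where the integrand is not integrable, the Bochner integral
    has the default value 0.\<close>
  have gh: "ennreal (cmod (?g x)) \<le> ?h x" for x
  proof (cases "integrable M (\<lambda>u. K u * f (stretch C (c u) x))")
    case True
    then show ?thesis unfolding mixture_def by (rule integral_norm_bound_ennreal)
  qed (simp add: mixture_def not_integrable_integral_eq)
  have "(\<integral>\<^sup>+x. ennreal ((cmod (?g x))\<^sup>2) \<partial>lborel) \<le> (\<integral>\<^sup>+x. (?h x)\<^sup>2 \<partial>lborel)"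
    using gh by (intro nn_integral_mono) (simp add: ennreal_power[symmetric] power_mono)
  also note le
  finally have le': "(\<integral>\<^sup>+x. ennreal ((cmod (?g x))\<^sup>2) \<partial>lebesgue) \<le> ennreal ((mixture_mass M c K * norm (abs_l2 f))\<^sup>2)"
    by (simp add: nn_integral_completion)
  have gm: "?g \<in> borel_measurable lebesgue" by (simp add: measurable_completion)
  then show sq: "square_integrable ?g"
    using le_less_trans[OF le' ennreal_less_top] unfolding square_integrable_def
    by (auto intro!: integrableI_bounded)
  have "ennreal ((norm (abs_l2 ?g))\<^sup>2) = (\<integral>\<^sup>+x. ennreal ((cmod (?g x))\<^sup>2) \<partial>lebesgue)"
    unfolding norm_abs_l2[OF sq] using sq
    by (intro nn_integral_eq_integral[symmetric]) (auto simp: square_integrable_def)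
  with le' have "(norm (abs_l2 ?g))\<^sup>2 \<le> (mixture_mass M c K * norm (abs_l2 f))\<^sup>2"
    by (metis ennreal_le_iff zero_le_power2)
  then show "norm (abs_l2 ?g) \<le> mixture_mass M c K * norm (abs_l2 f)"
    by (rule power2_le_imp_le) (simp add: mass_nonneg)
qed

end

(* Only Borel representatives are considered: on an incomplete measure space M, such as a product,
   the integrand need not be measurable for a merely Lebesgue measurable f. *)
definition represents :: "real^'n^'n \<Rightarrow> 'b measure \<Rightarrow> ('b \<Rightarrow> real^'n) \<Rightarrow> ('b \<Rightarrow> complex) \<Rightarrow>
    ((real^'n) l2 \<Rightarrow>\<^sub>L (real^'n) l2) \<Rightarrow> bool" where
  "represents C M c K T \<longleftrightarrow> (\<forall>f. f \<in> borel_measurable borel \<longrightarrow> square_integrable f \<longrightarrow>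
     blinfun_apply T (abs_l2 f) = abs_l2 (mixture C M c K f))"

lemma representsD:
  "represents C M c K T \<Longrightarrow> f \<in> borel_measurable borel \<Longrightarrow> square_integrable f \<Longrightarrow>
    blinfun_apply T (abs_l2 f) = abs_l2 (mixture C M c K f)"
  by (simp add: represents_def)

lemma represents_unique:
  fixes C :: "real^'n^'n"
  assumes "represents C M c K T" "represents C M c K U"
  shows "T = U"
proof (rule blinfun_eqI)
  fix F :: "(real^'n) l2"
  obtain f where "f \<in> borel_measurable borel" "square_integrable f" "F = abs_l2 f" by (rule l2_borel_cases)
  then show "blinfun_apply T F = blinfun_apply U F" using assms by (simp add: represents_def)
qed

lemma represents_cong_mixture:
  assumes "represents C M c K T" "\<And>f. f \<in> borel_measurable borel \<Longrightarrow> mixture C M c K f = mixture C M' c' K' f"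
  shows "represents C M' c' K' T"
  using assms by (simp add: represents_def)

lemma abs_l2_add:
  "square_integrable f \<Longrightarrow> square_integrable g \<Longrightarrow> abs_l2 f + abs_l2 g = abs_l2 (\<lambda>x. f x + g x)"
  by (simp add: plus_l2.abs_eq l2_rel_def)

lemma scaleC_abs_l2:
  "square_integrable f \<Longrightarrow> scaleC_l2 z (abs_l2 f) = abs_l2 (\<lambda>x. z * f x)"
  by (simp add: scaleC_l2.abs_eq l2_rel_def)

lemma scaleR_eq_scaleC_l2: "r *\<^sub>R F = scaleC_l2 (complex_of_real r) F"
  by transfer (simp add: l2_rel_def square_integrable_mult_left)

context stretch_mixture begin

lemma mixture_cong_AE:
  assumes f[measurable]: "f \<in> borel_measurable borel" "g \<in> borel_measurable borel"
    and eq: "AE x in lebesgue. f x = g x"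
  shows "AE x in lebesgue. mixture C M c K f x = mixture C M c K g x"
proof -
  have "{x. f x \<noteq> g x} \<in> sets lebesgue"
    by (rule sets_completionI_sets) (use f in measurable)
  then have "{x. f x \<noteq> g x} \<in> null_sets lebesgue"
    using eq by (subst (asm) AE_iff_null) (auto simp: Collect_neg_eq[symmetric])
  from AE_stretch_not_in[OF this] show ?thesis
  proof eventually_elim
    fix x assume "AE u in M. stretch C (c u) x \<notin> {x. f x \<noteq> g x}"
    then show "mixture C M c K f x = mixture C M c K g x"
      unfolding mixture_def by (intro integral_cong_AE) (auto elim!: eventually_mono)
  qed
qed

lemma abs_mixture_cong:
  assumes "f \<in> borel_measurable borel" "square_integrable f" "g \<in> borel_measurable borel" "square_integrable g"
    and "abs_l2 f = abs_l2 g"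
  shows "abs_l2 (mixture C M c K f) = abs_l2 (mixture C M c K g)"
  using assms by (simp add: abs_l2_eq_iff square_integrable_mixture mixture_cong_AE)

lemma abs_mixture_add:
  assumes [measurable]: "f \<in> borel_measurable borel" "g \<in> borel_measurable borel"
    and "square_integrable f" "square_integrable g"
  shows "abs_l2 (mixture C M c K (\<lambda>x. f x + g x)) = abs_l2 (mixture C M c K f) + abs_l2 (mixture C M c K g)"
proof -
  have "AE x in lebesgue. mixture C M c K (\<lambda>x. f x + g x) x = mixture C M c K f x + mixture C M c K g x"
    using AE_integrable_mixture[OF assms(3)] AE_integrable_mixture[OF assms(4)]
    by (auto elim!: eventually_elim2 simp: mixture_def distrib_left)
  then show ?thesis
    using assms by (simp add: abs_l2_add square_integrable_mixture abs_l2_eq_iff square_integrable_add)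
qed

lemma mixture_scale: "mixture C M c K (\<lambda>x. z * f x) = (\<lambda>x. z * mixture C M c K f x)"
  by (simp add: mixture_def fun_eq_iff mult.left_commute)

lemma represents_norm_le:
  assumes T: "represents C M c K T"
  shows "norm T \<le> mixture_mass M c K"
proof (rule norm_blinfun_bound)
  fix F :: "(real^'n) l2"
  obtain f where f: "f \<in> borel_measurable borel" "square_integrable f" "F = abs_l2 f"
    by (rule l2_borel_cases)
  then show "norm (blinfun_apply T F) \<le> mixture_mass M c K * norm F"
    using norm_mixture_le representsD[OF T] by simp
qed (rule mass_nonneg)

lemma represents_bounded_operator:
  assumes T: "represents C M c K T"
  shows "T \<in> bounded_operators"
proof -
  have "blinfun_apply T (scaleC_l2 z F) = scaleC_l2 z (blinfun_apply T F)" for z F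
  proof -
    obtain f where f[measurable]: "f \<in> borel_measurable borel" "square_integrable f" and F: "F = abs_l2 f"
      by (rule l2_borel_cases)
    then show ?thesis
      by (simp add: scaleC_abs_l2 representsD[OF T] square_integrable_mult_left mixture_scale square_integrable_mixture)
  qed
  then show ?thesis by (simp add: bounded_operators_def)
qed

text \<open>The operator is defined through a chosen Borel representative of each class. By
  \<open>abs_mixture_cong\<close> any other representative gives the same result, so the sum of two
  chosen representatives may replace the chosen representative of the sum; this yields
  linearity.\<close>

lemma represents_exists: "\<exists>T. represents C M c K T"
proof -
  define r where "r F = (SOME f. f \<in> borel_measurable borel \<and> square_integrable f \<and> F = abs_l2 f)" for F :: "(real^'n) l2"
  have r: "r F \<in> borel_measurable borel" "square_integrable (r F)" "abs_l2 (r F) = F" for F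
    using someI_ex[of "\<lambda>f. f \<in> borel_measurable borel \<and> square_integrable f \<and> F = abs_l2 f"] l2_borel_cases[of F]
    unfolding r_def by metis+
  define t where "t F = abs_l2 (mixture C M c K (r F))" for F
  have t: "t (abs_l2 f) = abs_l2 (mixture C M c K f)" if "f \<in> borel_measurable borel" "square_integrable f" for f
    unfolding t_def using that r by (intro abs_mixture_cong)
  have "bounded_linear t"
  proof (rule bounded_linear_intro)
    fix F G :: "(real^'n) l2" and s :: real
    have [measurable]: "r F \<in> borel_measurable borel" "r G \<in> borel_measurable borel" by (rule r)+
    have "F + G = abs_l2 (\<lambda>x. r F x + r G x)" using r abs_l2_add by metis
    then have "t (F + G) = abs_l2 (mixture C M c K (\<lambda>x. r F x + r G x))"
      using r by (simp add: t square_integrable_add)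
    then show "t (F + G) = t F + t G" using r by (simp add: abs_mixture_add t_def)
    have "s *\<^sub>R F = abs_l2 (\<lambda>x. complex_of_real s * r F x)"
      using r scaleC_abs_l2 scaleR_eq_scaleC_l2 by metis
    then have "t (s *\<^sub>R F) = abs_l2 (mixture C M c K (\<lambda>x. complex_of_real s * r F x))"
      using r by (simp add: t square_integrable_mult_left)
    then show "t (s *\<^sub>R F) = s *\<^sub>R t F"
      using r by (simp add: mixture_scale t_def scaleR_eq_scaleC_l2 scaleC_abs_l2 square_integrable_mixture)
    show "norm (t F) \<le> norm F * mixture_mass M c K"
      using norm_mixture_le[OF r(2,1), of F] r(3)[of F] by (simp add: t_def mult.commute)
  qed
  then have "represents C M c K (Blinfun t)"
    by (simp add: represents_def bounded_linear_Blinfun_apply t)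
  then show ?thesis ..
qed

lemma stretch_mixture_restrict:
  assumes [measurable]: "E \<in> sets M"
  shows "stretch_mixture C M c (\<lambda>u. indicator E u * K u)"
proof
  show "integrable M (\<lambda>u. \<bar>coord_prod (c u)\<bar> powr (-1/2) * cmod (indicator E u * K u))"
    by (rule Bochner_Integration.integrable_bound[OF weight_integrable]) (auto simp: norm_mult indicator_def)
qed (use orthogonal nonzero in auto)

text \<open>The pairing integrates \<open>K u * f (stretch C (c u) x)\<close> against
  \<open>g x\<close>. Outside \<open>E\<close> the integrand vanishes wherever \<open>g\<close> does
  not, so \<open>K\<close> may be cut down to \<open>E\<close> before the norm bound is applied.
  Read backwards, one matrix coefficient gives a lower bound for the mass of \<open>K\<close> on
  \<open>E\<close>.\<close>

lemma inner_localized_le: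
  assumes T: "represents C M c K T" and E: "E \<in> sets M"
    and f: "f \<in> borel_measurable borel" "square_integrable f" and g: "square_integrable g"
    and disj: "\<And>u x. u \<in> space M \<Longrightarrow> u \<notin> E \<Longrightarrow> K u \<noteq> 0 \<Longrightarrow> g x \<noteq> 0 \<Longrightarrow> f (stretch C (c u) x) = 0"
  shows "\<bar>inner (blinfun_apply T (abs_l2 f)) (abs_l2 g)\<bar> \<le>
    mixture_mass M c (\<lambda>u. indicator E u * K u) * norm (abs_l2 f) * norm (abs_l2 g)"
proof -
  let ?K = "\<lambda>u. indicator E u * K u"
  interpret E: stretch_mixture C M c ?K by (rule stretch_mixture_restrict[OF E])
  have "inner (mixture C M c K f x) (g x) = inner (mixture C M c ?K f x) (g x)" for x
  proof (cases "g x = 0")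
    case False
    then have "mixture C M c K f x = mixture C M c ?K f x"
      unfolding mixture_def using disj by (intro Bochner_Integration.integral_cong) (auto simp: indicator_def)
    then show ?thesis by simp
  qed simp
  then have "inner (blinfun_apply T (abs_l2 f)) (abs_l2 g) = inner (abs_l2 (mixture C M c ?K f)) (abs_l2 g)"
    using f g by (simp add: representsD[OF T] inner_abs_l2 square_integrable_mixture E.square_integrable_mixture)
  then have "\<bar>inner (blinfun_apply T (abs_l2 f)) (abs_l2 g)\<bar> \<le> norm (abs_l2 (mixture C M c ?K f)) * norm (abs_l2 g)"
    by (simp add: Cauchy_Schwarz_ineq2)
  also have "\<dots> \<le> mixture_mass M c ?K * norm (abs_l2 f) * norm (abs_l2 g)"
    using E.norm_mixture_le[OF f(2,1)] by (intro mult_right_mono) auto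
  finally show ?thesis .
qed

end

section \<open>Composition and commutation of mixtures\<close>

locale stretch_mixture_pair = A: stretch_mixture C M c K + B: stretch_mixture C N d L
  for C :: "real^'n^'n" and M :: "'b measure" and c K and N :: "'c measure" and d L
begin

sublocale P: pair_sigma_finite M N ..

text \<open>The weight is multiplicative, so the weighted product kernel is a product of integrable
  functions of separate variables.\<close>

sublocale AB: stretch_mixture C "M \<Otimes>\<^sub>M N" "\<lambda>p. c (fst p) * d (snd p)" "\<lambda>p. K (fst p) * L (snd p)"
proof unfold_locales
  show "orthogonal_matrix C" by (rule A.orthogonal)
  show "nonzero_coords (c (fst p) * d (snd p))" if "p \<in> space (M \<Otimes>\<^sub>M N)" for p
    using that A.nonzero B.nonzero by (auto simp: nonzero_coords_mult space_pair_measure)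
  let ?v = "\<lambda>u. \<bar>coord_prod (c u)\<bar> powr (-1/2) * cmod (K u)"
  let ?w = "\<lambda>u. \<bar>coord_prod (d u)\<bar> powr (-1/2) * cmod (L u)"
  have "integrable (M \<Otimes>\<^sub>M N) (\<lambda>p. ?v (fst p) * ?w (snd p))"
    using A.weight_integrable B.weight_integrable by (intro P.Fubini_integrable) auto
  then show "integrable (M \<Otimes>\<^sub>M N) (\<lambda>p. \<bar>coord_prod (c (fst p) * d (snd p))\<bar> powr (-1/2) * cmod (K (fst p) * L (snd p)))"
    by (simp add: coord_prod_mult abs_mult powr_mult norm_mult mult_ac)
qed measurable

text \<open>Fubini at those x where the double integral converges absolutely; the norm bound for the
  product mixture says that these are almost all x. The stretchings compose to
  \<open>d v * c u\<close>, and the commutativity of the componentwise product puts the factors in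
  the other order.\<close>

lemma mixture_mixture:
  assumes f[measurable]: "f \<in> borel_measurable borel" "square_integrable f"
  shows "AE x in lebesgue. mixture C M c K (mixture C N d L f) x =
    mixture C (M \<Otimes>\<^sub>M N) (\<lambda>p. c (fst p) * d (snd p)) (\<lambda>p. K (fst p) * L (snd p)) f x"
  using AB.AE_integrable_mixture[OF f(2,1)]
proof eventually_elim
  fix x assume "integrable (M \<Otimes>\<^sub>M N) (\<lambda>p. K (fst p) * L (snd p) * f (stretch C (c (fst p) * d (snd p)) x))"
  then have "integrable (M \<Otimes>\<^sub>M N) (\<lambda>(u, v). K u * L v * f (stretch C (c u * d v) x))"
    by (simp add: case_prod_beta')
  from P.integral_fst[OF this]
  show "mixture C M c K (mixture C N d L f) x =
    mixture C (M \<Otimes>\<^sub>M N) (\<lambda>p. c (fst p) * d (snd p)) (\<lambda>p. K (fst p) * L (snd p)) f x"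
    by (simp add: mixture_def case_prod_beta' stretch_stretch[OF A.orthogonal] mult.assoc mult.commute[of "d _"])
qed

lemma represents_compose:
  assumes T: "represents C M c K T" and U: "represents C N d L U"
  shows "represents C (M \<Otimes>\<^sub>M N) (\<lambda>p. c (fst p) * d (snd p)) (\<lambda>p. K (fst p) * L (snd p)) (T o\<^sub>L U)"
  unfolding represents_def
proof (intro allI impI)
  fix f :: "real^'n \<Rightarrow> complex" assume f[measurable]: "f \<in> borel_measurable borel" "square_integrable f"
  have "mixture C N d L f \<in> borel_measurable borel" "square_integrable (mixture C N d L f)"
    using f by (simp_all add: B.borel_measurable_mixture B.square_integrable_mixture)
  then show "blinfun_apply (T o\<^sub>L U) (abs_l2 f) = abs_l2 (mixture C (M \<Otimes>\<^sub>M N) (\<lambda>p. c (fst p) * d (snd p)) (\<lambda>p. K (fst p) * L (snd p)) f)"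
    using f mixture_mixture[OF f]
    by (simp add: representsD[OF T] representsD[OF U] abs_l2_eq_iff A.square_integrable_mixture AB.square_integrable_mixture)
qed

lemma mixture_swap:
  assumes [measurable]: "f \<in> borel_measurable borel"
  shows "mixture C (N \<Otimes>\<^sub>M M) (\<lambda>p. d (fst p) * c (snd p)) (\<lambda>p. L (fst p) * K (snd p)) f =
    mixture C (M \<Otimes>\<^sub>M N) (\<lambda>p. c (fst p) * d (snd p)) (\<lambda>p. K (fst p) * L (snd p)) f"
proof
  fix x
  have "(\<lambda>p. K (fst p) * L (snd p) * f (stretch C (c (fst p) * d (snd p)) x)) \<in> borel_measurable (M \<Otimes>\<^sub>M N)"
    by measurable
  from P.integral_product_swap[OF this]
  show "mixture C (N \<Otimes>\<^sub>M M) (\<lambda>p. d (fst p) * c (snd p)) (\<lambda>p. L (fst p) * K (snd p)) f x =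
    mixture C (M \<Otimes>\<^sub>M N) (\<lambda>p. c (fst p) * d (snd p)) (\<lambda>p. K (fst p) * L (snd p)) f x"
    by (simp add: mixture_def case_prod_beta' mult.commute)
qed

text \<open>Both products are represented by the same mixture up to a swap of the factors of the
  product space, and a mixture represents only one operator.\<close>

lemma represents_commute:
  assumes T: "represents C M c K T" and U: "represents C N d L U"
  shows "T o\<^sub>L U = U o\<^sub>L T"
proof -
  interpret Q: stretch_mixture_pair C N d L M c K ..
  show ?thesis
    using represents_compose[OF T U] Q.represents_compose[OF U T]
    by (intro represents_unique) (auto intro: represents_cong_mixture simp: mixture_swap)
qed

end


section \<open>Pushforward of kernels\<close>

context sigma_finite_measure begin

text \<open>Radon-Nikodym for the image under \<sigma> of the finite measure with density
  \<open>p\<close>. The test functions \<open>F\<close> may be unbounded, hence the separate claim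
  about integrability.\<close>

lemma pushforward_density_real:
  fixes p :: "'a \<Rightarrow> real" and \<sigma> :: "'a \<Rightarrow> 'e::euclidean_space"
  assumes p: "integrable M p" "\<And>u. 0 \<le> p u" and \<sigma>[measurable]: "\<sigma> \<in> borel_measurable M"
    and ac: "\<And>Z. Z \<in> null_sets lborel \<Longrightarrow> AE u in M. p u \<noteq> 0 \<longrightarrow> \<sigma> u \<notin> Z"
  shows "\<exists>k. integrable lborel k \<and> (\<forall>F :: 'e \<Rightarrow> complex. F \<in> borel_measurable borel \<longrightarrow>
      (integrable M (\<lambda>u. p u *\<^sub>R F (\<sigma> u)) \<longleftrightarrow> integrable lborel (\<lambda>v. k v *\<^sub>R F v)) \<and>
      (LINT u|M. p u *\<^sub>R F (\<sigma> u)) = (LINT v|lborel. k v *\<^sub>R F v))"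
proof -
  have [measurable]: "p \<in> borel_measurable M" using p(1) by (rule borel_measurable_integrable)
  define N where "N = distr (density M p) lborel \<sigma>"
  have sN: "sets N = sets lborel" by (simp add: N_def)
  have fin: "(\<integral>\<^sup>+u. ennreal (p u) \<partial>M) < \<infinity>"
    using p by (simp add: nn_integral_eq_integral)
  have fN: "finite_measure N"
    using fin by (intro finite_measureI) (simp add: N_def emeasure_distr emeasure_density cong: nn_integral_cong)
  have "absolutely_continuous lborel N"
    unfolding absolutely_continuous_def
  proof
    fix Z assume Z: "Z \<in> null_sets (lborel :: 'e measure)"
    then have [measurable]: "Z \<in> sets borel" by auto
    have "emeasure N Z = (\<integral>\<^sup>+u. ennreal (p u) * indicator (\<sigma> -` Z \<inter> space M) u \<partial>M)"
      by (simp add: N_def emeasure_distr emeasure_density)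
    also have "\<dots> = 0"
      using ac[OF Z] by (subst nn_integral_0_iff_AE) (auto elim!: eventually_mono simp: indicator_def)
    finally show "Z \<in> null_sets N" by (simp add: null_sets_def sN)
  qed
  then obtain k where k[measurable]: "k \<in> borel_measurable lborel" and k0: "\<And>x. 0 \<le> k x"
      and rn: "AE x in lborel. RN_deriv lborel N x = ennreal (k x)"
    using sigma_finite_measure.real_RN_deriv[OF sigma_finite_lborel fN _ sN] by metis
  have "N = density lborel (RN_deriv lborel N)"
    using \<open>absolutely_continuous lborel N\<close> sN by (simp add: sigma_finite_measure.density_RN_deriv[OF sigma_finite_lborel])
  also have "\<dots> = density lborel (\<lambda>x. ennreal (k x))"
    using rn by (intro density_cong) auto
  finally have N: "N = density lborel (\<lambda>x. ennreal (k x))" .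
  have "(\<integral>\<^sup>+v. ennreal (k v) \<partial>lborel) = emeasure N (space N)"
    by (simp add: N emeasure_density)
  also have "\<dots> < \<infinity>" using finite_measure.emeasure_finite[OF fN, of "space N"] by (simp add: less_top[symmetric])
  finally have "(\<integral>\<^sup>+v. ennreal (k v) \<partial>lborel) < \<infinity>" .
  then have kint: "integrable lborel k" using k0 by (intro integrableI_nonneg) auto
  have iff: "integrable M (\<lambda>u. p u *\<^sub>R F (\<sigma> u)) \<longleftrightarrow> integrable lborel (\<lambda>v. k v *\<^sub>R F v)"
    and eq: "(LINT u|M. p u *\<^sub>R F (\<sigma> u)) = (LINT v|lborel. k v *\<^sub>R F v)"
    if F[measurable]: "F \<in> borel_measurable borel" for F :: "'e \<Rightarrow> complex"
  proof -
    have m[measurable]: "\<sigma> \<in> measurable (density M p) lborel" "F \<in> borel_measurable lborel" by simp_all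
    show "integrable M (\<lambda>u. p u *\<^sub>R F (\<sigma> u)) \<longleftrightarrow> integrable lborel (\<lambda>v. k v *\<^sub>R F v)"
      using integrable_distr_eq[OF m] integrable_density[of F lborel k] integrable_density[of "\<lambda>u. F (\<sigma> u)" M p] p(2) k0
      by (simp add: N_def[symmetric] N)
    show "(LINT u|M. p u *\<^sub>R F (\<sigma> u)) = (LINT v|lborel. k v *\<^sub>R F v)"
      using integral_distr[OF m] integral_density[of F lborel k] integral_density[of "\<lambda>u. F (\<sigma> u)" M p] p(2) k0
      by (simp add: N_def[symmetric] N)
  qed
  show ?thesis using kint iff eq by blast
qed

text \<open>Four applications of the real case. Integrability passes in one direction only: after
  the pushforward, parts of \<kappa> with different phases may cancel.\<close>

lemma pushforward_density_complex:
  fixes \<kappa> :: "'a \<Rightarrow> complex" and \<sigma> :: "'a \<Rightarrow> 'e::euclidean_space"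
  assumes \<kappa>: "integrable M \<kappa>" and \<sigma>[measurable]: "\<sigma> \<in> borel_measurable M"
    and ac: "\<And>Z. Z \<in> null_sets lborel \<Longrightarrow> AE u in M. \<kappa> u \<noteq> 0 \<longrightarrow> \<sigma> u \<notin> Z"
  shows "\<exists>k. integrable lborel k \<and> (\<forall>F :: 'e \<Rightarrow> complex. F \<in> borel_measurable borel \<longrightarrow>
      integrable M (\<lambda>u. \<kappa> u * F (\<sigma> u)) \<longrightarrow>
      integrable lborel (\<lambda>v. k v * F v) \<and> (LINT u|M. \<kappa> u * F (\<sigma> u)) = (LINT v|lborel. k v * F v))"
proof -
  have [measurable]: "\<kappa> \<in> borel_measurable M" using \<kappa> by (rule borel_measurable_integrable)
  \<comment> \<open>With z = 1 and z = -1 these are the positive and negative parts of the real part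
    of \<kappa>. Since Re (-\<i> * w) = Im w, the values z = -\<i> and z = \<i> give those of the
    imaginary part.\<close>
  define part where "part z u = max 0 (Re (z * \<kappa> u))" for z u
  have part_le: "norm (part z u) \<le> cmod z * cmod (\<kappa> u)" for z u
    using abs_Re_le_cmod[of "z * \<kappa> u"] by (auto simp: part_def norm_mult max_def)
  have part_nonneg: "0 \<le> part z u" for z u by (simp add: part_def)
  have [measurable]: "part z \<in> borel_measurable M" for z unfolding part_def by measurable
  have part_int: "integrable M (part z)" for z
    by (rule Bochner_Integration.integrable_bound[where f="\<lambda>u. cmod z * cmod (\<kappa> u)"])
       (use \<kappa> part_le in auto)
  have "\<forall>z. \<exists>k. integrable lborel k \<and> (\<forall>F :: 'e \<Rightarrow> complex. F \<in> borel_measurable borel \<longrightarrow>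
      (integrable M (\<lambda>u. part z u *\<^sub>R F (\<sigma> u)) \<longleftrightarrow> integrable lborel (\<lambda>v. k v *\<^sub>R F v)) \<and>
      (LINT u|M. part z u *\<^sub>R F (\<sigma> u)) = (LINT v|lborel. k v *\<^sub>R F v))"
  proof (intro allI pushforward_density_real)
    fix z and Z assume "Z \<in> null_sets (lborel :: 'e measure)"
    from ac[OF this] show "AE u in M. part z u \<noteq> 0 \<longrightarrow> \<sigma> u \<notin> Z"
      by eventually_elim (auto simp: part_def)
  qed (simp_all add: part_int part_nonneg \<sigma>)
  from choice[OF this] obtain k where k: "\<forall>z. integrable lborel (k z) \<and> (\<forall>F :: 'e \<Rightarrow> complex. F \<in> borel_measurable borel \<longrightarrow>
      (integrable M (\<lambda>u. part z u *\<^sub>R F (\<sigma> u)) \<longleftrightarrow> integrable lborel (\<lambda>v. k z v *\<^sub>R F v)) \<and>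
      (LINT u|M. part z u *\<^sub>R F (\<sigma> u)) = (LINT v|lborel. k z v *\<^sub>R F v))" ..
  let ?k = "\<lambda>v. complex_of_real (k 1 v) - complex_of_real (k (-1) v) +
     \<i> * (complex_of_real (k (-\<i>) v) - complex_of_real (k \<i> v))"
  show ?thesis
  proof (intro exI[of _ ?k] conjI allI impI)
    show "integrable lborel ?k" using k by (simp only: Bochner_Integration.integrable_add Bochner_Integration.integrable_diff integrable_mult_right integrable_of_real)
  next
    fix F :: "'e \<Rightarrow> complex" assume F[measurable]: "F \<in> borel_measurable borel" and int: "integrable M (\<lambda>u. \<kappa> u * F (\<sigma> u))"
    have pi: "integrable M (\<lambda>u. part z u *\<^sub>R F (\<sigma> u))" for z
    proof (rule Bochner_Integration.integrable_bound)
      show "integrable M (\<lambda>u. z * (\<kappa> u * F (\<sigma> u)))" using int by (rule integrable_mult_right)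
      show "AE u in M. norm (part z u *\<^sub>R F (\<sigma> u)) \<le> norm (z * (\<kappa> u * F (\<sigma> u)))"
        using part_le by (auto simp: norm_mult mult.assoc[symmetric] intro!: mult_right_mono)
    qed measurable
    have ki: "integrable lborel (\<lambda>v. k z v *\<^sub>R F v)"
      and keq: "(LINT u|M. part z u *\<^sub>R F (\<sigma> u)) = (LINT v|lborel. k z v *\<^sub>R F v)" for z
      using k pi[of z] F by (blast+)
    have \<kappa>_eq: "\<kappa> u = complex_of_real (part 1 u) - complex_of_real (part (-1) u) +
       \<i> * (complex_of_real (part (-\<i>) u) - complex_of_real (part \<i> u))" for u
      by (auto simp: part_def complex_eq_iff max_def)
    have "(LINT u|M. \<kappa> u * F (\<sigma> u)) = (LINT u|M. (part 1 u *\<^sub>R F (\<sigma> u) - part (-1) u *\<^sub>R F (\<sigma> u)) +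
       \<i> * (part (-\<i>) u *\<^sub>R F (\<sigma> u) - part \<i> u *\<^sub>R F (\<sigma> u)))"
      by (subst \<kappa>_eq) (simp add: scaleR_conv_of_real algebra_simps)
    also have "\<dots> = (LINT v|lborel. (k 1 v *\<^sub>R F v - k (-1) v *\<^sub>R F v) +
       \<i> * (k (-\<i>) v *\<^sub>R F v - k \<i> v *\<^sub>R F v))"
      using pi ki by (simp add: keq)
    finally show "(LINT u|M. \<kappa> u * F (\<sigma> u)) = (LINT v|lborel. ?k v * F v)"
      by (simp add: scaleR_conv_of_real algebra_simps)
    have "integrable lborel (\<lambda>v. (k 1 v *\<^sub>R F v - k (-1) v *\<^sub>R F v) +
       \<i> * (k (-\<i>) v *\<^sub>R F v - k \<i> v *\<^sub>R F v))"
      using ki by simp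
    then show "integrable lborel (\<lambda>v. ?k v * F v)"
      by (simp add: scaleR_conv_of_real algebra_simps)
  qed
qed

end

section \<open>Kernels on D as mixtures over Lebesgue measure\<close>

locale diagonal_family =
  fixes D :: "(real^'n) set" and A :: "real^'n \<Rightarrow> real^'n^'n" and C :: "real^'n^'n" and a :: "real^'n \<Rightarrow> real^'n"
  assumes D [measurable]: "D \<in> sets lebesgue"
    and C: "orthogonal_matrix C"
    and a_measurable: "a \<in> borel_measurable (lebesgue_on D)"
    and a_nonzero: "\<And>u. u \<in> D \<Longrightarrow> nonzero_coords (a u)"
    and A_stretch: "\<And>u x. u \<in> D \<Longrightarrow> A u *v x = stretch C (a u) x"
    and det_A: "\<And>u. u \<in> D \<Longrightarrow> det (A u) = coord_prod (a u)"
begin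

(* Outside D, where kernels vanish almost everywhere, a' is the identity (1,...,1) of the group. *)
definition a' :: "real^'n \<Rightarrow> real^'n" where "a' u = (if u \<in> D then a u else 1)"

lemma a'_in_D [simp]: "u \<in> D \<Longrightarrow> a' u = a u"
  by (simp add: a'_def)

lemma a'_measurable [measurable]: "a' \<in> borel_measurable lebesgue"
proof -
  have "(\<lambda>u. if u \<in> D then a u else 0) \<in> borel_measurable lebesgue"
    using a_measurable D by (simp add: borel_measurable_if)
  then have "(\<lambda>u. (if u \<in> D then a u else 0) + indicator (-D) u *\<^sub>R 1) \<in> borel_measurable lebesgue"
    by measurable
  moreover have "(\<lambda>u. (if u \<in> D then a u else 0) + indicator (-D) u *\<^sub>R 1) = a'"
    by (auto simp: a'_def)
  ultimately show ?thesis by simp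
qed

lemma kernel_AE_D:
  "K \<in> hausdorff_kernels D A \<Longrightarrow> AE u in lebesgue. K u \<noteq> 0 \<longrightarrow> u \<in> D"
  by (auto simp: hausdorff_kernels_def elim!: eventually_mono)

text \<open>Off a null set, a nonzero value of \<open>K u\<close> forces u into \<open>D\<close>,
  where \<open>det (A u)\<close> is \<open>coord_prod (a' u)\<close>; elsewhere both weighted
  kernels vanish, whatever \<open>A\<close> does there.\<close>

lemma kernel_iff:
  "K \<in> hausdorff_kernels D A \<longleftrightarrow>
    stretch_mixture C lebesgue a' K \<and> (AE u in lebesgue. K u \<noteq> 0 \<longrightarrow> u \<in> D)"
proof -
  have nz: "nonzero_coords (a' u)" for u using a_nonzero by (simp add: a'_def)
  have "integrable lebesgue (\<lambda>u. complex_of_real (\<bar>det (A u)\<bar> powr (-1/2)) * K u) \<longleftrightarrow>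
      integrable lebesgue (\<lambda>u. \<bar>coord_prod (a' u)\<bar> powr (-1/2) * cmod (K u))" (is "?l \<longleftrightarrow> ?r")
    if K[measurable]: "K \<in> borel_measurable lebesgue" and ae: "AE u in lebesgue. K u \<noteq> 0 \<longrightarrow> u \<in> D"
  proof -
    have eq: "AE u in lebesgue. complex_of_real (\<bar>coord_prod (a' u)\<bar> powr (-1/2)) * K u =
        complex_of_real (\<bar>det (A u)\<bar> powr (-1/2)) * K u"
      using ae by eventually_elim (auto simp: det_A)
    have m: "(\<lambda>u. complex_of_real (\<bar>coord_prod (a' u)\<bar> powr (-1/2)) * K u) \<in> borel_measurable lebesgue"
      by measurable
    have "?l \<longleftrightarrow> integrable lebesgue (\<lambda>u. complex_of_real (\<bar>coord_prod (a' u)\<bar> powr (-1/2)) * K u)"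
      \<comment> \<open>Nothing is known about the measurability of \<open>A\<close> outside
        \<open>D\<close>, so the integrand with \<open>det (A u)\<close> inherits its measurability
        from \<open>m\<close> along \<open>eq\<close>; this uses that Lebesgue measure is
        complete.\<close>
      using eq by (intro integrable_cong_AE borel_measurable_AE[OF m] m) auto
    also have "\<dots> \<longleftrightarrow> ?r"
      using integrable_norm_iff[OF m] by (simp add: norm_mult)
    finally show ?thesis .
  qed
  moreover have "(AE u in lebesgue. K u \<noteq> 0 \<longrightarrow> u \<in> D \<and> det (A u) \<noteq> 0) \<longleftrightarrow> (AE u in lebesgue. K u \<noteq> 0 \<longrightarrow> u \<in> D)"
    by (intro AE_cong) (auto simp: det_A coord_prod_eq_0_iff a_nonzero)
  ultimately show ?thesis
    unfolding hausdorff_kernels_def stretch_mixture_def stretch_mixture_axioms_def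
    using C nz sigma_finite_lebesgue by auto
qed

text \<open>A Lebesgue measurable \<open>f\<close> may lose measurability when composed with u
  \<mapsto> \<open>A u *v x\<close>. For almost every x, however, the integrand agrees for almost
  every u with the one for the Borel function \<open>g\<close>, by
  \<open>AE_stretch_not_in\<close>.\<close>

lemma hausdorff_integral_AE:
  assumes K: "K \<in> hausdorff_kernels D A" and f: "square_integrable f"
    and g[measurable]: "g \<in> borel_measurable borel" and fg: "AE x in lebesgue. f x = g x"
  shows "AE x in lebesgue. integrable lebesgue (\<lambda>u. K u * f (A u *v x)) \<and>
    (LINT u|lebesgue. K u * f (A u *v x)) = mixture C lebesgue a' K g x"
proof -
  interpret stretch_mixture C lebesgue a' K using K kernel_iff by blast
  have gm: "g \<in> borel_measurable lebesgue" by (simp add: measurable_completion)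
  have g2: "square_integrable g" using abs_l2_cong(1)[OF f gm fg] .
  have "(\<lambda>x. f x - g x) -` (- {0}) \<inter> space lebesgue \<in> sets lebesgue"
    using f gm by (intro measurable_sets[OF borel_measurable_diff]) (auto simp: square_integrable_def)
  moreover have "(\<lambda>x. f x - g x) -` (- {0}) \<inter> space lebesgue = {x. f x \<noteq> g x}" by auto
  ultimately have "{x. f x \<noteq> g x} \<in> sets lebesgue" by simp
  then have "{x. f x \<noteq> g x} \<in> null_sets lebesgue"
    using fg by (subst (asm) AE_iff_null) (auto simp: Collect_neg_eq[symmetric])
  from AE_stretch_not_in[OF this] AE_integrable_mixture[OF g2 g] show ?thesis
  proof eventually_elim
    fix x assume ae: "AE u in lebesgue. stretch C (a' u) x \<notin> {x. f x \<noteq> g x}"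
      and int: "integrable lebesgue (\<lambda>u. K u * g (stretch C (a' u) x))"
    have eq: "AE u in lebesgue. K u * g (stretch C (a' u) x) = K u * f (A u *v x)"
      using ae kernel_AE_D[OF K] by eventually_elim (auto simp: A_stretch)
    have m: "(\<lambda>u. K u * g (stretch C (a' u) x)) \<in> borel_measurable lebesgue" using int by auto
    note m' = borel_measurable_AE[OF m eq]
    show "integrable lebesgue (\<lambda>u. K u * f (A u *v x)) \<and>
        (LINT u|lebesgue. K u * f (A u *v x)) = mixture C lebesgue a' K g x"
      using int integrable_cong_AE[OF m m' eq] integral_cong_AE[OF m m' eq] by (simp add: mixture_def)
  qed
qed

lemma is_hausdorff_operator_iff_represents:
  assumes K: "K \<in> hausdorff_kernels D A"
  shows "is_hausdorff_operator A K T \<longleftrightarrow> represents C lebesgue a' K T"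
proof -
  interpret stretch_mixture C lebesgue a' K using K kernel_iff by blast
  let ?H = "\<lambda>f x. LINT u|lebesgue. K u * f (A u *v x)"
  have H: "square_integrable (?H f)" "abs_l2 (?H f) = abs_l2 (mixture C lebesgue a' K g)"
    if f: "square_integrable f" and g: "g \<in> borel_measurable borel" "square_integrable g" "AE x in lebesgue. f x = g x" for f g
  proof -
    have eq: "AE x in lebesgue. mixture C lebesgue a' K g x = ?H f x"
      using hausdorff_integral_AE[OF K f g(1,3)] by eventually_elim simp
    have sq: "square_integrable (mixture C lebesgue a' K g)"
      using square_integrable_mixture[OF g(2,1)] .
    then have "?H f \<in> borel_measurable lebesgue"
      using borel_measurable_AE[OF _ eq] by (simp add: square_integrable_def)
    from abs_l2_cong[OF sq this eq]
    show "square_integrable (?H f)" "abs_l2 (?H f) = abs_l2 (mixture C lebesgue a' K g)" by simp_all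
  qed
  show ?thesis
  proof
    assume "is_hausdorff_operator A K T"
    then show "represents C lebesgue a' K T"
      using H by (simp add: is_hausdorff_operator_def represents_def)
  next
    assume T: "represents C lebesgue a' K T"
    show "is_hausdorff_operator A K T"
      unfolding is_hausdorff_operator_def
    proof (intro allI impI)
      fix f :: "real^'n \<Rightarrow> complex" assume f: "square_integrable f"
      obtain g where g: "g \<in> borel_measurable borel" "square_integrable g" "AE x in lebesgue. f x = g x" "abs_l2 g = abs_l2 f"
        using square_integrable_borel_rep[OF f] .
      have "blinfun_apply T (abs_l2 f) = abs_l2 (?H f)"
        using representsD[OF T g(1,2)] H(2)[OF f g(1-3)] g(4) by simp
      moreover have "AE x in lebesgue. integrable lebesgue (\<lambda>u. K u * f (A u *v x))"
        using hausdorff_integral_AE[OF K f g(1,3)] by eventually_elim simp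
      ultimately show "(AE x in lebesgue. integrable lebesgue (\<lambda>u. K u * f (A u *v x))) \<and>
          square_integrable (?H f) \<and> blinfun_apply T (abs_l2 f) = abs_l2 (?H f)"
        using H(1)[OF f g(1-3)] by simp
    qed
  qed
qed

lemma hausdorff_operators_iff:
  "T \<in> hausdorff_operators D A \<longleftrightarrow> (\<exists>K\<in>hausdorff_kernels D A. represents C lebesgue a' K T)"
  by (auto simp: hausdorff_operators_def is_hausdorff_operator_iff_represents)

(* The kernel of T is obtained from the density of the pushforward of |det|^(-1/2) K under sigma. *)
lemma hausdorff_operator_of_mixture:
  assumes mix: "stretch_mixture C M c K" and T: "represents C M c K T"
    and \<sigma>[measurable]: "\<sigma> \<in> borel_measurable M"
    and section_eq: "AE u in M. K u \<noteq> 0 \<longrightarrow> \<sigma> u \<in> D \<and> a (\<sigma> u) = c u"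
    and null: "\<And>Z. Z \<in> null_sets lebesgue \<Longrightarrow> AE u in M. K u \<noteq> 0 \<longrightarrow> \<sigma> u \<notin> Z"
  shows "T \<in> hausdorff_operators D A"
proof -
  interpret stretch_mixture C M c K by (rule mix)
  define \<kappa> where "\<kappa> u = complex_of_real (\<bar>coord_prod (c u)\<bar> powr (-1/2)) * K u" for u
  have [measurable]: "\<kappa> \<in> borel_measurable M" unfolding \<kappa>_def by measurable
  have \<kappa>_int: "integrable M \<kappa>"
    using weight_integrable by (subst integrable_norm_iff[symmetric]) (auto simp: \<kappa>_def norm_mult)
  have \<kappa>_ac: "AE u in M. \<kappa> u \<noteq> 0 \<longrightarrow> \<sigma> u \<notin> Z" if "Z \<in> null_sets lborel" for Z
    using null[OF null_sets_completionI[OF that]] by eventually_elim (auto simp: \<kappa>_def)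
  obtain k where k: "integrable lborel k" and kF: "\<forall>F :: real^'n \<Rightarrow> complex. F \<in> borel_measurable borel \<longrightarrow>
      integrable M (\<lambda>u. \<kappa> u * F (\<sigma> u)) \<longrightarrow>
      integrable lborel (\<lambda>v. k v * F v) \<and> (LINT u|M. \<kappa> u * F (\<sigma> u)) = (LINT v|lborel. k v * F v)"
    using pushforward_density_complex[OF \<kappa>_int \<sigma> \<kappa>_ac] by blast
  have [measurable]: "k \<in> borel_measurable borel" using k by auto
  have [measurable]: "k \<in> borel_measurable lebesgue" by (simp add: measurable_completion)
  \<comment> \<open>The factor \<open>sqrt\<close> of the determinant undoes the weight, so that the
    weighted kernel is the density \<open>k\<close> restricted to \<open>D\<close>.\<close>
  define K' where "K' v = indicator D v * (k v * complex_of_real (sqrt \<bar>coord_prod (a' v)\<bar>))" for v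
  have [measurable]: "K' \<in> borel_measurable lebesgue" unfolding K'_def by measurable
  have nz: "nonzero_coords (a' u)" for u using a_nonzero by (simp add: a'_def)
  have "\<bar>coord_prod (a' v)\<bar> powr (-1/2) * sqrt \<bar>coord_prod (a' v)\<bar> = 1" for v
    using nz coord_prod_eq_0_iff[of "a' v"] by (simp add: powr_half_sqrt[symmetric] powr_add[symmetric])
  then have K'w: "\<bar>coord_prod (a' v)\<bar> powr (-1/2) * cmod (K' v) = indicator D v * cmod (k v)" for v
    by (simp add: K'_def norm_mult indicator_def mult.left_commute)
  have "integrable lebesgue k" using k by (simp add: integrable_completion)
  then have "integrable lebesgue (\<lambda>v. indicator D v *\<^sub>R cmod (k v))"
    by (intro integrable_mult_indicator) auto
  moreover have "AE u in lebesgue. K' u \<noteq> 0 \<longrightarrow> u \<in> D" by (simp add: K'_def indicator_def)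
  ultimately have K': "K' \<in> hausdorff_kernels D A"
    unfolding kernel_iff stretch_mixture_def stretch_mixture_axioms_def
    using C nz sigma_finite_lebesgue K'w by auto
  interpret K': stretch_mixture C lebesgue a' K' using K' kernel_iff by blast
  \<comment> \<open>The pushforward accepts only Borel test functions, so \<open>a'\<close> and the
    indicator of \<open>D\<close> are replaced by Borel versions. They differ from the originals
    only on the null set \<open>Z\<close> obtained below, which \<sigma> avoids almost everywhere
    where \<open>K\<close> is nonzero.\<close>
  obtain ab where ab[measurable]: "ab \<in> borel_measurable borel" and ab_eq: "AE v in lebesgue. a' v = ab v"
    using lebesgue_ex_borel_measurable[OF a'_measurable] .
  have "(indicator D :: real^'n \<Rightarrow> real) \<in> borel_measurable lebesgue" by measurable
  then obtain d :: "real^'n \<Rightarrow> real" where d[measurable]: "d \<in> borel_measurable borel" and d_eq: "AE v in lebesgue. indicator D v = d v"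
    using lebesgue_ex_borel_measurable by blast
  have "AE v in lebesgue. a' v = ab v \<and> indicator D v = d v" using ab_eq d_eq by auto
  then obtain Z where Z: "Z \<in> null_sets lebesgue" "\<And>v. v \<notin> Z \<Longrightarrow> a' v = ab v \<and> indicator D v = d v"
    by (auto simp: eventually_ae_filter)
  have "AE x in lebesgue. mixture C M c K g x = mixture C lebesgue a' K' g x"
    if g[measurable]: "g \<in> borel_measurable borel" "square_integrable g" for g
    using AE_integrable_mixture[OF g(2,1)]
  proof eventually_elim
    fix x assume int: "integrable M (\<lambda>u. K u * g (stretch C (c u) x))"
    \<comment> \<open>Chosen so that \<kappa> times \<open>F\<close> after \<sigma> is the integrand
      of the given mixture, while \<open>k\<close> times \<open>F\<close> is that of the mixture
      with kernel \<open>K'\<close>.\<close>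
    define F where "F v = complex_of_real (d v * sqrt \<bar>coord_prod (ab v)\<bar>) * g (stretch C (ab v) x)" for v
    have F[measurable]: "F \<in> borel_measurable borel" unfolding F_def by measurable
    have "AE u in M. u \<in> space M" by simp
    with section_eq null[OF Z(1)] have eq: "AE u in M. K u * g (stretch C (c u) x) = \<kappa> u * F (\<sigma> u)"
    proof eventually_elim
      fix u assume u: "u \<in> space M" "K u \<noteq> 0 \<longrightarrow> \<sigma> u \<in> D \<and> a (\<sigma> u) = c u" "K u \<noteq> 0 \<longrightarrow> \<sigma> u \<notin> Z"
      show "K u * g (stretch C (c u) x) = \<kappa> u * F (\<sigma> u)"
      proof (cases "K u = 0")
        case False
        then have "ab (\<sigma> u) = c u" "d (\<sigma> u) = 1" using u Z(2)[of "\<sigma> u"] by auto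
        then have "\<kappa> u * F (\<sigma> u) = complex_of_real (\<bar>coord_prod (c u)\<bar> powr (-1/2) * sqrt \<bar>coord_prod (c u)\<bar>) * (K u * g (stretch C (c u) x))"
          by (simp add: \<kappa>_def F_def)
        then show ?thesis by (simp only: weight_identity[OF u(1)] of_real_1 mult_1)
      qed (simp add: \<kappa>_def)
    qed
    have m: "(\<lambda>u. K u * g (stretch C (c u) x)) \<in> borel_measurable M" "(\<lambda>u. \<kappa> u * F (\<sigma> u)) \<in> borel_measurable M"
      by measurable
    have int': "integrable M (\<lambda>u. \<kappa> u * F (\<sigma> u))" using int integrable_cong_AE[OF m eq] by simp
    have "mixture C M c K g x = (LINT u|M. \<kappa> u * F (\<sigma> u))"
      unfolding mixture_def using integral_cong_AE[OF m eq] .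
    also have "\<dots> = (LINT v|lborel. k v * F v)" using kF F int' by simp
    also have "\<dots> = (LINT v|lebesgue. k v * F v)" by (simp add: integral_completion)
    also have "\<dots> = mixture C lebesgue a' K' g x"
      unfolding mixture_def
    proof (intro integral_cong_AE)
      show "(\<lambda>v. k v * F v) \<in> borel_measurable lebesgue" by (rule measurable_completion) measurable
      show "(\<lambda>v. K' v * g (stretch C (a' v) x)) \<in> borel_measurable lebesgue" by measurable
      show "AE v in lebesgue. k v * F v = K' v * g (stretch C (a' v) x)"
        using ab_eq d_eq
      proof eventually_elim
        fix v assume v: "a' v = ab v" "indicator D v = d v"
        have "(indicator D v :: complex) = complex_of_real (d v)"
          unfolding v(2)[symmetric] by (simp add: indicator_def)
        then show "k v * F v = K' v * g (stretch C (a' v) x)"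
          by (simp add: K'_def F_def v(1))
      qed
    qed
    finally show "mixture C M c K g x = mixture C lebesgue a' K' g x" .
  qed
  then have "represents C lebesgue a' K' T"
    unfolding represents_def
    by (auto simp: representsD[OF T] abs_l2_eq_iff square_integrable_mixture K'.square_integrable_mixture)
  then show ?thesis using K' hausdorff_operators_iff by blast
qed

end


section \<open>The algebra of Hausdorff operators\<close>

text \<open>A neighbourhood of the identity measured on the logarithmic scale, so that widths add
  under products and quotients (\<open>near_one_mult\<close>,
  \<open>near_one_cancel\<close>).\<close>

definition near_one :: "real \<Rightarrow> real^'n \<Rightarrow> bool" where
  "near_one \<delta> y \<longleftrightarrow> (\<forall>k. exp (- \<delta>) \<le> y $ k \<and> y $ k \<le> exp \<delta>)"

lemma (in diagonal_family) zero_in_hausdorff_kernels: "(\<lambda>u. 0) \<in> hausdorff_kernels D A"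
  by (simp add: hausdorff_kernels_def)

lemma (in diagonal_family) hausdorff_kernels_add:
  assumes "K \<in> hausdorff_kernels D A" "L \<in> hausdorff_kernels D A"
  shows "(\<lambda>u. K u + L u) \<in> hausdorff_kernels D A"
  using assms by (auto simp: hausdorff_kernels_def distrib_left elim!: eventually_elim2)

lemma (in diagonal_family) hausdorff_kernels_mult:
  assumes "K \<in> hausdorff_kernels D A"
  shows "(\<lambda>u. z * K u) \<in> hausdorff_kernels D A"
  using assms integrable_mult_right[of z lebesgue "\<lambda>u. complex_of_real (\<bar>det (A u)\<bar> powr (-1/2)) * K u"]
  by (auto simp: hausdorff_kernels_def mult.left_commute elim!: eventually_mono)

lemma (in diagonal_family) hausdorff_operators_add:
  assumes "T \<in> hausdorff_operators D A" "U \<in> hausdorff_operators D A"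
  shows "T + U \<in> hausdorff_operators D A"
proof -
  obtain K L where K: "K \<in> hausdorff_kernels D A" "represents C lebesgue a' K T"
    and L: "L \<in> hausdorff_kernels D A" "represents C lebesgue a' L U"
    using assms by (auto simp: hausdorff_operators_iff)
  note KL = hausdorff_kernels_add[OF K(1) L(1)]
  interpret K: stretch_mixture C lebesgue a' K using K kernel_iff by blast
  interpret L: stretch_mixture C lebesgue a' L using L kernel_iff by blast
  interpret KL: stretch_mixture C lebesgue a' "\<lambda>u. K u + L u" using KL kernel_iff by blast
  have "represents C lebesgue a' (\<lambda>u. K u + L u) (T + U)"
    unfolding represents_def
  proof (intro allI impI)
    fix f :: "real^'n \<Rightarrow> complex" assume f: "f \<in> borel_measurable borel" "square_integrable f"
    have "AE x in lebesgue. mixture C lebesgue a' K f x + mixture C lebesgue a' L f x = mixture C lebesgue a' (\<lambda>u. K u + L u) f x"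
      using K.AE_integrable_mixture[OF f(2,1)] L.AE_integrable_mixture[OF f(2,1)]
      by eventually_elim (simp add: mixture_def distrib_right)
    then show "blinfun_apply (T + U) (abs_l2 f) = abs_l2 (mixture C lebesgue a' (\<lambda>u. K u + L u) f)"
      using f by (simp add: plus_blinfun.rep_eq representsD[OF K(2)] representsD[OF L(2)] abs_l2_add abs_l2_eq_iff
        K.square_integrable_mixture L.square_integrable_mixture KL.square_integrable_mixture square_integrable_add)
  qed
  then show ?thesis using KL hausdorff_operators_iff by blast
qed

lemma (in diagonal_family) hausdorff_operators_scaleC:
  assumes "T \<in> hausdorff_operators D A"
  shows "scaleC_op z T \<in> hausdorff_operators D A"
proof -
  obtain K where K: "K \<in> hausdorff_kernels D A" "represents C lebesgue a' K T"
    using assms by (auto simp: hausdorff_operators_iff)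
  interpret K: stretch_mixture C lebesgue a' K using K kernel_iff by blast
  have "mixture C lebesgue a' (\<lambda>u. z * K u) f = (\<lambda>x. z * mixture C lebesgue a' K f x)" for f
    by (simp add: fun_eq_iff mixture_def mult.assoc)
  then have "represents C lebesgue a' (\<lambda>u. z * K u) (scaleC_op z T)"
    unfolding represents_def
    by (auto simp: scaleC_op_apply representsD[OF K(2)] scaleC_abs_l2 K.square_integrable_mixture)
  then show ?thesis using hausdorff_kernels_mult[OF K(1)] hausdorff_operators_iff by blast
qed

lemma (in diagonal_family) zero_in_hausdorff_operators: "0 \<in> hausdorff_operators D A"
proof -
  have "mixture C lebesgue a' (\<lambda>u. 0) f = (\<lambda>x. 0)" for f by (simp add: mixture_def fun_eq_iff)
  then have "represents C lebesgue a' (\<lambda>u. 0) 0"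
    by (simp add: represents_def zero_l2_def)
  then show ?thesis using zero_in_hausdorff_kernels hausdorff_operators_iff by blast
qed

lemma (in diagonal_family) hausdorff_operators_subset: "hausdorff_operators D A \<subseteq> bounded_operators"
  using kernel_iff hausdorff_operators_iff stretch_mixture.represents_bounded_operator by blast

lemma (in diagonal_family) hausdorff_operator_exists:
  assumes K: "K \<in> hausdorff_kernels D A"
  shows "\<exists>T\<in>bounded_operators. is_hausdorff_operator A K T"
proof -
  interpret stretch_mixture C lebesgue a' K using K kernel_iff by blast
  show ?thesis
    using represents_exists represents_bounded_operator is_hausdorff_operator_iff_represents[OF K] by blast
qed

lemma (in diagonal_family) hausdorff_operators_commute: "commutative_operators (hausdorff_operators D A)"
  unfolding commutative_operators_def
proof (intro ballI)
  fix T U assume "T \<in> hausdorff_operators D A" "U \<in> hausdorff_operators D A"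
  then obtain K L where K: "K \<in> hausdorff_kernels D A" "represents C lebesgue a' K T"
    and L: "L \<in> hausdorff_kernels D A" "represents C lebesgue a' L U"
    by (auto simp: hausdorff_operators_iff)
  interpret stretch_mixture_pair C lebesgue a' K lebesgue a' L
    unfolding stretch_mixture_pair_def using K L kernel_iff by blast
  show "T o\<^sub>L U = U o\<^sub>L T" using represents_commute K(2) L(2) .
qed

text \<open>\<beta> is a right inverse of \<open>a\<close>. Its exceptional set may depend on the
  null set \<open>Z\<close> that \<beta> must avoid, and has to be null along each translate
  \<open>c * a u\<close>; this makes pushforwards under \<beta> absolutely continuous. The last two
  conditions say that the distribution of \<open>a\<close> has no atom at the identity but charges
  each of its neighbourhoods.\<close>

locale hausdorff_family = diagonal_family D A C a
  for D :: "(real^'n) set" and A C a +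
  fixes \<beta> :: "real^'n \<Rightarrow> real^'n"
  assumes \<beta>_measurable [measurable]: "\<beta> \<in> borel_measurable borel"
    and \<beta>_section: "\<And>Z. Z \<in> null_sets lebesgue \<Longrightarrow>
      \<exists>N\<in>sets borel. (\<forall>y. y \<notin> N \<longrightarrow> \<beta> y \<in> D \<and> a (\<beta> y) = y \<and> \<beta> y \<notin> Z) \<and>
        (\<forall>c. nonzero_coords c \<longrightarrow> (AE u in lebesgue. u \<in> D \<longrightarrow> c * a u \<notin> N))"
    and a_eq_one_null: "{u \<in> D. a u = 1} \<in> null_sets lebesgue"
    and a_near_one_nonnull: "0 < \<delta> \<Longrightarrow> {u \<in> D. near_one \<delta> (a u)} \<notin> null_sets lebesgue"
begin

text \<open>The left factor is an arbitrary mixture, so that dilations are covered as well. The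
  section is \<sigma> (u, v) = \<beta> (c u * a' v): for each fixed u the exceptional set is avoided
  for almost every v with \<open>L v\<close> nonzero, and Fubini combines these statements. Thus one
  factor with a density is enough.\<close>

lemma mixture_compose_hausdorff:
  assumes mix: "stretch_mixture C M c K" and T: "represents C M c K T" and U: "U \<in> hausdorff_operators D A"
  shows "T o\<^sub>L U \<in> hausdorff_operators D A"
proof -
  obtain L where L: "L \<in> hausdorff_kernels D A" "represents C lebesgue a' L U"
    using U by (auto simp: hausdorff_operators_iff)
  interpret stretch_mixture_pair C M c K lebesgue a' L
    unfolding stretch_mixture_pair_def using mix L kernel_iff by blast
  define \<sigma> where "\<sigma> p = \<beta> (c (fst p) * a' (snd p))" for p
  have avoid: "AE p in M \<Otimes>\<^sub>M lebesgue. L (snd p) \<noteq> 0 \<longrightarrow> c (fst p) * a' (snd p) \<notin> N"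
    if [measurable]: "N \<in> sets borel" and N: "\<And>c. nonzero_coords c \<Longrightarrow> AE u in lebesgue. u \<in> D \<longrightarrow> c * a u \<notin> N" for N
  proof (rule P.AE_pair_measure)
    show "{p \<in> space (M \<Otimes>\<^sub>M lebesgue). L (snd p) \<noteq> 0 \<longrightarrow> c (fst p) * a' (snd p) \<notin> N} \<in> sets (M \<Otimes>\<^sub>M lebesgue)"
      by measurable
    have "AE v in lebesgue. L v \<noteq> 0 \<longrightarrow> c u * a' v \<notin> N" if "u \<in> space M" for u
      using N[OF A.nonzero[OF that]] kernel_AE_D[OF L(1)] by eventually_elim auto
    then show "AE u in M. AE v in lebesgue. L (snd (u, v)) \<noteq> 0 \<longrightarrow> c (fst (u, v)) * a' (snd (u, v)) \<notin> N"
      by (auto intro!: AE_I2)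
  qed
  show ?thesis
  proof (rule hausdorff_operator_of_mixture[OF AB.stretch_mixture_axioms represents_compose[OF T L(2)], of \<sigma>])
    show "\<sigma> \<in> borel_measurable (M \<Otimes>\<^sub>M lebesgue)" unfolding \<sigma>_def by measurable
    show null: "AE p in M \<Otimes>\<^sub>M lebesgue. K (fst p) * L (snd p) \<noteq> 0 \<longrightarrow> \<sigma> p \<notin> Z" if Z: "Z \<in> null_sets lebesgue" for Z
    proof -
      obtain N where N: "N \<in> sets borel" "\<forall>y. y \<notin> N \<longrightarrow> \<beta> y \<in> D \<and> a (\<beta> y) = y \<and> \<beta> y \<notin> Z"
        "\<forall>c. nonzero_coords c \<longrightarrow> (AE u in lebesgue. u \<in> D \<longrightarrow> c * a u \<notin> N)"
        using \<beta>_section[OF Z] by blast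
      have "AE p in M \<Otimes>\<^sub>M lebesgue. L (snd p) \<noteq> 0 \<longrightarrow> c (fst p) * a' (snd p) \<notin> N"
        using N(3) by (intro avoid N(1)) blast
      then show ?thesis by eventually_elim (use N(2) in \<open>auto simp: \<sigma>_def\<close>)
    qed
    obtain N where N: "N \<in> sets borel" "\<forall>y. y \<notin> N \<longrightarrow> \<beta> y \<in> D \<and> a (\<beta> y) = y"
      "\<forall>c. nonzero_coords c \<longrightarrow> (AE u in lebesgue. u \<in> D \<longrightarrow> c * a u \<notin> N)"
      using \<beta>_section[of "{}"] by auto
    have "AE p in M \<Otimes>\<^sub>M lebesgue. L (snd p) \<noteq> 0 \<longrightarrow> c (fst p) * a' (snd p) \<notin> N"
      using N(3) by (intro avoid N(1)) blast
    then show "AE p in M \<Otimes>\<^sub>M lebesgue. K (fst p) * L (snd p) \<noteq> 0 \<longrightarrow> \<sigma> p \<in> D \<and> a (\<sigma> p) = c (fst p) * a' (snd p)"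
      by eventually_elim (use N(2) in \<open>auto simp: \<sigma>_def\<close>)
  qed
qed

lemma hausdorff_operators_compose:
  assumes "T \<in> hausdorff_operators D A" "U \<in> hausdorff_operators D A"
  shows "T o\<^sub>L U \<in> hausdorff_operators D A"
  using assms mixture_compose_hausdorff kernel_iff hausdorff_operators_iff by meson

lemma hausdorff_operators_subalgebra: "operator_subalgebra (hausdorff_operators D A)"
  unfolding operator_subalgebra_def
  using hausdorff_operators_subset zero_in_hausdorff_operators hausdorff_operators_add
    hausdorff_operators_scaleC hausdorff_operators_compose by blast

end


section \<open>The inverse of the eigenvalue map\<close>

lemma diag_matrix_vector: "diag_matrix v *v x = v * x"
  by (simp add: diag_matrix_def matrix_vector_mult_def times_vec_def vec_eq_iff if_distrib[where f="\<lambda>z. z * _"] cong: if_cong)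

lemma det_diag_matrix: "det (diag_matrix v) = coord_prod v"
  by (subst det_diagonal) (auto simp: diag_matrix_def coord_prod_def)

text \<open>Off \<open>N\<close> the preimage is mapped into \<open>Z\<close>, and a set off
  \<open>N\<close> with null image is null.\<close>

lemma null_vimage_almost_bijective:
  assumes b: "almost_bijective b X" and Z: "Z \<in> null_sets lebesgue"
  shows "{t. b t \<in> Z} \<in> null_sets lebesgue"
proof -
  obtain N M where N: "N \<in> null_sets lebesgue"
    and null: "\<And>Z. Z \<subseteq> UNIV - N \<Longrightarrow> Z \<in> null_sets lebesgue \<longleftrightarrow> b ` Z \<in> null_sets lebesgue"
    using b unfolding almost_bijective_def by blast
  have "b ` ({t. b t \<in> Z} - N) \<in> null_sets lebesgue"
    using Z by (intro null_sets_completion_subset[OF _ Z]) auto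
  then have "{t. b t \<in> Z} - N \<in> null_sets lebesgue" by (subst null) auto
  then have "({t. b t \<in> Z} - N) \<union> N \<in> null_sets lebesgue" using N by (rule null_sets.Un)
  then show ?thesis by (rule null_sets_completion_subset[rotated]) auto
qed

text \<open>Every point of \<open>X\<close> outside a null set is a value of \<open>b\<close>, so
  \<open>Y\<close> is covered by that null set and by the image of a part of \<open>N\<close>. Here
  \<open>b\<close> carries null sets forward, whereas the preceding lemma pulls them back.\<close>

lemma almost_bijective_subset:
  assumes b: "almost_bijective b X" and N: "N \<in> null_sets lebesgue"
    and Y: "\<And>u t. u \<in> Y \<Longrightarrow> u \<in> X \<and> (u = b t \<longrightarrow> t \<in> N)"
  shows "Y \<in> null_sets lebesgue"
proof -
  obtain N' M where M: "M \<in> null_sets lebesgue" and bij: "bij_betw b (UNIV - N') (X - M)"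
    and null: "\<And>Z. Z \<subseteq> UNIV - N' \<Longrightarrow> Z \<in> null_sets lebesgue \<longleftrightarrow> b ` Z \<in> null_sets lebesgue"
    using b unfolding almost_bijective_def by blast
  have "N - N' \<in> null_sets lebesgue" by (rule null_sets_completion_subset[OF _ N]) auto
  then have "M \<union> b ` (N - N') \<in> null_sets lebesgue"
    using M by (subst (asm) null) auto
  moreover have "Y \<subseteq> M \<union> b ` (N - N')"
  proof
    fix u assume u: "u \<in> Y"
    show "u \<in> M \<union> b ` (N - N')"
    proof (cases "u \<in> M")
      case False
      then have "u \<in> b ` (UNIV - N')" using bij Y[OF u] by (auto simp: bij_betw_def)
      then show ?thesis using Y[OF u] by blast
    qed simp
  qed
  ultimately show ?thesis by (rule null_sets_completion_subset[rotated])
qed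

lemma finite_sign_vectors: "finite (sign_vectors :: (real^'n) set)"
proof -
  have "(sign_vectors :: (real^'n) set) \<subseteq> (\<lambda>f. \<chi> k. f k) ` (UNIV \<rightarrow>\<^sub>E {-1, 1})"
  proof
    fix e :: "real^'n" assume "e \<in> sign_vectors"
    then show "e \<in> (\<lambda>f. \<chi> k. f k) ` (UNIV \<rightarrow>\<^sub>E {-1, 1})"
      by (intro image_eqI[of _ _ "\<lambda>k. e $ k"]) (auto simp: sign_vectors_def)
  qed
  then show ?thesis by (rule finite_subset) (auto intro!: finite_imageI finite_PiE)
qed

text \<open>Together with \<open>ln_abs\<close>, this identifies the multiplicative group with the
  product of the sign group and the additive group of vectors t.\<close>

definition sgn_vec :: "real^'n \<Rightarrow> real^'n" where "sgn_vec y = (\<chi> k. sgn (y $ k))"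
definition ln_abs :: "real^'n \<Rightarrow> real^'n" where "ln_abs y = (\<chi> k. ln \<bar>y $ k\<bar>)"

lemma sgn_vec_in_sign_vectors: "nonzero_coords y \<Longrightarrow> sgn_vec y \<in> sign_vectors"
  by (auto simp: sgn_vec_def sign_vectors_def nonzero_coords_def sgn_real_def)

lemma ln_abs_mult: "nonzero_coords y \<Longrightarrow> nonzero_coords z \<Longrightarrow> ln_abs (y * z) = ln_abs y + ln_abs z"
  by (auto simp: ln_abs_def nonzero_coords_def vec_eq_iff abs_mult ln_mult)

lemma borel_measurable_ln_abs [measurable (raw)]:
  "f \<in> borel_measurable M \<Longrightarrow> (\<lambda>x. ln_abs (f x)) \<in> borel_measurable M"
  unfolding ln_abs_def by measurable

lemma borel_measurable_sgn_vec [measurable (raw)]: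
  "f \<in> borel_measurable M \<Longrightarrow> (\<lambda>x. sgn_vec (f x)) \<in> borel_measurable M"
  unfolding sgn_vec_def by measurable

lemma eq_of_sgn_abs_exp:
  assumes "sgn x = s" "\<bar>x\<bar> = exp t" shows "x = s * exp (t::real)"
  using assms sgn_mult_abs[of x] by metis

text \<open>The section picks the branch of the solution by the signs of y and evaluates it at the
  logarithms: \<beta> y is \<open>b e t\<close> with e = \<open>sgn_vec y\<close> and t =
  \<open>ln_abs y\<close>, up to the choice of Borel versions.\<close>

lemma hausdorff_family_exists:
  fixes D :: "(real^'n) set"
    and A :: "real^'n \<Rightarrow> real^'n^'n"
    and C :: "real^'n^'n"
    and a :: "real^'n \<Rightarrow> real^'n"
    and b :: "real^'n \<Rightarrow> real^'n \<Rightarrow> real^'n"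
  assumes domain: "D \<in> sets lebesgue"
    and measurable_family: "A \<in> borel_measurable (lebesgue_on D)"
    and nonsingular: "\<And>u. u \<in> D \<Longrightarrow> det (A u) \<noteq> 0"
    and orthogonal: "orthogonal_matrix C"
    and diagonalized: "\<And>u. u \<in> D \<Longrightarrow> matrix_inv C ** A u ** C = diag_matrix (a u)"
    and unique_solution: "\<And>e. e \<in> sign_vectors \<Longrightarrow>
      (AE t in lebesgue. \<forall>u. (u \<in> sign_region D a e \<and> (\<forall>k. \<bar>a u $ k\<bar> = exp (t $ k))) \<longleftrightarrow> u = b e t)"
    and measurable_solution: "\<And>e. e \<in> sign_vectors \<Longrightarrow> b e \<in> borel_measurable lebesgue"
    and almost_bijection: "\<And>e. e \<in> sign_vectors \<Longrightarrow> almost_bijective (b e) (sign_region D a e)"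
  shows "\<exists>\<beta>. hausdorff_family D A C a \<beta>"
proof -
  have CC: "transpose C ** C = mat 1" "C ** transpose C = mat 1"
    using orthogonal by (auto simp: orthogonal_matrix_def)
  have inv: "matrix_inv C = transpose C"
  proof -
    have "C ** matrix_inv C = mat 1 \<and> matrix_inv C ** C = mat 1"
      unfolding matrix_inv_def by (rule someI[of _ "transpose C"]) (use CC in auto)
    then show ?thesis by (metis CC(2) matrix_mul_assoc matrix_mul_lid matrix_mul_rid)
  qed
  have A_eq: "A u = C ** diag_matrix (a u) ** transpose C" if "u \<in> D" for u
  proof -
    have "C ** diag_matrix (a u) ** transpose C = (C ** transpose C) ** A u ** (C ** transpose C)"
      unfolding diagonalized[OF that, symmetric] inv by (simp add: matrix_mul_assoc)
    then show ?thesis by (simp add: CC)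
  qed
  have det_A: "det (A u) = coord_prod (a u)" if "u \<in> D" for u
  proof -
    have "det C * det (transpose C) = 1"
      using CC(2) by (metis det_I det_mul)
    then show ?thesis by (simp add: A_eq[OF that] det_mul det_diag_matrix mult.commute)
  qed
  have nz: "nonzero_coords (a u)" if "u \<in> D" for u
    using nonsingular[OF that] det_A[OF that] coord_prod_eq_0_iff by metis
  have "a \<in> borel_measurable (lebesgue_on D)"
  proof -
    have [measurable]: "A \<in> borel_measurable (lebesgue_on D)" by fact
    \<comment> \<open>The diagonal entries of \<open>transpose C ** A u ** C\<close>, which are
      linear in the entries of \<open>A u\<close> and equal the eigenvalues on
      \<open>D\<close>.\<close>
    have "(\<lambda>u. \<chi> k. \<Sum>j\<in>UNIV. (\<Sum>i\<in>UNIV. C $ i $ k * A u $ i $ j) * C $ j $ k) \<in> borel_measurable (lebesgue_on D)"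
      by measurable
    moreover have "a u = (\<chi> k. \<Sum>j\<in>UNIV. (\<Sum>i\<in>UNIV. C $ i $ k * A u $ i $ j) * C $ j $ k)" if "u \<in> D" for u
    proof -
      have "a u $ k = (transpose C ** A u ** C) $ k $ k" for k
        using diagonalized[OF that] by (simp add: inv diag_matrix_def)
      then show ?thesis by (simp add: vec_eq_iff matrix_matrix_mult_def transpose_def)
    qed
    ultimately show ?thesis
      by (subst measurable_cong[of "lebesgue_on D" a]) (auto simp: space_restrict_space)
  qed
  then interpret diagonal_family D A C a
    using domain orthogonal nz det_A
    by unfold_locales (auto simp: A_eq stretch_def matrix_vector_mul_assoc[symmetric] diag_matrix_vector)
  have good: "AE t in lebesgue. b e t \<in> D \<and> a (b e t) = (\<chi> k. e $ k * exp (t $ k))" if "e \<in> sign_vectors" for e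
    using unique_solution[OF that]
    by eventually_elim (auto simp: sign_region_def vec_eq_iff intro!: eq_of_sgn_abs_exp)
  \<comment> \<open>Absolute continuity of the logarithmic eigenvalue map. On each sign region this
    map is inverted by \<open>b e\<close>, so the preimage of \<open>N\<close> is covered, up to a
    null set, by the image of a null set.\<close>
  have pullback: "{u \<in> D. ln_abs (a u) \<in> N} \<in> null_sets lebesgue" if N: "N \<in> null_sets lebesgue" for N
  proof -
    have "{u \<in> sign_region D a e. ln_abs (a u) \<in> N} \<in> null_sets lebesgue" if e: "e \<in> sign_vectors" for e
    proof -
      obtain N' where N': "N' \<in> null_sets lebesgue"
        "\<And>t. t \<notin> N' \<Longrightarrow> b e t \<in> D \<and> a (b e t) = (\<chi> k. e $ k * exp (t $ k))"
        using good[OF e] by (auto simp: eventually_ae_filter)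
      have abs_e: "\<bar>e $ k\<bar> = 1" for k
      proof -
        have "e $ k = -1 \<or> e $ k = 1" using e by (simp add: sign_vectors_def)
        then show ?thesis by auto
      qed
      show ?thesis
      proof (rule almost_bijective_subset[OF almost_bijection[OF e]])
        show "N \<union> N' \<in> null_sets lebesgue" using N N'(1) by (rule null_sets.Un)
        fix u t assume u: "u \<in> {u \<in> sign_region D a e. ln_abs (a u) \<in> N}"
        have "t \<in> N \<union> N'" if t: "u = b e t"
        proof (cases "t \<in> N'")
          case False
          then have "ln_abs (a u) = t"
            using N'(2)[of t] abs_e by (simp add: t ln_abs_def vec_eq_iff abs_mult)
          then show ?thesis using u by auto
        qed simp
        then show "u \<in> sign_region D a e \<and> (u = b e t \<longrightarrow> t \<in> N \<union> N')" using u by auto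
      qed
    qed
    then have "(\<Union>e\<in>sign_vectors. {u \<in> sign_region D a e. ln_abs (a u) \<in> N}) \<in> null_sets lebesgue"
      by (intro null_sets_UN' countable_finite finite_sign_vectors)
    then show ?thesis
    proof (rule null_sets_completion_subset[rotated])
      show "{u \<in> D. ln_abs (a u) \<in> N} \<subseteq> (\<Union>e\<in>sign_vectors. {u \<in> sign_region D a e. ln_abs (a u) \<in> N})"
      proof
        fix u assume u: "u \<in> {u \<in> D. ln_abs (a u) \<in> N}"
        then have "sgn_vec (a u) \<in> sign_vectors" "u \<in> sign_region D a (sgn_vec (a u))"
          using sgn_vec_in_sign_vectors[OF nz] by (auto simp: sign_region_def sgn_vec_def)
        then show "u \<in> (\<Union>e\<in>sign_vectors. {u \<in> sign_region D a e. ln_abs (a u) \<in> N})"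
          using u by blast
      qed
    qed
  qed
  \<comment> \<open>Lebesgue measurability of \<open>b e\<close> would not survive composition with
    \<open>ln_abs\<close> and with maps on product spaces.\<close>
  have "\<forall>e. \<exists>g. e \<in> sign_vectors \<longrightarrow> g \<in> borel_measurable borel \<and> (AE t in lebesgue. b e t = g t)"
    using lebesgue_ex_borel_measurable[OF measurable_solution] by metis
  then obtain b' where b': "\<And>e. e \<in> sign_vectors \<Longrightarrow> b' e \<in> borel_measurable borel"
    "\<And>e. e \<in> sign_vectors \<Longrightarrow> AE t in lebesgue. b e t = b' e t" by metis
  \<comment> \<open>At most one summand is nonzero. If y has a zero coordinate, then
    \<open>sgn_vec y\<close> is no sign vector and \<beta> y has the default value 0.\<close>
  define \<beta> where "\<beta> y = (\<Sum>e\<in>sign_vectors. indicator {y. sgn_vec y = e} y *\<^sub>R b' e (ln_abs y))" for y :: "real^'n"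
  have \<beta>_eq: "\<beta> y = b' (sgn_vec y) (ln_abs y)" if "nonzero_coords y" for y
  proof -
    have "\<beta> y = (\<Sum>e\<in>sign_vectors. if e = sgn_vec y then b' (sgn_vec y) (ln_abs y) else 0)"
      unfolding \<beta>_def by (intro sum.cong) (auto simp: indicator_def)
    then show ?thesis using sgn_vec_in_sign_vectors[OF that] by (simp add: finite_sign_vectors)
  qed
  have \<beta>m: "\<beta> \<in> borel_measurable borel"
    unfolding \<beta>_def
  proof (intro borel_measurable_sum borel_measurable_scaleR)
    fix e :: "real^'n" assume e: "e \<in> sign_vectors"
    note [measurable] = b'(1)[OF e]
    show "(\<lambda>y. b' e (ln_abs y)) \<in> borel_measurable borel" by measurable
    show "indicator {y. sgn_vec y = e} \<in> borel_measurable borel" by measurable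
  qed
  have section_eq: "\<exists>N\<in>sets borel. (\<forall>y. y \<notin> N \<longrightarrow> \<beta> y \<in> D \<and> a (\<beta> y) = y \<and> \<beta> y \<notin> Z) \<and>
        (\<forall>c. nonzero_coords c \<longrightarrow> (AE u in lebesgue. u \<in> D \<longrightarrow> c * a u \<notin> N))" if Z: "Z \<in> null_sets lebesgue" for Z
  proof -
    define P where "P e t \<longleftrightarrow> b' e t \<in> D \<and> a (b' e t) = (\<chi> k. e $ k * exp (t $ k)) \<and> b' e t \<notin> Z" for e t
    have "\<forall>e\<in>sign_vectors. \<exists>B. B \<in> null_sets lborel \<and> {t \<in> space lborel. \<not> P e t} \<subseteq> B"
    proof
      fix e :: "real^'n" assume e: "e \<in> sign_vectors"
      have "AE t in lebesgue. t \<notin> {t. b e t \<in> Z}"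
        by (rule AE_not_in[OF null_vimage_almost_bijective[OF almost_bijection[OF e] Z]])
      then have "AE t in lebesgue. P e t"
        using good[OF e] b'(2)[OF e] by eventually_elim (simp add: P_def)
      then have "AE t in lborel. P e t" by (simp only: AE_completion_iff)
      then show "\<exists>B. B \<in> null_sets lborel \<and> {t \<in> space lborel. \<not> P e t} \<subseteq> B"
        by (simp only: eventually_ae_filter Bex_def)
    qed
    from bchoice[OF this] obtain B where
      "\<forall>e\<in>sign_vectors. B e \<in> null_sets lborel \<and> {t \<in> space lborel. \<not> P e t} \<subseteq> B e" ..
    then have B: "\<And>e. e \<in> sign_vectors \<Longrightarrow> B e \<in> null_sets lborel"
      "\<And>e t. e \<in> sign_vectors \<Longrightarrow> t \<notin> B e \<Longrightarrow> P e t" by auto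
    define B' where "B' = (\<Union>e\<in>sign_vectors. B e)"
    have B': "B' \<in> null_sets lborel"
      unfolding B'_def using B(1) by (intro null_sets_UN' countable_finite finite_sign_vectors)
    then have [measurable]: "B' \<in> sets borel" by auto
    show ?thesis
    proof (intro bexI conjI allI impI)
      show "{y :: real^'n. \<not> nonzero_coords y \<or> ln_abs y \<in> B'} \<in> sets borel" by measurable
      fix y assume "y \<notin> {y :: real^'n. \<not> nonzero_coords y \<or> ln_abs y \<in> B'}"
      then have y: "nonzero_coords y" and ly: "ln_abs y \<notin> B (sgn_vec y)"
        using sgn_vec_in_sign_vectors[of y] by (auto simp: B'_def)
      have "(\<chi> k. sgn_vec y $ k * exp (ln_abs y $ k)) = y"
        using y by (simp add: vec_eq_iff sgn_vec_def ln_abs_def nonzero_coords_def sgn_mult_abs)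
      then show "\<beta> y \<in> D" "a (\<beta> y) = y" "\<beta> y \<notin> Z"
        using B(2)[OF sgn_vec_in_sign_vectors[OF y] ly] by (simp_all add: P_def \<beta>_eq[OF y])
    next
      fix c :: "real^'n" assume c: "nonzero_coords c"
      have "negligible B'"
        using null_sets_completionI[OF B'] by (simp add: negligible_iff_null_sets)
      \<comment> \<open>Multiplication by c is translation by \<open>ln_abs c\<close> in logarithms,
        so c * a u meets the exceptional set exactly when the logarithm of \<open>a u\<close> lies
        in a translate of \<open>B'\<close>.\<close>
      then have "negligible ((+) (- ln_abs c) ` B')" by (rule negligible_translation)
      then have "{u \<in> D. ln_abs (a u) \<in> (+) (- ln_abs c) ` B'} \<in> null_sets lebesgue"
        by (intro pullback) (simp add: negligible_iff_null_sets)
      from AE_not_in[OF this]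
      show "AE u in lebesgue. u \<in> D \<longrightarrow> c * a u \<notin> {y. \<not> nonzero_coords y \<or> ln_abs y \<in> B'}"
      proof eventually_elim
        fix u assume u: "u \<notin> {u \<in> D. ln_abs (a u) \<in> (+) (- ln_abs c) ` B'}"
        show "u \<in> D \<longrightarrow> c * a u \<notin> {y. \<not> nonzero_coords y \<or> ln_abs y \<in> B'}"
        proof
          assume uD: "u \<in> D"
          have "ln_abs (a u) = - ln_abs c + ln_abs (c * a u)"
            using ln_abs_mult[OF c nz[OF uD]] by simp
          then have "ln_abs (c * a u) \<notin> B'" using u uD by (metis (mono_tags, lifting) image_eqI mem_Collect_eq)
          then show "c * a u \<notin> {y. \<not> nonzero_coords y \<or> ln_abs y \<in> B'}"
            using c nz[OF uD] by (simp add: nonzero_coords_mult)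
        qed
      qed
    qed
  qed
  have one_null: "{u \<in> D. a u = 1} \<in> null_sets lebesgue"
  proof (rule null_sets_completion_subset)
    show "{u \<in> D. ln_abs (a u) \<in> {0}} \<in> null_sets lebesgue"
      by (intro pullback) (simp flip: negligible_iff_null_sets)
    show "{u \<in> D. a u = 1} \<subseteq> {u \<in> D. ln_abs (a u) \<in> {0}}"
      by (auto simp: ln_abs_def vec_eq_iff)
  qed
  have nonnull: "{u \<in> D. near_one \<delta> (a u)} \<notin> null_sets lebesgue" if "0 < \<delta>" for \<delta>
  proof
    let ?Z = "{u \<in> D. near_one \<delta> (a u)}" and ?B = "box (\<chi> k. - \<delta>) (\<chi> k. \<delta>) :: (real^'n) set"
    assume Z: "?Z \<in> null_sets lebesgue"
    \<comment> \<open>Near the identity all coordinates are positive, which selects the branch with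
      all signs 1. Were \<open>?Z\<close> null, almost every t would lie outside the open cube
      \<open>?B\<close> of logarithms.\<close>
    have e: "(1 :: real^'n) \<in> sign_vectors" by (simp add: sign_vectors_def)
    have "AE t in lebesgue. t \<notin> {t. b 1 t \<in> ?Z}"
      by (rule AE_not_in[OF null_vimage_almost_bijective[OF almost_bijection[OF e] Z]])
    then have "AE t in lebesgue. t \<notin> ?B"
      using good[OF e]
    proof eventually_elim
      fix t assume t: "t \<notin> {t. b 1 t \<in> ?Z}" "b 1 t \<in> D \<and> a (b 1 t) = (\<chi> k. 1 $ k * exp (t $ k))"
      show "t \<notin> ?B"
      proof
        assume "t \<in> ?B"
        then have "- \<delta> < t $ k \<and> t $ k < \<delta>" for k by (auto simp: mem_box_cart)
        then have "near_one \<delta> (a (b 1 t))" using t(2) by (auto simp: near_one_def less_imp_le)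
        then show False using t by auto
      qed
    qed
    then have "?B \<in> null_sets lebesgue" by (subst (asm) AE_iff_null_sets[symmetric]) auto
    then have "negligible ?B" by (simp add: negligible_iff_null_sets)
    then have "?B = {}" using open_not_negligible open_box by blast
    moreover have "0 \<in> ?B" using \<open>0 < \<delta>\<close> by (simp add: mem_box_cart)
    ultimately show False by simp
  qed
  show ?thesis
    by (intro exI[of _ \<beta>]) (unfold_locales, use \<beta>m section_eq one_null nonnull in auto)
qed


section \<open>Completeness of L2 and Rudin-Shapiro sums\<close>

lemma l2_cases:
  obtains f where "square_integrable f" "F = abs_l2 f"
  using Quotient3_rep_reflp[OF Quotient3_l2, of F] Quotient3_abs_rep[OF Quotient3_l2, of F]
  unfolding l2_rel_def by metis

lemma sum_abs_l2:
  assumes "finite I" "\<And>i. i \<in> I \<Longrightarrow> square_integrable (f i)"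
  shows "square_integrable (\<lambda>x. \<Sum>i\<in>I. f i x) \<and> (\<Sum>i\<in>I. abs_l2 (f i)) = abs_l2 (\<lambda>x. \<Sum>i\<in>I. f i x)"
  using assms
  by (induction I rule: finite_induct)
     (auto simp: square_integrable_zero square_integrable_add zero_l2_def plus_l2.abs_eq l2_rel_def)

(* Riesz-Fischer: the squared sum of the |f k| dominates the squared remainders. *)
lemma l2_summable_norm_convergent:
  fixes F :: "nat \<Rightarrow> 'a::euclidean_space l2"
  assumes sum: "summable (\<lambda>k. norm (F k))"
  shows "convergent (\<lambda>n. \<Sum>k<n. F k)"
proof -
  have "\<forall>k. \<exists>f. square_integrable f \<and> F k = abs_l2 f" using l2_cases by metis
  then obtain f where f: "\<And>k. square_integrable (f k)" and F: "\<And>k. F k = abs_l2 (f k)" by metis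
  have [measurable]: "f k \<in> borel_measurable lebesgue" for k using f by (simp add: square_integrable_def)
  define B where "B = (\<Sum>k. norm (F k))"
  let ?S = "\<lambda>n x. \<Sum>k<n. cmod (f k x)"
  have bound: "(\<integral>\<^sup>+x. ennreal ((?S n x)\<^sup>2) \<partial>lebesgue) \<le> ennreal (B\<^sup>2)" for n
  proof -
    \<comment> \<open>The moduli are viewed as complex-valued functions, so that the triangle
      inequality of \<open>l2\<close> applies to their sum.\<close>
    have sq: "square_integrable (\<lambda>x. complex_of_real (cmod (f k x)))" for k
      using f[of k] by (simp add: square_integrable_def)
    have nrm: "norm (abs_l2 (\<lambda>x. complex_of_real (cmod (f k x)))) = norm (F k)" for k
    proof (rule power2_eq_imp_eq)
      show "(norm (abs_l2 (\<lambda>x. complex_of_real (cmod (f k x)))))\<^sup>2 = (norm (F k))\<^sup>2"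
        using norm_abs_l2[OF sq[of k]] norm_abs_l2[OF f[of k]] by (simp add: F)
    qed auto
    have sqS: "square_integrable (\<lambda>x. \<Sum>k<n. complex_of_real (cmod (f k x)))"
      and eqS: "(\<Sum>k<n. abs_l2 (\<lambda>x. complex_of_real (cmod (f k x)))) = abs_l2 (\<lambda>x. \<Sum>k<n. complex_of_real (cmod (f k x)))"
      using sum_abs_l2[of "{..<n}" "\<lambda>k x. complex_of_real (cmod (f k x))"] sq by auto
    have cS: "(cmod (\<Sum>k<n. complex_of_real (cmod (f k x))))\<^sup>2 = (?S n x)\<^sup>2" for x
      by (simp flip: of_real_sum)
    have nb: "norm (\<Sum>k<n. abs_l2 (\<lambda>x. complex_of_real (cmod (f k x)))) \<le> B"
    proof -
      have "norm (\<Sum>k<n. abs_l2 (\<lambda>x. complex_of_real (cmod (f k x)))) \<le> (\<Sum>k<n. norm (F k))"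
        by (rule order_trans[OF norm_sum]) (simp add: nrm)
      also have "\<dots> \<le> B" unfolding B_def using sum by (intro sum_le_suminf) auto
      finally show ?thesis .
    qed
    have "(\<integral>\<^sup>+x. ennreal ((?S n x)\<^sup>2) \<partial>lebesgue) = ennreal (LINT x|lebesgue. (?S n x)\<^sup>2)"
      using sqS by (intro nn_integral_eq_integral) (auto simp: square_integrable_def cS)
    also have "(LINT x|lebesgue. (?S n x)\<^sup>2) = (norm (\<Sum>k<n. abs_l2 (\<lambda>x. complex_of_real (cmod (f k x)))))\<^sup>2"
      unfolding eqS using norm_abs_l2[OF sqS] by (simp add: cS)
    also have "ennreal ((norm (\<Sum>k<n. abs_l2 (\<lambda>x. complex_of_real (cmod (f k x)))))\<^sup>2) \<le> ennreal (B\<^sup>2)"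
      by (intro ennreal_leI power_mono nb norm_ge_zero)
    finally show ?thesis .
  qed
  have S_mono: "?S m x \<le> ?S n x" if "m \<le> n" for m n x
    using that by (intro sum_mono2) auto
  let ?H = "\<lambda>x. SUP n. ennreal ((?S n x)\<^sup>2)"
  have "(\<integral>\<^sup>+x. ?H x \<partial>lebesgue) = (SUP n. \<integral>\<^sup>+x. ennreal ((?S n x)\<^sup>2) \<partial>lebesgue)"
    by (rule nn_integral_monotone_convergence_SUP)
       (auto simp: incseq_def le_fun_def intro!: ennreal_leI power_mono S_mono sum_nonneg)
  also have "\<dots> \<le> ennreal (B\<^sup>2)" by (intro SUP_least bound)
  finally have Hle: "(\<integral>\<^sup>+x. ?H x \<partial>lebesgue) \<le> ennreal (B\<^sup>2)" .
  then have "AE x in lebesgue. ?H x \<noteq> \<infinity>"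
    by (intro nn_integral_PInf_AE) (auto simp: top_unique)
  then have AE_sum: "AE x in lebesgue. summable (\<lambda>k. cmod (f k x)) \<and> ennreal ((\<Sum>k. cmod (f k x))\<^sup>2) \<le> ?H x"
  proof eventually_elim
    fix x assume "?H x \<noteq> \<infinity>"
    then obtain c where c: "0 \<le> c" "?H x = ennreal c" by (cases "?H x") auto
    have Sc: "(?S n x)\<^sup>2 \<le> c" for n
      using SUP_upper[of n UNIV "\<lambda>n. ennreal ((?S n x)\<^sup>2)"] c by (simp add: ennreal_le_iff)
    then have "?S n x \<le> sqrt c" for n by (intro real_le_rsqrt)
    then have s: "summable (\<lambda>k. cmod (f k x))"
      by (intro bounded_imp_summable[of _ "sqrt c"]) (auto simp: lessThan_Suc_atMost[symmetric] simp del: sum.lessThan_Suc)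
    then have "(\<lambda>n. (?S n x)\<^sup>2) \<longlonglongrightarrow> (\<Sum>k. cmod (f k x))\<^sup>2"
      by (intro tendsto_power summable_LIMSEQ)
    then have "(\<Sum>k. cmod (f k x))\<^sup>2 \<le> c" using Sc by (intro LIMSEQ_le_const2) auto
    then show "summable (\<lambda>k. cmod (f k x)) \<and> ennreal ((\<Sum>k. cmod (f k x))\<^sup>2) \<le> ?H x"
      using s c by (simp add: ennreal_leI)
  qed
  define w where "w x = (\<Sum>k. cmod (f k x))\<^sup>2" for x
  have [measurable]: "w \<in> borel_measurable lebesgue"
    unfolding w_def[abs_def] by (intro borel_measurable_power borel_measurable_suminf) measurable
  have "(\<integral>\<^sup>+x. ennreal (w x) \<partial>lebesgue) \<le> (\<integral>\<^sup>+x. ?H x \<partial>lebesgue)"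
    using AE_sum by (intro nn_integral_mono_AE) (auto simp: w_def elim!: eventually_mono)
  then have "(\<integral>\<^sup>+x. ennreal (w x) \<partial>lebesgue) \<le> ennreal (B\<^sup>2)" using Hle by (rule order_trans)
  then have "(\<integral>\<^sup>+x. ennreal (w x) \<partial>lebesgue) < \<infinity>" by (rule le_less_trans) simp
  then have wint: "integrable lebesgue w"
    by (intro integrableI_nonneg) (auto simp: w_def)
  define G where "G x = (\<Sum>k. f k x)" for x
  have Gm[measurable]: "G \<in> borel_measurable lebesgue"
    unfolding G_def[abs_def] by (rule borel_measurable_suminf) measurable
  have AE_tail: "AE x in lebesgue. \<forall>n. (cmod (G x - (\<Sum>k<n. f k x)))\<^sup>2 \<le> w x"
    using AE_sum
  proof eventually_elim
    fix x assume "summable (\<lambda>k. cmod (f k x)) \<and> ennreal ((\<Sum>k. cmod (f k x))\<^sup>2) \<le> ?H x"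
    then have *: "summable (\<lambda>k. cmod (f k x))" ..
    then have s: "summable (\<lambda>k. f k x)" by (rule summable_norm_cancel)
    show "\<forall>n. (cmod (G x - (\<Sum>k<n. f k x)))\<^sup>2 \<le> w x"
    proof
      fix n
      have "G x - (\<Sum>k<n. f k x) = (\<Sum>k. f (k + n) x)"
        unfolding G_def using suminf_minus_initial_segment[OF s, of n] by simp
      also have "cmod \<dots> \<le> (\<Sum>k. cmod (f (k + n) x))"
        by (intro summable_norm summable_ignore_initial_segment[OF *])
      also have "\<dots> = (\<Sum>k. cmod (f k x)) - ?S n x"
        by (rule suminf_minus_initial_segment[OF *])
      also have "\<dots> \<le> (\<Sum>k. cmod (f k x))" by (simp add: sum_nonneg)
      finally show "(cmod (G x - (\<Sum>k<n. f k x)))\<^sup>2 \<le> w x"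
        unfolding w_def by (intro power_mono) auto
    qed
  qed
  have G: "square_integrable G"
    unfolding square_integrable_def
  proof (intro conjI Gm Bochner_Integration.integrable_bound[OF wint])
    show "AE x in lebesgue. norm ((cmod (G x))\<^sup>2) \<le> norm (w x)"
      using AE_tail by eventually_elim (drule spec[of _ 0], auto)
  qed measurable
  have sums: "square_integrable (\<lambda>x. \<Sum>k<n. f k x)" "(\<Sum>k<n. F k) = abs_l2 (\<lambda>x. \<Sum>k<n. f k x)" for n
    using sum_abs_l2[of "{..<n}" f] f by (auto simp: F)
  have diff: "square_integrable (\<lambda>x. G x - (\<Sum>k<n. f k x))"
    "abs_l2 G - (\<Sum>k<n. F k) = abs_l2 (\<lambda>x. G x - (\<Sum>k<n. f k x))" for n
    using G sums by (auto simp: square_integrable_diff minus_l2.abs_eq l2_rel_def)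
  have "(\<lambda>n. LINT x|lebesgue. (cmod (G x - (\<Sum>k<n. f k x)))\<^sup>2) \<longlonglongrightarrow> (LINT x|(lebesgue::'a measure). 0)"
  proof (rule integral_dominated_convergence[where w=w])
    show "AE x in lebesgue. (\<lambda>n. (cmod (G x - (\<Sum>k<n. f k x)))\<^sup>2) \<longlonglongrightarrow> 0"
      using AE_sum
    proof eventually_elim
      fix x assume "summable (\<lambda>k. cmod (f k x)) \<and> ennreal ((\<Sum>k. cmod (f k x))\<^sup>2) \<le> ?H x"
      then have "summable (\<lambda>k. cmod (f k x))" ..
      then have "(\<lambda>n. \<Sum>k<n. f k x) \<longlonglongrightarrow> G x"
        unfolding G_def by (rule summable_LIMSEQ[OF summable_norm_cancel])
      then have "(\<lambda>n. (cmod (G x - (\<Sum>k<n. f k x)))\<^sup>2) \<longlonglongrightarrow> (cmod (G x - G x))\<^sup>2"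
        by (intro tendsto_intros)
      then show "(\<lambda>n. (cmod (G x - (\<Sum>k<n. f k x)))\<^sup>2) \<longlonglongrightarrow> 0" by simp
    qed
    show "AE x in lebesgue. norm ((cmod (G x - (\<Sum>k<n. f k x)))\<^sup>2) \<le> w x" for n
      using AE_tail by eventually_elim simp
    show "(\<lambda>x. (cmod (G x - (\<Sum>k<n. f k x)))\<^sup>2) \<in> borel_measurable lebesgue" for n
      using diff(1)[of n] unfolding square_integrable_def by (intro borel_measurable_integrable) simp
  qed (simp, rule wint)
  then have "(\<lambda>n. (norm (abs_l2 G - (\<Sum>k<n. F k)))\<^sup>2) \<longlonglongrightarrow> 0"
    by (simp add: diff norm_abs_l2)
  from tendsto_real_sqrt[OF this] have "(\<lambda>n. norm (abs_l2 G - (\<Sum>k<n. F k))) \<longlonglongrightarrow> 0"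
    by simp
  then have "(\<lambda>n. norm ((\<Sum>k<n. F k) - abs_l2 G)) \<longlonglongrightarrow> 0"
    by (simp add: norm_minus_commute)
  then have "(\<lambda>n. \<Sum>k<n. F k) \<longlonglongrightarrow> abs_l2 G"
    by (rule LIM_zero_cancel[OF tendsto_norm_zero_cancel])
  then show ?thesis by (rule convergentI)
qed

text \<open>A subsequence with geometrically small increments converges by the preceding lemma.
  Completeness then passes to the bounded operators, where an absolutely convergent series will be
  summed.\<close>

instance l2 :: (euclidean_space) banach
proof
  fix X :: "nat \<Rightarrow> 'a l2" assume X: "Cauchy X"
  have "\<forall>k. \<exists>N. \<forall>m\<ge>N. \<forall>n\<ge>N. norm (X m - X n) < (1/2)^k"
    using X unfolding Cauchy_iff by simp
  then obtain N where N: "\<And>k m n. N k \<le> m \<Longrightarrow> N k \<le> n \<Longrightarrow> norm (X m - X n) < (1/2)^k" by metis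
  \<comment> \<open>Summing \<open>Suc (N i)\<close> makes \<open>r\<close> strictly increasing and
    at least \<open>N k\<close> at k.\<close>
  define r where "r k = (\<Sum>i\<le>k. Suc (N i))" for k
  have r_le: "N k \<le> r k" for k
    unfolding r_def by (rule order_trans[OF _ member_le_sum[of k]]) auto
  have mono: "strict_mono r" unfolding r_def by (intro strict_monoI_Suc) simp
  have "norm (X (r (Suc k)) - X (r k)) \<le> (1/2)^k" for k
    using N[of k "r (Suc k)" "r k"] r_le[of k] strict_monoD[OF mono, of k "Suc k"] by simp
  then have "summable (\<lambda>k. norm (X (r (Suc k)) - X (r k)))"
    by (intro summable_comparison_test'[OF summable_geometric[of "1/2 :: real"]]) auto
  then have "convergent (\<lambda>n. \<Sum>k<n. X (r (Suc k)) - X (r k))" by (rule l2_summable_norm_convergent)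
  then obtain L where "(\<lambda>n. X (r n) - X (r 0)) \<longlonglongrightarrow> L"
    by (auto simp: convergent_def sum_lessThan_telescope[of "\<lambda>n. X (r n)"])
  from tendsto_add[OF this tendsto_const[of "X (r 0)"]] have "(X \<circ> r) \<longlonglongrightarrow> L + X (r 0)"
    by (simp add: comp_def)
  then show "convergent X" using Cauchy_converges_subseq[OF X mono] by (auto intro: convergentI)
qed

section \<open>Rudin-Shapiro signs for a semigroup of contractions\<close>

lemma rudin_shapiro_step:
  fixes W :: "nat \<Rightarrow> 'a::real_normed_vector \<Rightarrow>\<^sub>L 'a"
  assumes "\<And>m n. W (m + n) = W m o\<^sub>L W n"
  shows "(\<Sum>m<2*N. (if m < N then \<epsilon> m else \<delta> (m - N)) *\<^sub>R W m x) =
    (\<Sum>m<N. \<epsilon> m *\<^sub>R W m x) + W N (\<Sum>m<N. \<delta> m *\<^sub>R W m x)"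
proof -
  have "(\<Sum>m<2*N. (if m < N then \<epsilon> m else \<delta> (m - N)) *\<^sub>R W m x) =
      (\<Sum>m<N. \<epsilon> m *\<^sub>R W m x) + (\<Sum>m=N..<2*N. \<delta> (m - N) *\<^sub>R W m x)"
    by (subst sum.atLeastLessThan_concat[of 0 N "2*N", symmetric, unfolded atLeast0LessThan]) auto
  also have "(\<Sum>m=N..<2*N. \<delta> (m - N) *\<^sub>R W m x) = (\<Sum>m<N. \<delta> m *\<^sub>R W (N + m) x)"
    by (rule sum.reindex_bij_witness[of _ "\<lambda>m. m + N" "\<lambda>m. m - N"]) auto
  also have "\<dots> = W N (\<Sum>m<N. \<delta> m *\<^sub>R W m x)"
    by (simp add: assms blinfun.sum_right blinfun.scaleR_right)
  finally show ?thesis .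
qed

(* The signs satisfy p' = p + W q, q' = p - W q; the bound doubles by the parallelogram law. *)
lemma rudin_shapiro:
  fixes W :: "nat \<Rightarrow> 'a::real_inner \<Rightarrow>\<^sub>L 'a"
  assumes W0: "W 0 = id_blinfun" and W: "\<And>m n. W (m + n) = W m o\<^sub>L W n" and nW: "\<And>m. norm (W m) \<le> 1"
  shows "\<exists>\<epsilon> \<delta>. (\<forall>m. \<bar>\<epsilon> m\<bar> = 1 \<and> \<bar>\<delta> m\<bar> = 1) \<and> (\<forall>x.
    (norm (\<Sum>m<2^k. \<epsilon> m *\<^sub>R W m x))\<^sup>2 + (norm (\<Sum>m<2^k. \<delta> m *\<^sub>R W m x))\<^sup>2 \<le> 2 ^ Suc k * (norm x)\<^sup>2)"
proof (induction k)
  case 0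
  show ?case by (intro exI[of _ "\<lambda>_. 1"]) (simp add: W0)
next
  case (Suc k)
  then obtain \<epsilon> \<delta> :: "nat \<Rightarrow> real" where signs: "\<And>m. \<bar>\<epsilon> m\<bar> = 1" "\<And>m. \<bar>\<delta> m\<bar> = 1"
    and IH: "\<And>x. (norm (\<Sum>m<2^k. \<epsilon> m *\<^sub>R W m x))\<^sup>2 + (norm (\<Sum>m<2^k. \<delta> m *\<^sub>R W m x))\<^sup>2 \<le> 2 ^ Suc k * (norm x)\<^sup>2"
    by blast
  let ?N = "2 ^ k :: nat"
  let ?\<epsilon> = "\<lambda>m. if m < ?N then \<epsilon> m else \<delta> (m - ?N)" and ?\<delta> = "\<lambda>m. if m < ?N then \<epsilon> m else - \<delta> (m - ?N)"
  have "(norm (\<Sum>m<2^Suc k. ?\<epsilon> m *\<^sub>R W m x))\<^sup>2 + (norm (\<Sum>m<2^Suc k. ?\<delta> m *\<^sub>R W m x))\<^sup>2 \<le> 2 ^ Suc (Suc k) * (norm x)\<^sup>2" for x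
  proof -
    let ?p = "\<Sum>m<?N. \<epsilon> m *\<^sub>R W m x" and ?q = "\<Sum>m<?N. \<delta> m *\<^sub>R W m x"
    have e: "(\<Sum>m<2^Suc k. ?\<epsilon> m *\<^sub>R W m x) = ?p + W ?N ?q"
      using rudin_shapiro_step[of W ?N \<epsilon> \<delta>, OF W] by simp
    have d: "(\<Sum>m<2^Suc k. ?\<delta> m *\<^sub>R W m x) = ?p - W ?N ?q"
      using rudin_shapiro_step[of W ?N \<epsilon> "\<lambda>m. - \<delta> m", OF W]
      by (simp add: sum_negf blinfun.minus_right)
    have par: "(norm (p + r))\<^sup>2 + (norm (p - r))\<^sup>2 = 2 * ((norm p)\<^sup>2 + (norm r)\<^sup>2)" for p r :: 'a
      by (simp add: power2_norm_eq_inner inner_add inner_diff inner_commute)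
    have "norm (W ?N ?q) \<le> norm ?q"
      using norm_blinfun[of "W ?N" ?q] mult_right_mono[OF nW norm_ge_zero, of ?N ?q] by simp
    then have "(norm (W ?N ?q))\<^sup>2 \<le> (norm ?q)\<^sup>2" by (intro power_mono) auto
    then have "2 * ((norm ?p)\<^sup>2 + (norm (W ?N ?q))\<^sup>2) \<le> 2 * (2 ^ Suc k * (norm x)\<^sup>2)"
      using IH[of x] by (intro mult_left_mono) linarith+
    also have "\<dots> = 2 ^ Suc (Suc k) * (norm x)\<^sup>2" by simp
    finally show ?thesis unfolding e d par .
  qed
  moreover have "\<And>m. \<bar>?\<epsilon> m\<bar> = 1 \<and> \<bar>?\<delta> m\<bar> = 1" using signs by simp
  ultimately show ?case by (intro exI[of _ ?\<epsilon>] exI[of _ ?\<delta>]) simp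
qed


section \<open>Absence of a unit\<close>

lemma near_one_mult: "near_one \<delta> y \<Longrightarrow> near_one \<epsilon> z \<Longrightarrow> near_one (\<delta> + \<epsilon>) (y * z)"
  unfolding near_one_def
proof
  fix k assume *: "\<forall>k. exp (- \<delta>) \<le> y $ k \<and> y $ k \<le> exp \<delta>" "\<forall>k. exp (- \<epsilon>) \<le> z $ k \<and> z $ k \<le> exp \<epsilon>"
  have "exp (- \<delta>) * exp (- \<epsilon>) \<le> y $ k * z $ k" "y $ k * z $ k \<le> exp \<delta> * exp \<epsilon>"
    using * exp_gt_zero[of "- \<delta>"] exp_gt_zero[of "- \<epsilon>"]
    by (intro mult_mono; meson less_imp_le order_trans exp_ge_zero)+
  then show "exp (- (\<delta> + \<epsilon>)) \<le> (y * z) $ k \<and> (y * z) $ k \<le> exp (\<delta> + \<epsilon>)"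
    by (simp add: exp_add[symmetric])
qed

lemma near_one_cancel:
  assumes y: "near_one \<delta> y" and yz: "near_one \<epsilon> (y * z)"
  shows "near_one (\<delta> + \<epsilon>) z"
proof -
  have pos: "0 < y $ k" for k using y exp_gt_zero[of "- \<delta>"] unfolding near_one_def by (meson less_le_trans)
  let ?i = "\<chi> k. inverse (y $ k)"
  have "near_one \<delta> ?i"
    unfolding near_one_def
  proof
    fix k
    have "inverse (exp \<delta>) \<le> inverse (y $ k)" "inverse (y $ k) \<le> inverse (exp (- \<delta>))"
      using y pos[of k] by (auto simp: near_one_def intro!: le_imp_inverse_le)
    then show "exp (- \<delta>) \<le> ?i $ k \<and> ?i $ k \<le> exp \<delta>" by (simp add: exp_minus)
  qed
  from near_one_mult[OF this yz] show ?thesis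
    using pos by (simp add: times_vec_def less_imp_neq[symmetric] mult.assoc[symmetric])
qed

lemma pred_near_one [measurable (raw)]:
  assumes [measurable]: "f \<in> borel_measurable M"
  shows "Measurable.pred M (\<lambda>x. near_one \<delta> (f x))"
proof -
  have *: "near_one \<delta> y \<longleftrightarrow> (\<forall>k. exp (- \<delta>) \<le> y $ k \<and> 0 \<le> exp \<delta> - y $ k)" for y :: "real^'n"
    by (simp add: near_one_def)
  show ?thesis unfolding * by measurable
qed

text \<open>The group acts simply transitively on the vectors with nonzero coordinates in the
  eigenbasis. With \<open>C *v 1\<close> as base point and \<open>C\<close> orthogonal, this set is
  the copy of the neighbourhood \<open>near_one\<close> in the space on which functions
  live.\<close>

definition near_one_set :: "real^'n^'n \<Rightarrow> real \<Rightarrow> (real^'n) set" where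
  "near_one_set C \<delta> = {x. near_one \<delta> (transpose C *v x)}"

lemma near_one_set_borel [measurable]: "near_one_set C \<delta> \<in> sets borel"
  unfolding near_one_set_def by measurable

lemma stretch_in_near_one_set:
  "orthogonal_matrix C \<Longrightarrow> stretch C y x \<in> near_one_set C \<delta> \<longleftrightarrow> near_one \<delta> (y * (transpose C *v x))"
  by (simp add: near_one_set_def stretch_def transpose_mult_self)

lemma near_one_set_lmeasurable:
  assumes C: "orthogonal_matrix C"
  shows "near_one_set C \<delta> \<in> lmeasurable"
proof -
  have "near_one_set C \<delta> = (*v) C ` cbox (\<chi> k. exp (- \<delta>)) (\<chi> k. exp \<delta>)"
  proof (intro equalityI subsetI)
    fix x assume "x \<in> near_one_set C \<delta>"
    then show "x \<in> (*v) C ` cbox (\<chi> k. exp (- \<delta>)) (\<chi> k. exp \<delta>)"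
      by (intro image_eqI[of _ _ "transpose C *v x"]) (auto simp: near_one_set_def near_one_def mem_box_cart transpose_mult_self[OF C])
  qed (auto simp: near_one_set_def near_one_def mem_box_cart transpose_mult_self[OF C])
  moreover have "compact ((*v) C ` cbox (\<chi> k. exp (- \<delta>)) (\<chi> k. exp \<delta>))"
    by (intro compact_continuous_image compact_cbox linear_continuous_on) (simp add: matrix_vector_mul_bounded_linear)
  ultimately show ?thesis by (simp add: lmeasurable_compact)
qed

lemma near_one_set_measure_pos:
  assumes C: "orthogonal_matrix C" and \<delta>: "0 < \<delta>"
  shows "0 < measure lebesgue (near_one_set C \<delta>)"
proof -
  let ?U = "(*v) (transpose C) -` box (\<chi> k. exp (- \<delta>)) (\<chi> k. exp \<delta>)"
  have "continuous_on UNIV ((*v) (transpose C))"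
    by (intro linear_continuous_on) (simp add: matrix_vector_mul_bounded_linear)
  then have "open ?U" using open_vimage open_box by blast
  moreover have "C *v 1 \<in> ?U" using \<delta> by (simp add: transpose_mult_self[OF C] mem_box_cart)
  ultimately have "\<not> negligible ?U" using open_not_negligible by blast
  moreover have "?U \<subseteq> near_one_set C \<delta>"
    by (auto simp: near_one_set_def near_one_def mem_box_cart less_imp_le)
  ultimately have "\<not> negligible (near_one_set C \<delta>)" using negligible_subset by blast
  then show ?thesis
    using near_one_set_lmeasurable[OF C, of \<delta>] by (simp add: negligible_iff_measure zero_less_measure_iff)
qed

lemma square_integrable_indicator:
  assumes "S \<in> lmeasurable"
  shows "square_integrable (\<lambda>x. indicator S x :: complex)"
proof -
  have "(\<lambda>x. (cmod (indicator S x))\<^sup>2) = (indicator S :: _ \<Rightarrow> real)"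
    by (auto simp: indicator_def)
  then show ?thesis using assms unfolding square_integrable_def
    by (auto simp: fmeasurable_def)
qed

context hausdorff_family begin

text \<open>The kernel uses only stretchings of width \<delta>. From the set of width \<delta> they
  all lead into that of width 2 * \<delta>, so the value is the total integral of the kernel;
  conversely, only points of width 3 * \<delta> can be carried into width 2 * \<delta>.\<close>

lemma bump_operator:
  assumes \<delta>: "0 < \<delta>"
  obtains K T \<kappa> where "K \<in> hausdorff_kernels D A" "represents C lebesgue a' K T" "0 < \<kappa>"
    "\<forall>x \<in> near_one_set C \<delta>. mixture C lebesgue a' K (indicator (near_one_set C (2 * \<delta>))) x = complex_of_real \<kappa>"
    "\<forall>x. mixture C lebesgue a' K (indicator (near_one_set C (2 * \<delta>))) x \<noteq> 0 \<longrightarrow> x \<in> near_one_set C (3 * \<delta>)"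
proof -
  \<comment> \<open>The ball makes the measure finite. Some radius gives a non-null set, since the
    union over all radii is not null.\<close>
  let ?Z = "\<lambda>R. {u \<in> D. near_one \<delta> (a' u)} \<inter> cball 0 (real R)"
  have "(\<Union>R. ?Z R) = {u \<in> D. near_one \<delta> (a u)}"
    using real_arch_simple by (auto simp: a'_def)
  then have "(\<Union>R. ?Z R) \<notin> null_sets lebesgue" using a_near_one_nonnull[OF \<delta>] by simp
  then obtain R where R: "?Z R \<notin> null_sets lebesgue" using null_sets_UN[of ?Z lebesgue] by auto
  have "{u \<in> D. near_one \<delta> (a' u)} = D \<inter> {u \<in> space lebesgue. near_one \<delta> (a' u)}" by auto
  moreover have "{u \<in> space lebesgue. near_one \<delta> (a' u)} \<in> sets lebesgue" by measurable
  ultimately have "{u \<in> D. near_one \<delta> (a' u)} \<in> sets lebesgue" using D by (simp only: sets.Int)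
  then have Z: "?Z R \<in> lmeasurable"
    by (intro fmeasurableI2[OF lmeasurable_cball[of 0 "real R"]]) auto
  define K :: "real^'n \<Rightarrow> complex" where "K = indicator (?Z R)"
  define \<kappa> where "\<kappa> = measure lebesgue (?Z R)"
  have \<kappa>: "0 < \<kappa>" using R Z unfolding \<kappa>_def by (simp add: zero_less_measure_iff null_sets_def fmeasurableD emeasure_eq_measure2)
  have K: "K \<in> hausdorff_kernels D A"
    unfolding kernel_iff stretch_mixture_def stretch_mixture_axioms_def
  proof (intro conjI sigma_finite_lebesgue C a'_measurable allI impI)
    show Km: "K \<in> borel_measurable lebesgue" unfolding K_def using Z by (intro borel_measurable_indicator) (rule fmeasurableD)
    show "nonzero_coords (a' u)" for u using a_nonzero by (simp add: a'_def)
    show "AE u in lebesgue. K u \<noteq> 0 \<longrightarrow> u \<in> D" by (simp add: K_def indicator_def)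
    \<comment> \<open>A lower bound for the determinant over \<open>?Z R\<close>, which keeps the
      weight bounded and hence the weighted kernel integrable.\<close>
    let ?m = "exp (- \<delta>) ^ CARD('n)"
    have le: "\<bar>coord_prod (a' u)\<bar> powr (-1/2) * cmod (K u) \<le> ?m powr (-1/2) * indicator (?Z R) u" for u
    proof (cases "u \<in> ?Z R")
      case True
      then have "exp (- \<delta>) \<le> a' u $ k" for k unfolding near_one_def by blast
      then have "(\<Prod>k\<in>(UNIV::'n set). exp (- \<delta>)) \<le> (\<Prod>k\<in>UNIV. a' u $ k)" by (intro prod_mono) auto
      then have "?m \<le> \<bar>coord_prod (a' u)\<bar>" by (simp add: coord_prod_def)
      then have "\<bar>coord_prod (a' u)\<bar> powr (-1/2) \<le> ?m powr (-1/2)" by (intro powr_mono2') auto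
      then show ?thesis unfolding K_def indicator_simps(1)[OF True] by simp
    qed (simp add: K_def)
    show "integrable lebesgue (\<lambda>u. \<bar>coord_prod (a' u)\<bar> powr (-1/2) * cmod (K u))"
    proof (rule Bochner_Integration.integrable_bound)
      show "integrable lebesgue (\<lambda>u. ?m powr (-1/2) * indicator (?Z R) u)"
        using Z by (intro integrable_mult_right) (auto simp: fmeasurable_def)
      show "(\<lambda>u. \<bar>coord_prod (a' u)\<bar> powr (-1/2) * cmod (K u)) \<in> borel_measurable lebesgue"
        using Km by measurable
    qed (use le in auto)
  qed
  interpret stretch_mixture C lebesgue a' K using K kernel_iff by blast
  obtain T where T: "represents C lebesgue a' K T" using represents_exists by blast
  let ?f = "indicator (near_one_set C (2 * \<delta>)) :: _ \<Rightarrow> complex"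
  show thesis
  proof (rule that[OF K T \<kappa>]; intro ballI allI impI)
    fix x assume x: "x \<in> near_one_set C \<delta>"
    have "mixture C lebesgue a' K ?f x = (LINT u|lebesgue. K u)"
      unfolding mixture_def
    proof (intro Bochner_Integration.integral_cong refl)
      fix u
      show "K u * ?f (stretch C (a' u) x) = K u"
      proof (cases "u \<in> ?Z R")
        case True
        then have "near_one (\<delta> + \<delta>) (a' u * (transpose C *v x))"
          using x by (intro near_one_mult) (auto simp: near_one_set_def)
        then show ?thesis by (simp add: stretch_in_near_one_set[OF C] indicator_def)
      qed (simp add: K_def)
    qed
    also have "\<dots> = complex_of_real (LINT u|lebesgue. indicator (?Z R) u)"
    proof -
      have "K u = complex_of_real (indicator (?Z R) u)" for u
        unfolding K_def by (cases "u \<in> ?Z R") (simp_all only: indicator_simps of_real_1 of_real_0 not_False_eq_True)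
      then show ?thesis by simp
    qed
    also have "\<dots> = complex_of_real \<kappa>" using Z by (simp add: \<kappa>_def)
    finally show "mixture C lebesgue a' K ?f x = complex_of_real \<kappa>" .
  next
    fix x assume "mixture C lebesgue a' K ?f x \<noteq> 0"
    then obtain u where "K u * ?f (stretch C (a' u) x) \<noteq> 0"
      unfolding mixture_def by (metis (mono_tags, lifting) Bochner_Integration.integral_cong integral_zero)
    then have "u \<in> ?Z R" "stretch C (a' u) x \<in> near_one_set C (2 * \<delta>)"
      by (auto simp: K_def indicator_def split: if_splits)
    then have "near_one \<delta> (a' u)" "near_one (2 * \<delta>) (a' u * (transpose C *v x))"
      by (auto simp: stretch_in_near_one_set[OF C])
    from near_one_cancel[OF this] show "x \<in> near_one_set C (3 * \<delta>)" by (simp add: near_one_set_def)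
  qed
qed

text \<open>\<open>F\<close> lies in the range of an element of the algebra, so a left unit would
  have to fix it. The positive pairing shows that \<open>F\<close> is not null, and later supplies
  the size of the matrix coefficients.\<close>

lemma bump_vector:
  assumes \<delta>: "0 < \<delta>"
  obtains T F where "T \<in> hausdorff_operators D A" "F \<in> borel_measurable borel" "square_integrable F"
    "blinfun_apply T (abs_l2 (indicator (near_one_set C (2 * \<delta>)))) = abs_l2 F"
    "\<forall>x. F x \<noteq> 0 \<longrightarrow> x \<in> near_one_set C (3 * \<delta>)"
    "0 < inner (abs_l2 F) (abs_l2 (indicator (near_one_set C \<delta>)))"
proof -
  let ?f = "indicator (near_one_set C (2 * \<delta>)) :: _ \<Rightarrow> complex"
  obtain K T \<kappa> where K: "K \<in> hausdorff_kernels D A" and T: "represents C lebesgue a' K T" and \<kappa>: "0 < \<kappa>"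
    and const: "\<forall>x \<in> near_one_set C \<delta>. mixture C lebesgue a' K ?f x = complex_of_real \<kappa>"
    and supp: "\<forall>x. mixture C lebesgue a' K ?f x \<noteq> 0 \<longrightarrow> x \<in> near_one_set C (3 * \<delta>)"
    by (rule bump_operator[OF \<delta>])
  interpret stretch_mixture C lebesgue a' K using K kernel_iff by blast
  have f: "?f \<in> borel_measurable borel" "square_integrable ?f"
    using square_integrable_indicator[OF near_one_set_lmeasurable[OF C]] by auto
  have g: "square_integrable (indicator (near_one_set C \<delta>) :: _ \<Rightarrow> complex)"
    using square_integrable_indicator[OF near_one_set_lmeasurable[OF C]] .
  have F: "square_integrable (mixture C lebesgue a' K ?f)" by (rule square_integrable_mixture[OF f(2,1)])
  have "inner (mixture C lebesgue a' K ?f x) (indicator (near_one_set C \<delta>) x) = \<kappa> * indicator (near_one_set C \<delta>) x" for x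
    using const by (simp add: indicator_def inner_complex_def)
  then have "inner (abs_l2 (mixture C lebesgue a' K ?f)) (abs_l2 (indicator (near_one_set C \<delta>))) = \<kappa> * measure lebesgue (near_one_set C \<delta>)"
    using near_one_set_lmeasurable[OF C, of \<delta>] by (simp add: inner_abs_l2[OF F g])
  then have *: "0 < inner (abs_l2 (mixture C lebesgue a' K ?f)) (abs_l2 (indicator (near_one_set C \<delta>)))"
    using \<kappa> near_one_set_measure_pos[OF C \<delta>] by simp
  have "T \<in> hausdorff_operators D A" using T K hausdorff_operators_iff by blast
  from this *
  show thesis by (rule that[OF _ borel_measurable_mixture[OF f(1)] F representsD[OF T f] supp])
qed

text \<open>Dominated convergence with the weighted kernel as majorant: at any point other than the
  identity some coordinate differs from 1 and leaves the neighbourhoods eventually.\<close>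

lemma mass_near_one_small:
  assumes K: "K \<in> hausdorff_kernels D A"
  shows "\<exists>\<delta>>0. mixture_mass lebesgue a' (\<lambda>u. indicator {u. near_one \<delta> (a' u)} u * K u) < 1"
proof -
  interpret stretch_mixture C lebesgue a' K using K kernel_iff by blast
  let ?w = "\<lambda>u. \<bar>coord_prod (a' u)\<bar> powr (-1/2) * cmod (K u)"
  let ?v = "\<lambda>n u. \<bar>coord_prod (a' u)\<bar> powr (-1/2) * cmod (indicator {u. near_one (1 / real (Suc n)) (a' u)} u * K u)"
  have "(\<lambda>n. integral\<^sup>L lebesgue (?v n)) \<longlonglongrightarrow> (LINT u|(lebesgue :: (real^'n) measure). 0)"
  proof (rule integral_dominated_convergence[where w="?w"])
    show "AE u in lebesgue. (\<lambda>n. ?v n u) \<longlonglongrightarrow> 0"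
      using AE_not_in[OF a_eq_one_null] kernel_AE_D[OF K]
    proof eventually_elim
      fix u assume u: "u \<notin> {u \<in> D. a u = 1}" "K u \<noteq> 0 \<longrightarrow> u \<in> D"
      show "(\<lambda>n. ?v n u) \<longlonglongrightarrow> 0"
      proof (cases "K u = 0")
        case False
        then have "a' u \<noteq> 1" using u by simp
        then obtain k where k: "a' u $ k \<noteq> 1" by (auto simp: vec_eq_iff)
        have e1: "(\<lambda>n. exp (1 / real (Suc n))) \<longlonglongrightarrow> exp 0" "(\<lambda>n. exp (- (1 / real (Suc n)))) \<longlonglongrightarrow> exp (-0)"
          by (intro tendsto_intros LIMSEQ_Suc lim_1_over_n)+
        have "eventually (\<lambda>n. \<not> near_one (1 / real (Suc n)) (a' u)) sequentially"
        proof (cases "a' u $ k < 1")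
          case True
          then have "eventually (\<lambda>n. a' u $ k < exp (- (1 / real (Suc n)))) sequentially"
            using order_tendstoD(1)[OF e1(2)] by simp
          then show ?thesis by eventually_elim (auto simp: near_one_def not_le)
        next
          case False
          then have "eventually (\<lambda>n. exp (1 / real (Suc n)) < a' u $ k) sequentially"
            using order_tendstoD(2)[OF e1(1)] k by simp
          then show ?thesis by eventually_elim (auto simp: near_one_def not_le)
        qed
        then have "eventually (\<lambda>n. ?v n u = 0) sequentially" by eventually_elim simp
        then show ?thesis by (rule tendsto_eventually)
      qed simp
    qed
    show "AE u in lebesgue. norm (?v n u) \<le> ?w u" for n
      by (auto simp: norm_mult indicator_def)
    show "?v n \<in> borel_measurable lebesgue" for n by measurable
  qed (simp, rule weight_integrable)
  then have "eventually (\<lambda>n. integral\<^sup>L lebesgue (?v n) < 1) sequentially"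
    by (intro order_tendstoD(2)[of _ 0]) auto
  then obtain n where "integral\<^sup>L lebesgue (?v n) < 1" by (auto simp: eventually_sequentially)
  then show ?thesis
    unfolding mixture_mass_def by (intro exI[of _ "1 / real (Suc n)"]) auto
qed

lemma hausdorff_operators_no_unit: "\<not> has_unit (hausdorff_operators D A)"
proof
  assume "has_unit (hausdorff_operators D A)"
  then obtain E where E: "E \<in> hausdorff_operators D A" "\<And>T. T \<in> hausdorff_operators D A \<Longrightarrow> E o\<^sub>L T = T"
    unfolding has_unit_def by blast
  then obtain L where L: "L \<in> hausdorff_kernels D A" "represents C lebesgue a' L E"
    by (auto simp: hausdorff_operators_iff)
  interpret stretch_mixture C lebesgue a' L using L kernel_iff by blast
  obtain \<epsilon> where \<epsilon>: "0 < \<epsilon>" and small: "mixture_mass lebesgue a' (\<lambda>u. indicator {u. near_one \<epsilon> (a' u)} u * L u) < 1"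
    using mass_near_one_small[OF L(1)] by blast
  \<comment> \<open>The support of \<open>F\<close> has width 3 * \<delta>, so a stretching that
    carries one point of it to another has width at most 6 * \<delta> = \<epsilon>.\<close>
  define \<delta> where "\<delta> = \<epsilon> / 6"
  have \<delta>: "0 < \<delta>" using \<epsilon> by (simp add: \<delta>_def)
  obtain T F where T: "T \<in> hausdorff_operators D A" and F: "F \<in> borel_measurable borel" "square_integrable F"
    and TF: "blinfun_apply T (abs_l2 (indicator (near_one_set C (2 * \<delta>)))) = abs_l2 F"
    and supp: "\<forall>x. F x \<noteq> 0 \<longrightarrow> x \<in> near_one_set C (3 * \<delta>)"
    and pos: "0 < inner (abs_l2 F) (abs_l2 (indicator (near_one_set C \<delta>)))"
    by (rule bump_vector[OF \<delta>])
  have EF: "blinfun_apply E (abs_l2 F) = abs_l2 F"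
    using E(2)[OF T] TF by (metis blinfun_apply_blinfun_compose)
  have F0: "abs_l2 F \<noteq> 0" using pos by auto
  have "\<bar>inner (blinfun_apply E (abs_l2 F)) (abs_l2 F)\<bar> \<le>
      mixture_mass lebesgue a' (\<lambda>u. indicator {u. near_one \<epsilon> (a' u)} u * L u) * norm (abs_l2 F) * norm (abs_l2 F)"
  proof (rule inner_localized_le[OF L(2) _ F F(2)])
    have "{u \<in> space lebesgue. near_one \<epsilon> (a' u)} \<in> sets lebesgue" by measurable
    then show "{u. near_one \<epsilon> (a' u)} \<in> sets lebesgue" by simp
    fix u x assume u: "u \<notin> {u. near_one \<epsilon> (a' u)}" and x: "F x \<noteq> 0"
    show "F (stretch C (a' u) x) = 0"
    proof (rule ccontr)
      assume "F (stretch C (a' u) x) \<noteq> 0"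
      from supp[rule_format, OF this] have "near_one (3 * \<delta>) ((transpose C *v x) * a' u)"
        by (simp add: stretch_in_near_one_set[OF C] mult.commute)
      moreover have "near_one (3 * \<delta>) (transpose C *v x)" using supp[rule_format, OF x] by (simp add: near_one_set_def)
      ultimately have "near_one (3 * \<delta> + 3 * \<delta>) (a' u)" using near_one_cancel by blast
      then show False using u by (simp add: \<delta>_def)
    qed
  qed
  then have "(norm (abs_l2 F))\<^sup>2 \<le> mixture_mass lebesgue a' (\<lambda>u. indicator {u. near_one \<epsilon> (a' u)} u * L u) * (norm (abs_l2 F))\<^sup>2"
    by (simp add: EF power2_norm_eq_inner[symmetric] power2_eq_square mult.assoc)
  also have "\<dots> < 1 * (norm (abs_l2 F))\<^sup>2"
    using small F0 by (intro mult_strict_right_mono) auto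
  finally show False by simp
qed

end


section \<open>Failure of closedness\<close>

definition dilate :: "real \<Rightarrow> (real^'n \<Rightarrow> complex) \<Rightarrow> real^'n \<Rightarrow> complex" where
  "dilate s f x = complex_of_real (sqrt (s ^ CARD('n))) * f (s *\<^sub>R x)"

lemma stretch_const: "orthogonal_matrix C \<Longrightarrow> stretch C (\<chi> k. s) x = s *\<^sub>R x"
proof -
  assume C: "orthogonal_matrix C"
  have "(\<chi> k. s) * y = s *\<^sub>R y" for y :: "real^'a" by (simp add: vec_eq_iff)
  then show ?thesis by (simp add: stretch_def matrix_vector_mult_scaleR transpose_mult_self[OF C])
qed

context diagonal_family begin

text \<open>Introduced through a mixture over a one-point space, so that the mass bound and
  \<open>mixture_compose_hausdorff\<close> apply to it. The choice is meaningful for s > 0, where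
  the mixture has mass 1.\<close>

definition dilation :: "real \<Rightarrow> (real^'n) l2 \<Rightarrow>\<^sub>L (real^'n) l2" where
  "dilation s = (SOME W. represents C (count_space (UNIV :: unit set)) (\<lambda>_. \<chi> k. s)
     (\<lambda>_. complex_of_real (sqrt (s ^ CARD('n)))) W)"

lemma mixture_dilate:
  "mixture C (count_space (UNIV :: unit set)) (\<lambda>_. \<chi> k. s) (\<lambda>_. complex_of_real (sqrt (s ^ CARD('n)))) f = dilate s f"
  by (simp add: fun_eq_iff mixture_def dilate_def lebesgue_integral_count_space_finite stretch_const[OF C])

lemma dilation_mixture:
  assumes s: "0 < s"
  shows "stretch_mixture C (count_space (UNIV :: unit set)) (\<lambda>_. \<chi> k. s) (\<lambda>_. complex_of_real (sqrt (s ^ CARD('n))))"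
    and "mixture_mass (count_space (UNIV :: unit set)) (\<lambda>_. \<chi> k. s :: real^'n) (\<lambda>_. complex_of_real (sqrt (s ^ CARD('n)))) = 1"
proof -
  show "stretch_mixture C (count_space (UNIV :: unit set)) (\<lambda>_. \<chi> k. s) (\<lambda>_. complex_of_real (sqrt (s ^ CARD('n))))"
    unfolding stretch_mixture_def stretch_mixture_axioms_def
    using s C by (auto simp: sigma_finite_measure_count_space_finite nonzero_coords_def integrable_count_space)
  have "(s ^ CARD('n)) powr (-1/2) * sqrt (s ^ CARD('n)) = 1"
    using s by (simp add: powr_half_sqrt[symmetric] powr_add[symmetric])
  then show "mixture_mass (count_space (UNIV :: unit set)) (\<lambda>_. \<chi> k. s :: real^'n) (\<lambda>_. complex_of_real (sqrt (s ^ CARD('n)))) = 1"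
    using s by (simp add: mixture_mass_def lebesgue_integral_count_space_finite coord_prod_def)
qed

lemma dilation_represents:
  assumes s: "0 < s"
  shows "represents C (count_space (UNIV :: unit set)) (\<lambda>_. \<chi> k. s) (\<lambda>_. complex_of_real (sqrt (s ^ CARD('n)))) (dilation s)"
  unfolding dilation_def
  by (rule someI_ex[OF stretch_mixture.represents_exists[OF dilation_mixture(1)[OF s]]])

lemma dilation_abs_l2:
  assumes s: "0 < s" and f: "f \<in> borel_measurable borel" "square_integrable f"
  shows "dilate s f \<in> borel_measurable borel" "square_integrable (dilate s f)"
    "blinfun_apply (dilation s) (abs_l2 f) = abs_l2 (dilate s f)"
  using stretch_mixture.borel_measurable_mixture[OF dilation_mixture(1)[OF s] f(1)]
    stretch_mixture.square_integrable_mixture[OF dilation_mixture(1)[OF s] f(2,1)]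
    representsD[OF dilation_represents[OF s] f]
  unfolding mixture_dilate by auto

lemma norm_dilation_le: "0 < s \<Longrightarrow> norm (dilation s) \<le> 1"
  using stretch_mixture.represents_norm_le[OF dilation_mixture(1) dilation_represents] dilation_mixture(2) by metis

lemma dilation_mult:
  assumes s: "0 < s" and t: "0 < t"
  shows "dilation (s * t) = dilation s o\<^sub>L dilation t"
proof (rule blinfun_eqI)
  fix F :: "(real^'n) l2"
  obtain f where f: "f \<in> borel_measurable borel" "square_integrable f" and F: "F = abs_l2 f" by (rule l2_borel_cases)
  have "dilate (s * t) f = dilate s (dilate t f)"
    by (simp add: fun_eq_iff dilate_def power_mult_distrib real_sqrt_mult mult.commute[of s t])
  then show "blinfun_apply (dilation (s * t)) F = blinfun_apply (dilation s o\<^sub>L dilation t) F"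
    using s t f dilation_abs_l2[OF t f] by (simp add: F dilation_abs_l2)
qed

lemma dilation_one: "dilation 1 = id_blinfun"
proof (rule blinfun_eqI)
  fix F :: "(real^'n) l2"
  obtain f where f: "f \<in> borel_measurable borel" "square_integrable f" and F: "F = abs_l2 f" by (rule l2_borel_cases)
  have "dilate 1 f = f" by (simp add: fun_eq_iff dilate_def)
  then show "blinfun_apply (dilation 1) F = blinfun_apply id_blinfun F"
    using f by (simp add: F dilation_abs_l2)
qed

text \<open>A contraction whose inverse, the dilation by 1/s, is also a contraction.\<close>

lemma norm_dilation:
  assumes s: "0 < s"
  shows "norm (blinfun_apply (dilation s) F) = norm F"
proof (rule antisym)
  have le: "norm (blinfun_apply (dilation t) G) \<le> norm G" if "0 < t" for t and G :: "(real^'n) l2"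
    using norm_blinfun[of "dilation t" G] mult_right_mono[OF norm_dilation_le[OF that] norm_ge_zero, of G] by simp
  show "norm (blinfun_apply (dilation s) F) \<le> norm F" by (rule le[OF s])
  have "blinfun_apply (dilation (1/s)) (blinfun_apply (dilation s) F) = F"
    using dilation_mult[of "1/s" s] s by (simp add: dilation_one flip: blinfun_apply_blinfun_compose)
  then show "norm F \<le> norm (blinfun_apply (dilation s) F)"
    using le[of "1/s" "blinfun_apply (dilation s) F"] s by simp
qed

lemma inner_dilation:
  assumes s: "0 < s"
  shows "inner (blinfun_apply (dilation s) F) (blinfun_apply (dilation s) G) = inner F G"
  using norm_dilation[OF s, of F] norm_dilation[OF s, of G] norm_dilation[OF s, of "F + G"]
  by (simp add: dot_norm blinfun.add_right)

end

text \<open>The index ranges from 2^k to 2^(k+1) - 1 do not overlap, so an exponent determines its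
  block.\<close>

lemma dyadic_ranges_disjoint:
  fixes j k i l :: nat
  assumes "j < 2 ^ k" "i < 2 ^ l" "2 ^ k + j = 2 ^ l + i"
  shows "k = l"
proof (rule ccontr)
  assume "k \<noteq> l"
  then consider "Suc k \<le> l" | "Suc l \<le> k" by linarith
  then show False
  proof cases
    case 1
    then have "(2::nat) ^ Suc k \<le> 2 ^ l" by (intro power_increasing) auto
    then show False using assms by simp
  next
    case 2
    then have "(2::nat) ^ Suc l \<le> 2 ^ k" by (intro power_increasing) auto
    then show False using assms by simp
  qed
qed

text \<open>Different exponents separate the coordinates by a factor of at least exp 10, which
  exceeds the combined tolerance exp (\<delta> + \<epsilon>). The number 10 is above the width sums
  used below, 3 + 1 and 3 + 3.\<close>

lemma near_one_powers_disjoint: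
  fixes y :: "real^'n"
  assumes d: "\<delta> + \<epsilon> < 10"
    and 1: "near_one \<delta> ((exp 10 ^ m) *\<^sub>R y)" and 2: "near_one \<epsilon> ((exp 10 ^ l) *\<^sub>R y)"
  shows "m = l"
proof -
  have *: "m \<le> l" if d: "\<delta> + \<epsilon> < 10"
    and 1: "near_one \<delta> ((exp 10 ^ m) *\<^sub>R y)" and 2: "near_one \<epsilon> ((exp 10 ^ l) *\<^sub>R y)" for \<delta> \<epsilon> :: real and m l :: nat
  proof (rule ccontr)
    fix k :: 'n
    assume "\<not> m \<le> l"
    then have lm: "Suc l \<le> m" by simp
    let ?y = "y $ k"
    have le: "exp 10 ^ m * ?y \<le> exp \<delta>" "exp (- \<epsilon>) \<le> exp 10 ^ l * ?y"
      using 1 2 by (auto simp: near_one_def)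
    have "0 < exp 10 ^ l * ?y" using le(2) exp_gt_zero less_le_trans by blast
    then have y: "0 < ?y" by (simp add: zero_less_mult_iff)
    have "exp 10 * exp (- \<epsilon>) \<le> exp 10 * (exp 10 ^ l * ?y)" using le(2) by simp
    also have "\<dots> = exp 10 ^ Suc l * ?y" by simp
    also have "\<dots> \<le> exp 10 ^ m * ?y"
      using y lm by (intro mult_right_mono power_increasing) auto
    also have "\<dots> \<le> exp \<delta>" by (rule le)
    finally have "exp (10 - \<epsilon>) \<le> exp \<delta>" by (simp add: exp_diff exp_minus divide_inverse)
    then show False using d by simp
  qed
  show ?thesis using *[OF d 1 2] *[OF _ 2 1] d by simp
qed

section \<open>A norm-convergent series in the algebra whose limit has no kernel of finite
  mass\<close>

context hausdorff_family begin

lemma dilation_compose_hausdorff: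
  "0 < s \<Longrightarrow> T \<in> hausdorff_operators D A \<Longrightarrow> dilation s o\<^sub>L T \<in> hausdorff_operators D A"
  by (rule mixture_compose_hausdorff[OF dilation_mixture(1) dilation_represents])

lemma hausdorff_operators_scaleR:
  assumes "T \<in> hausdorff_operators D A"
  shows "r *\<^sub>R T \<in> hausdorff_operators D A"
proof -
  have "r *\<^sub>R T = scaleC_op (complex_of_real r) T"
    by (rule blinfun_eqI) (simp add: scaleC_op_apply scaleR_eq_scaleC_l2 blinfun.scaleR_left)
  then show ?thesis using hausdorff_operators_scaleC[OF assms] by simp
qed

lemma hausdorff_operators_sum:
  assumes "finite I" "\<And>i. i \<in> I \<Longrightarrow> T i \<in> hausdorff_operators D A"
  shows "(\<Sum>i\<in>I. T i) \<in> hausdorff_operators D A"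
  using assms by (induction I rule: finite_induct) (auto simp: zero_in_hausdorff_operators hausdorff_operators_add)

lemma sum_localized_mass_le:
  assumes mix: "stretch_mixture C M c K" and I: "finite I" and E: "\<And>i. i \<in> I \<Longrightarrow> E i \<in> sets M"
    and disj: "\<And>i j u. i \<in> I \<Longrightarrow> j \<in> I \<Longrightarrow> u \<in> E i \<Longrightarrow> u \<in> E j \<Longrightarrow> i = j"
  shows "(\<Sum>i\<in>I. mixture_mass M c (\<lambda>u. indicator (E i) u * K u)) \<le> mixture_mass M c K"
proof -
  interpret stretch_mixture C M c K by (rule mix)
  let ?w = "\<lambda>u. \<bar>coord_prod (c u)\<bar> powr (-1/2) * cmod (K u)"
  let ?v = "\<lambda>i u. \<bar>coord_prod (c u)\<bar> powr (-1/2) * cmod (indicator (E i) u * K u)"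
  have int: "integrable M (?v i)" if "i \<in> I" for i
    using stretch_mixture.weight_integrable[OF stretch_mixture_restrict[OF E[OF that]]] .
  have "(\<Sum>i\<in>I. mixture_mass M c (\<lambda>u. indicator (E i) u * K u)) = (LINT u|M. (\<Sum>i\<in>I. ?v i u))"
    unfolding mixture_mass_def using int by (subst Bochner_Integration.integral_sum) auto
  also have "\<dots> \<le> (LINT u|M. ?w u)"
  proof (rule integral_mono)
    show "integrable M (\<lambda>u. \<Sum>i\<in>I. ?v i u)" using int by (rule Bochner_Integration.integrable_sum)
    show "integrable M ?w" by (rule weight_integrable)
    fix u
    show "(\<Sum>i\<in>I. ?v i u) \<le> ?w u"
    proof (cases "\<exists>j\<in>I. u \<in> E j")
      case True
      then obtain j where j: "j \<in> I" "u \<in> E j" by blast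
      have "?v i u = (if i = j then ?w u else 0)" if "i \<in> I" for i
      proof (cases "i = j")
        case False
        then have "u \<notin> E i" using disj that j by blast
        then show ?thesis using False by simp
      qed (simp add: j)
      then have "(\<Sum>i\<in>I. ?v i u) = (\<Sum>i\<in>I. if i = j then ?w u else 0)" by (intro sum.cong) auto
      then show ?thesis using I j by simp
    next
      case False
      then have "(\<Sum>i\<in>I. ?v i u) = 0" by (intro sum.neutral) (auto simp: indicator_def)
      then show ?thesis by simp
    qed
  qed
  finally show ?thesis by (simp add: mixture_mass_def)
qed

lemma hausdorff_operators_not_closed:
  "\<not> closedin (top_of_set bounded_operators) (hausdorff_operators D A)"
proof
  assume closed: "closedin (top_of_set bounded_operators) (hausdorff_operators D A)"
  \<comment> \<open>Powers of a single dilation, since the sign construction needs a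
    semigroup.\<close>
  define W where "W m = dilation (exp 10 ^ m)" for m :: nat
  have W0: "W 0 = id_blinfun" by (simp add: W_def dilation_one)
  have W_add: "W (m + l) = W m o\<^sub>L W l" for m l by (simp add: W_def power_add dilation_mult)
  have W_norm: "norm (W m) \<le> 1" for m by (simp add: W_def norm_dilation_le)
  obtain T F where T: "T \<in> hausdorff_operators D A" and F: "F \<in> borel_measurable borel" "square_integrable F"
    and TF: "blinfun_apply T (abs_l2 (indicator (near_one_set C (2 * 1)))) = abs_l2 F"
    and supp: "\<forall>x. F x \<noteq> 0 \<longrightarrow> x \<in> near_one_set C (3 * 1)"
    and pos: "0 < inner (abs_l2 F) (abs_l2 (indicator (near_one_set C 1)))"
    using bump_vector[OF zero_less_one] by blast
  define f where "f = (indicator (near_one_set C 2) :: real^'n \<Rightarrow> complex)"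
  define g where "g = (indicator (near_one_set C 1) :: real^'n \<Rightarrow> complex)"
  have f: "f \<in> borel_measurable borel" "square_integrable f" and g: "g \<in> borel_measurable borel" "square_integrable g"
    using square_integrable_indicator[OF near_one_set_lmeasurable[OF C]] by (auto simp: f_def g_def)
  define \<gamma> where "\<gamma> = inner (abs_l2 F) (abs_l2 g)"
  have \<gamma>: "0 < \<gamma>" using pos by (simp add: \<gamma>_def g_def)
  have TF: "blinfun_apply T (abs_l2 f) = abs_l2 F" using TF by (simp add: f_def)
  \<comment> \<open>The dilates of \<open>F\<close> and of \<open>g\<close> form a biorthogonal
    system up to the factor \<gamma>: for different exponents their supports are disjoint, and for
    equal exponents the dilation is unitary.\<close>
  have orth: "inner (blinfun_apply (W m) (abs_l2 F)) (blinfun_apply (W l) (abs_l2 g)) = (if m = l then \<gamma> else 0)" for m l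
  proof (cases "m = l")
    case True
    then show ?thesis by (simp add: W_def inner_dilation \<gamma>_def)
  next
    case False
    have "inner (dilate (exp 10 ^ m) F x) (dilate (exp 10 ^ l) g x) = 0" for x
    proof (rule ccontr)
      assume "inner (dilate (exp 10 ^ m) F x) (dilate (exp 10 ^ l) g x) \<noteq> 0"
      then have "F (exp 10 ^ m *\<^sub>R x) \<noteq> 0" "g (exp 10 ^ l *\<^sub>R x) \<noteq> 0" by (auto simp: dilate_def)
      then have "near_one 3 (exp 10 ^ m *\<^sub>R (transpose C *v x))" "near_one 1 (exp 10 ^ l *\<^sub>R (transpose C *v x))"
        using supp by (auto simp: g_def near_one_set_def indicator_def matrix_vector_mult_scaleR split: if_splits)
      then show False using near_one_powers_disjoint[of 3 1 m "transpose C *v x" l] False by simp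
    qed
    then show ?thesis
      using False F g by (simp add: W_def dilation_abs_l2 inner_abs_l2)
  qed
  \<comment> \<open>Only the first of the two companion sums is kept; the second served the
    induction.\<close>
  have "\<forall>k. \<exists>\<epsilon>. (\<forall>m. \<bar>\<epsilon> m\<bar> = 1) \<and> (\<forall>x. (norm (\<Sum>m<2^k. \<epsilon> m *\<^sub>R W m x))\<^sup>2 \<le> 2 ^ Suc k * (norm x)\<^sup>2)"
  proof
    fix k
    obtain \<epsilon> \<delta> :: "nat \<Rightarrow> real" where "\<forall>m. \<bar>\<epsilon> m\<bar> = 1 \<and> \<bar>\<delta> m\<bar> = 1" and
      *: "\<forall>x. (norm (\<Sum>m<2^k. \<epsilon> m *\<^sub>R W m x))\<^sup>2 + (norm (\<Sum>m<2^k. \<delta> m *\<^sub>R W m x))\<^sup>2 \<le> 2 ^ Suc k * (norm x)\<^sup>2"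
      using rudin_shapiro[of W k, OF W0 W_add W_norm] by blast
    then have "\<forall>m. \<bar>\<epsilon> m\<bar> = 1" by blast
    moreover have "(norm (\<Sum>m<2^k. \<epsilon> m *\<^sub>R W m x))\<^sup>2 \<le> 2 ^ Suc k * (norm x)\<^sup>2" for x
      using *[rule_format, of x] zero_le_power2[of "norm (\<Sum>m<2^k. \<delta> m *\<^sub>R W m x)"] by linarith
    ultimately show "\<exists>\<epsilon>. (\<forall>m. \<bar>\<epsilon> m\<bar> = 1) \<and> (\<forall>x. (norm (\<Sum>m<2^k. \<epsilon> m *\<^sub>R W m x))\<^sup>2 \<le> 2 ^ Suc k * (norm x)\<^sup>2)"
      by blast
  qed
  from choice[OF this] obtain \<epsilon> :: "nat \<Rightarrow> nat \<Rightarrow> real" where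
    \<epsilon>': "\<forall>k. (\<forall>m. \<bar>\<epsilon> k m\<bar> = 1) \<and> (\<forall>x. (norm (\<Sum>m<2^k. \<epsilon> k m *\<^sub>R W m x))\<^sup>2 \<le> 2 ^ Suc k * (norm x)\<^sup>2)" ..
  have \<epsilon>: "\<bar>\<epsilon> k m\<bar> = 1" and RS: "(norm (\<Sum>m<2^k. \<epsilon> k m *\<^sub>R W m x))\<^sup>2 \<le> 2 ^ Suc k * (norm x)\<^sup>2" for k m x
    using \<epsilon>' by blast+
  \<comment> \<open>The shift by 2^k costs nothing in norm, as \<open>W\<close> is isometric, and
    moves the blocks to disjoint ranges of exponents.\<close>
  define R where "R k = (\<Sum>m<2^k. \<epsilon> k m *\<^sub>R W (2^k + m))" for k
  have R_apply: "R k x = W (2^k) (\<Sum>m<2^k. \<epsilon> k m *\<^sub>R W m x)" for k x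
    by (simp add: R_def W_add blinfun.sum_left blinfun.sum_right blinfun.scaleR_left blinfun.scaleR_right)
  have R_norm: "norm (R k) \<le> sqrt 2 * sqrt 2 ^ k" for k
  proof (rule norm_blinfun_bound)
    fix x :: "(real^'n) l2"
    have "norm (R k x) = norm (\<Sum>m<2^k. \<epsilon> k m *\<^sub>R W m x)"
      unfolding R_apply by (subst W_def) (simp add: norm_dilation)
    also have "\<dots> \<le> sqrt (2 ^ Suc k * (norm x)\<^sup>2)" using RS[of k x] by (rule real_le_rsqrt)
    also have "\<dots> = sqrt 2 * sqrt 2 ^ k * norm x" by (simp add: real_sqrt_mult real_sqrt_power)
    finally show "norm (R k x) \<le> sqrt 2 * sqrt 2 ^ k * norm x" .
  qed simp
  have RT_in: "R k o\<^sub>L T \<in> hausdorff_operators D A" for k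
  proof -
    have "R k o\<^sub>L T = (\<Sum>m<2^k. \<epsilon> k m *\<^sub>R (W (2^k + m) o\<^sub>L T))"
      by (rule blinfun_eqI) (simp add: R_def blinfun.sum_left blinfun.scaleR_left)
    then show ?thesis
      using T by (auto simp: W_def intro!: hausdorff_operators_sum hausdorff_operators_scaleR dilation_compose_hausdorff)
  qed
  \<comment> \<open>q * sqrt 2 < 1 makes the series of norms converge, while 2 * q > 1 makes the
    mass of successive blocks grow without bound.\<close>
  define q :: real where "q = 3/5"
  have q: "0 < q" "1 < 2 * q" by (simp_all add: q_def)
  have q2: "q * sqrt 2 < 1"
  proof -
    have "sqrt 2 < 5/3" by (rule real_less_lsqrt) (auto simp: power2_eq_square)
    then show ?thesis by (simp add: q_def)
  qed
  define S where "S N = (\<Sum>k<N. q ^ k *\<^sub>R (R k o\<^sub>L T))" for N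
  have S_in: "S N \<in> hausdorff_operators D A" for N
    unfolding S_def by (intro hausdorff_operators_sum hausdorff_operators_scaleR RT_in) auto
  have "summable (\<lambda>k. norm (q ^ k *\<^sub>R (R k o\<^sub>L T)))"
  proof (rule summable_comparison_test')
    show "summable (\<lambda>k. (sqrt 2 * norm T) * (q * sqrt 2) ^ k)"
      using q q2 by (intro summable_mult summable_geometric) auto
    fix k
    have "norm (q ^ k *\<^sub>R (R k o\<^sub>L T)) \<le> q ^ k * (norm (R k) * norm T)"
      using q norm_blinfun_compose[of "R k" T] by simp
    also have "\<dots> \<le> q ^ k * ((sqrt 2 * sqrt 2 ^ k) * norm T)"
      using q by (intro mult_left_mono mult_right_mono R_norm) auto
    finally show "norm (norm (q ^ k *\<^sub>R (R k o\<^sub>L T))) \<le> (sqrt 2 * norm T) * (q * sqrt 2) ^ k"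
      by (simp add: power_mult_distrib mult_ac)
  qed
  then have "summable (\<lambda>k. q ^ k *\<^sub>R (R k o\<^sub>L T))" by (rule summable_norm_cancel)
  then obtain U where U: "S \<longlonglongrightarrow> U" unfolding S_def summable_iff_convergent convergent_def by blast
  \<comment> \<open>Closedness is relative to the complex-linear operators, so the limit must be
    shown to be one of them.\<close>
  have U_bounded: "U \<in> bounded_operators"
    unfolding bounded_operators_def
  proof (intro CollectI allI)
    fix z and G :: "(real^'n) l2"
    have 1: "(\<lambda>N. S N (scaleC_l2 z G)) \<longlonglongrightarrow> U (scaleC_l2 z G)"
      using U by (intro tendsto_intros)
    have 2: "(\<lambda>N. scaleC_l2 z (S N G)) \<longlonglongrightarrow> scaleC_l2 z (U G)"
      using U by (intro bounded_linear.tendsto[OF bounded_linear_scaleC_l2] tendsto_intros)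
    have "S N (scaleC_l2 z G) = scaleC_l2 z (S N G)" for N
      using S_in hausdorff_operators_subset unfolding bounded_operators_def by blast
    then show "U (scaleC_l2 z G) = scaleC_l2 z (U G)" using 1 2 LIMSEQ_unique by simp
  qed
  obtain Q where Q: "closed Q" "hausdorff_operators D A = bounded_operators \<inter> Q"
    using closed by (auto simp: closedin_closed)
  have "U \<in> Q" using S_in Q U closed_sequentially[of Q S U] by blast
  then have "U \<in> hausdorff_operators D A" using Q U_bounded by blast
  then obtain L where L: "L \<in> hausdorff_kernels D A" "represents C lebesgue a' L U"
    by (auto simp: hausdorff_operators_iff)
  interpret stretch_mixture C lebesgue a' L using L kernel_iff by blast
  \<comment> \<open>Biorthogonality leaves one term of one block, so the coefficient of the partial
    sums is constant once N > k, and the limit inherits it.\<close>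
  have coeff: "inner (U (abs_l2 f)) (W (2^k + j) (abs_l2 g)) = q ^ k * \<epsilon> k j * \<gamma>" if j: "j < 2 ^ k" for k j
  proof -
    have RTF: "inner (R i (abs_l2 F)) (W (2^k + j) (abs_l2 g)) = (if i = k then \<epsilon> k j * \<gamma> else 0)" for i
    proof -
      have "inner (R i (abs_l2 F)) (W (2^k + j) (abs_l2 g)) = (\<Sum>m<2^i. \<epsilon> i m * (if 2^i + m = 2^k + j then \<gamma> else 0))"
        by (simp add: R_def blinfun.sum_left blinfun.scaleR_left inner_sum_left orth)
      also have "\<dots> = (\<Sum>m<2^i. if m = j then (if i = k then \<epsilon> k j * \<gamma> else 0) else 0)"
        using dyadic_ranges_disjoint[OF _ j, of _ i] by (intro sum.cong) auto
      also have "\<dots> = (if i = k then \<epsilon> k j * \<gamma> else 0)" using j by auto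
      finally show ?thesis .
    qed
    have "inner (S N (abs_l2 f)) (W (2^k + j) (abs_l2 g)) = q ^ k * \<epsilon> k j * \<gamma>" if N: "k < N" for N
    proof -
      have "inner (S N (abs_l2 f)) (W (2^k + j) (abs_l2 g)) = (\<Sum>i<N. q ^ i * (if i = k then \<epsilon> k j * \<gamma> else 0))"
        by (simp add: S_def blinfun.sum_left blinfun.scaleR_left inner_sum_left TF RTF)
      also have "\<dots> = (\<Sum>i<N. if i = k then q ^ k * (\<epsilon> k j * \<gamma>) else 0)" by (intro sum.cong) auto
      also have "\<dots> = q ^ k * \<epsilon> k j * \<gamma>" using N by simp
      finally show ?thesis .
    qed
    then have "eventually (\<lambda>N. inner (S N (abs_l2 f)) (W (2^k + j) (abs_l2 g)) = q ^ k * \<epsilon> k j * \<gamma>) sequentially"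
      by (rule eventually_sequentiallyI[of "Suc k"]) simp
    then have "(\<lambda>N. inner (S N (abs_l2 f)) (W (2^k + j) (abs_l2 g))) \<longlonglongrightarrow> q ^ k * \<epsilon> k j * \<gamma>"
      by (rule tendsto_eventually)
    moreover have "(\<lambda>N. inner (S N (abs_l2 f)) (W (2^k + j) (abs_l2 g))) \<longlonglongrightarrow> inner (U (abs_l2 f)) (W (2^k + j) (abs_l2 g))"
      using U by (intro tendsto_intros)
    ultimately show ?thesis using LIMSEQ_unique by blast
  qed
  \<comment> \<open>The u whose stretching can carry the support of the m-th dilate of
    \<open>g\<close> into that of \<open>f\<close>: widths 1 and 2 give 3. The reciprocals of the
    eigenvalues appear because the coordinates of x are eliminated by
    \<open>near_one_cancel\<close>.\<close>
  define E where "E m = {u. near_one 3 (exp 10 ^ m *\<^sub>R (\<chi> k. inverse (a' u $ k)))}" for m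
  have E_sets: "E m \<in> sets lebesgue" for m
  proof -
    have "{u \<in> space lebesgue. near_one 3 (exp 10 ^ m *\<^sub>R (\<chi> k. inverse (a' u $ k)))} \<in> sets lebesgue" by measurable
    then show ?thesis by (simp add: E_def)
  qed
  have local: "\<bar>inner (U (abs_l2 f)) (W m (abs_l2 g))\<bar> \<le>
      mixture_mass lebesgue a' (\<lambda>u. indicator (E m) u * L u) * (norm (abs_l2 f) * norm (abs_l2 g))" for m
  proof -
    have Wg: "W m (abs_l2 g) = abs_l2 (dilate (exp 10 ^ m) g)" "square_integrable (dilate (exp 10 ^ m) g)"
      "norm (abs_l2 (dilate (exp 10 ^ m) g)) = norm (abs_l2 g)"
      using dilation_abs_l2[OF _ g, of "exp 10 ^ m"] norm_dilation[of "exp 10 ^ m" "abs_l2 g"] by (simp_all add: W_def)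
    have "\<bar>inner (U (abs_l2 f)) (abs_l2 (dilate (exp 10 ^ m) g))\<bar> \<le>
        mixture_mass lebesgue a' (\<lambda>u. indicator (E m) u * L u) * norm (abs_l2 f) * norm (abs_l2 (dilate (exp 10 ^ m) g))"
    proof (rule inner_localized_le[OF L(2) E_sets f Wg(2)])
      fix u x assume u: "u \<notin> E m" and gx: "dilate (exp 10 ^ m) g x \<noteq> 0"
      show "f (stretch C (a' u) x) = 0"
      proof (rule ccontr)
        assume "f (stretch C (a' u) x) \<noteq> 0"
        then have 1: "near_one 2 (a' u * (transpose C *v x))"
          by (auto simp: f_def stretch_in_near_one_set[OF C] indicator_def split: if_splits)
        have "near_one 1 (exp 10 ^ m *\<^sub>R (transpose C *v x))"
          using gx by (auto simp: dilate_def g_def near_one_set_def indicator_def matrix_vector_mult_scaleR split: if_splits)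
        also have "exp 10 ^ m *\<^sub>R (transpose C *v x) =
            (a' u * (transpose C *v x)) * (exp 10 ^ m *\<^sub>R (\<chi> k. inverse (a' u $ k)))"
          using nonzero[of u] by (simp add: vec_eq_iff nonzero_coords_def field_simps)
        finally have "near_one (2 + 1) (exp 10 ^ m *\<^sub>R (\<chi> k. inverse (a' u $ k)))"
          using near_one_cancel[OF 1] by blast
        then show False using u by (simp add: E_def)
      qed
    qed
    then show ?thesis by (simp add: Wg mult.assoc)
  qed
  \<comment> \<open>The 2^k coefficients of block k have equal modulus and are controlled by the
    mass of a single kernel \<open>L\<close> on disjoint sets, so their sum is bounded independently
    of k.\<close>
  have bound: "(2 * q) ^ k * \<gamma> \<le> mixture_mass lebesgue a' L * (norm (abs_l2 f) * norm (abs_l2 g))" for k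
  proof -
    have "(2 * q) ^ k * \<gamma> = (\<Sum>j<(2::nat)^k. q ^ k * \<gamma>)" by (simp add: power_mult_distrib)
    also have "\<dots> = (\<Sum>j<2^k. \<bar>inner (U (abs_l2 f)) (W (2^k + j) (abs_l2 g))\<bar>)"
      using \<epsilon> q \<gamma> by (intro sum.cong) (simp_all add: coeff abs_mult)
    also have "\<dots> \<le> (\<Sum>j<2^k. mixture_mass lebesgue a' (\<lambda>u. indicator (E (2^k + j)) u * L u) * (norm (abs_l2 f) * norm (abs_l2 g)))"
      by (intro sum_mono local)
    also have "\<dots> = (\<Sum>j<2^k. mixture_mass lebesgue a' (\<lambda>u. indicator (E (2^k + j)) u * L u)) * (norm (abs_l2 f) * norm (abs_l2 g))"
      by (simp only: sum_distrib_right)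
    also have "\<dots> \<le> mixture_mass lebesgue a' L * (norm (abs_l2 f) * norm (abs_l2 g))"
    proof (intro mult_right_mono sum_localized_mass_le[OF stretch_mixture_axioms])
      fix i j u assume "u \<in> E (2^k + i)" "u \<in> E (2^k + j)"
      then have "2^k + i = 2^k + j" unfolding E_def by (intro near_one_powers_disjoint[of 3 3]) auto
      then show "i = j" by simp
    qed (auto simp: E_sets)
    finally show ?thesis .
  qed
  obtain k where "mixture_mass lebesgue a' L * (norm (abs_l2 f) * norm (abs_l2 g)) / \<gamma> < (2 * q) ^ k"
    using real_arch_pow[OF q(2)] by blast
  then show False using bound[of k] \<gamma> by (simp add: field_simps)
qed

end


theorem theorem3:
  fixes D :: "(real^'n) set"
    and A :: "real^'n \<Rightarrow> real^'n^'n"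
    and C :: "real^'n^'n"
    and a :: "real^'n \<Rightarrow> real^'n"
    and b :: "real^'n \<Rightarrow> real^'n \<Rightarrow> real^'n"
  assumes domain: "D \<in> sets lebesgue"
    and measurable_family: "A \<in> borel_measurable (lebesgue_on D)"
    and nonsingular: "\<And>u. u \<in> D \<Longrightarrow> det (A u) \<noteq> 0"
    and self_adjoint: "\<And>u. u \<in> D \<Longrightarrow> transpose (A u) = A u"
    and commuting: "\<And>u v. u \<in> D \<Longrightarrow> v \<in> D \<Longrightarrow> A u ** A v = A v ** A u"
    and orthogonal: "orthogonal_matrix C"
    and diagonalized: "\<And>u. u \<in> D \<Longrightarrow> matrix_inv C ** A u ** C = diag_matrix (a u)"
    and unique_solution: "\<And>e. e \<in> sign_vectors \<Longrightarrow>
      (AE t in lebesgue. \<forall>u. (u \<in> sign_region D a e \<and> (\<forall>k. \<bar>a u $ k\<bar> = exp (t $ k))) \<longleftrightarrow> u = b e t)"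
    and measurable_solution: "\<And>e. e \<in> sign_vectors \<Longrightarrow> b e \<in> borel_measurable lebesgue"
    and almost_bijection: "\<And>e. e \<in> sign_vectors \<Longrightarrow> almost_bijective (b e) (sign_region D a e)"
  shows "(\<forall>K\<in>hausdorff_kernels D A. \<exists>T\<in>bounded_operators. is_hausdorff_operator A K T) \<and>
    operator_subalgebra (hausdorff_operators D A) \<and>
    commutative_operators (hausdorff_operators D A) \<and>
    \<not> has_unit (hausdorff_operators D A) \<and>
    \<not> closedin (top_of_set bounded_operators) (hausdorff_operators D A)"
proof -
  obtain \<beta> where "hausdorff_family D A C a \<beta>"
    using hausdorff_family_exists[OF domain measurable_family nonsingular orthogonal diagonalized
      unique_solution measurable_solution almost_bijection] by blast
  then interpret hausdorff_family D A C a \<beta> .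
  show ?thesis
    using hausdorff_operator_exists hausdorff_operators_subalgebra hausdorff_operators_commute
      hausdorff_operators_no_unit hausdorff_operators_not_closed by blast
qed

end
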